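(* For $r,\hat r>0$ let $D_{4,r,\hat r}$ be the rank 2 distribution generated by rolling, without slipping and twisting, of two spheres of radii $r$ and $\hat r$ one on another. Distributions $D_{4,r,\hat r}$ with different ratios $\frac{\hat r}{r}\ge1$ are not equivalent.
   Context: Let $S$ and $\widehat S$ be round 2-spheres in $\mathbb R^3$ of radii $r$ and $\hat r$ with the induced Riemannian metrics. The state space is the 5-dimensional manifold $M_4=\{B:T_xS\to T_{\hat x}\widehat S\mid x\in S,\ \hat x\in\widehat S,\ B\text{ is an isometry}\}$. A curve $B(t)\in M_4$, $B(t):T_{x(t)}S\to T_{\hat x(t)}\widehat S$, is admissible if (no slipping) $B(t)\dot x(t)=\dot{\hat x}(t)$ and (no twisting) $B(t)$ maps vector fields parallel along $x(t)$ to vector fields parallel along $\hat x(t)$. The velocities of admissible curves form a rank 2 distribution $D_{4,r,\hat r}$ on $M_4$. (For $\hat r=r$ it is integrable.) Two distributions $D_1,D_2$ are called equivalent if there is a diffeomorphism $F$ of the underlying manifolds with $F_*D_1(q)=D_2(F(q))$ for all $q$. *)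

theory Defs
  imports "HOL-Analysis.Analysis"
begin

text \<open>Smooth maps between subsets of Euclidean spaces.\<close>

fun times_differentiable_on ::
    "nat \<Rightarrow> 'a::euclidean_space set \<Rightarrow> ('a \<Rightarrow> 'b::euclidean_space) \<Rightarrow> bool" where
  "times_differentiable_on 0 U f \<longleftrightarrow> continuous_on U f"
| "times_differentiable_on (Suc k) U f \<longleftrightarrow>
     (\<forall>x\<in>U. f differentiable (at x)) \<and>
     (\<forall>v. times_differentiable_on k U (\<lambda>x. frechet_derivative f (at x) v))"

text \<open>The class \<open>C\<^sup>\<infinity>\<close>; meaningful for open \<open>U\<close> only.\<close>

definition smooth_on :: "'a::euclidean_space set \<Rightarrow> ('a \<Rightarrow> 'b::euclidean_space) \<Rightarrow> bool" where
  "smooth_on U f \<longleftrightarrow> (\<forall>k. times_differentiable_on k U f)"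

text \<open>Smoothness of a map defined on an embedded submanifold \<open>M\<close>: it extends smoothly to the
  ambient space near every point of \<open>M\<close>.\<close>

definition smooth_map_on :: "'a::euclidean_space set \<Rightarrow> ('a \<Rightarrow> 'b::euclidean_space) \<Rightarrow> bool" where
  "smooth_map_on M f \<longleftrightarrow>
     (\<forall>p\<in>M. \<exists>U g. open U \<and> p \<in> U \<and> smooth_on U g \<and> (\<forall>q\<in>M \<inter> U. g q = f q))"

definition diffeomorphism ::
    "'a::euclidean_space set \<Rightarrow> 'b::euclidean_space set \<Rightarrow> ('a \<Rightarrow> 'b) \<Rightarrow> bool" where
  "diffeomorphism M N F \<longleftrightarrow>
     bij_betw F M N \<and> smooth_map_on M F \<and> smooth_map_on N (inv_into M F)"

text \<open>A distribution on \<open>M\<close> assigns to each point a set of vectors tangent to \<open>M\<close>. A derivative of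
  \<open>F\<close> within \<open>M\<close> is determined only on tangent vectors of \<open>M\<close>, where it is the differential of
  \<open>F\<close>; see the lemma that follows.\<close>

definition equivalent_distributions ::
    "'a::euclidean_space set \<Rightarrow> ('a \<Rightarrow> 'a set) \<Rightarrow>
     'b::euclidean_space set \<Rightarrow> ('b \<Rightarrow> 'b set) \<Rightarrow> bool" where
  "equivalent_distributions M D\<^sub>1 N D\<^sub>2 \<longleftrightarrow>
     (\<exists>F. diffeomorphism M N F \<and>
          (\<forall>q\<in>M. frechet_derivative F (at q within M) ` D\<^sub>1 q = D\<^sub>2 (F q)))"

lemma frechet_derivative_within_velocity:
  fixes F :: "'a::euclidean_space \<Rightarrow> 'b::euclidean_space" and \<gamma> :: "real \<Rightarrow> 'a"
  assumes F: "smooth_map_on M F" and e: "e > 0"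
    and \<gamma>: "\<gamma> ` {-e<..<e} \<subseteq> M" "\<gamma> 0 = q" "(\<gamma> has_vector_derivative v) (at 0)"
  shows "((F \<circ> \<gamma>) has_vector_derivative frechet_derivative F (at q within M) v) (at 0)"
proof -
  let ?I = "{-e<..<e}"
  have "q \<in> M" using \<gamma> e by force
  then obtain U g where U: "open U" "q \<in> U" "smooth_on U g" "\<forall>p\<in>M \<inter> U. g p = F p"
    using F by (meson smooth_map_on_def)
  have "times_differentiable_on 1 U g" using U(3) by (simp add: smooth_on_def)
  then have "g differentiable (at q)" using U(2) by simp
  then obtain L where L: "(g has_derivative L) (at q)" by (auto simp: differentiable_def)
  obtain d where d: "d > 0" "ball q d \<subseteq> U" using U(1,2) openE by blast
  have "(F has_derivative L) (at q within M)"
    by (rule has_derivative_transform_within[OF has_derivative_at_withinI[OF L] d(1) \<open>q \<in> M\<close>])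
      (use U(4) d(2) in \<open>auto simp: subset_iff dist_commute\<close>)
  then have "(F has_derivative frechet_derivative F (at q within M)) (at q within M)"
    using frechet_derivative_works differentiable_def by blast
  then have "(F has_derivative frechet_derivative F (at q within M)) (at (\<gamma> 0) within \<gamma> ` ?I)"
    using \<gamma>(1,2) has_derivative_subset by blast
  with has_vector_derivative_at_within[OF \<gamma>(3)]
  have "((F \<circ> \<gamma>) has_vector_derivative frechet_derivative F (at q within M) v) (at 0 within ?I)"
    by (rule vector_derivative_diff_chain_within)
  then show ?thesis
    using e at_within_open[of "0::real" ?I] by simp
qed

text \<open>The sphere of radius \<open>r\<close> is \<open>sphere 0 r\<close>; its tangent plane at \<open>x\<close> is the orthogonal
  complement of \<open>x\<close>.\<close>

definition tangent_plane :: "real^3 \<Rightarrow> (real^3) set" where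
  "tangent_plane x = {v. orthogonal x v}"

definition tangent_proj :: "real^3 \<Rightarrow> real^3 \<Rightarrow> real^3" where
  "tangent_proj x v = v - ((x \<bullet> v) / (x \<bullet> x)) *\<^sub>R x"

text \<open>The covariant derivative of a tangent field along a curve, for the Levi-Civita connection of
  the metric induced from \<open>\<real>\<^sup>3\<close>, is the tangential part of its ordinary derivative.\<close>

definition parallel_along ::
    "real set \<Rightarrow> (real \<Rightarrow> real^3) \<Rightarrow> (real \<Rightarrow> real^3) \<Rightarrow> bool" where
  "parallel_along I x V \<longleftrightarrow>
     (\<forall>t\<in>I. V t \<in> tangent_plane (x t) \<and> V differentiable (at t) \<and>
            tangent_proj (x t) (vector_derivative V (at t)) = 0)"

text \<open>A linear map from the plane tangent to \<open>S\<close> at \<open>x\<close> to the plane tangent to the other sphere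
  at \<open>x'\<close> is represented by the \<open>3 \<times> 3\<close> matrix extending it by zero on the normal line through
  \<open>x\<close>. This embeds the state space as a submanifold of a Euclidean space. Isometries reversing
  orientation are included.\<close>

type_synonym state = "(real^3) \<times> (real^3) \<times> (real^3^3)"

definition M4 :: "real \<Rightarrow> real \<Rightarrow> state set" where
  "M4 r r' = {(x, x', B). x \<in> sphere 0 r \<and> x' \<in> sphere 0 r' \<and>
     B *v x = 0 \<and> (*v) B ` tangent_plane x = tangent_plane x' \<and>
     (\<forall>u\<in>tangent_plane x. \<forall>v\<in>tangent_plane x. (B *v u) \<bullet> (B *v v) = u \<bullet> v)}"

definition no_slipping ::
    "real set \<Rightarrow> (real \<Rightarrow> real^3) \<Rightarrow> (real \<Rightarrow> real^3) \<Rightarrow> (real \<Rightarrow> real^3^3) \<Rightarrow> bool" where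
  "no_slipping I x x' B \<longleftrightarrow>
     (\<forall>t\<in>I. B t *v vector_derivative x (at t) = vector_derivative x' (at t))"

definition no_twisting ::
    "real set \<Rightarrow> (real \<Rightarrow> real^3) \<Rightarrow> (real \<Rightarrow> real^3) \<Rightarrow> (real \<Rightarrow> real^3^3) \<Rightarrow> bool" where
  "no_twisting I x x' B \<longleftrightarrow>
     (\<forall>V. parallel_along I x V \<longrightarrow> parallel_along I x' (\<lambda>t. B t *v V t))"

definition admissible :: "real \<Rightarrow> real \<Rightarrow> real set \<Rightarrow> (real \<Rightarrow> state) \<Rightarrow> bool" where
  "admissible r r' I \<gamma> \<longleftrightarrow>
     smooth_on I \<gamma> \<and> \<gamma> ` I \<subseteq> M4 r r' \<and>
     (let x = (\<lambda>t. fst (\<gamma> t)); x' = (\<lambda>t. fst (snd (\<gamma> t))); B = (\<lambda>t. snd (snd (\<gamma> t)))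
      in no_slipping I x x' B \<and> no_twisting I x x' B)"

definition D4 :: "real \<Rightarrow> real \<Rightarrow> state \<Rightarrow> state set" where
  "D4 r r' q = {v. \<exists>e>0. \<exists>\<gamma>. admissible r r' {-e<..<e} \<gamma> \<and> \<gamma> 0 = q \<and>
                     (\<gamma> has_vector_derivative v) (at 0)}"

end

theory Submission
  imports Defs
begin

text \<open>
  An equivalence carries a curve rolled along a great circle to another such curve. Indeed, the first
  variations of length on the two spheres agree, which gives a covector along the rolled curve that is
  constant on every horizontal variation. Pulling the infinitesimal motions of the target back by
  the equivalence turns it into a constant covector \<open>(\<alpha>, \<beta>)\<close> on \<open>so(3) \<times> so(3)\<close>
  vanishing on all motions that are horizontal somewhere along the image curve; for unequal radii this
  forces the image curve into the great circles orthogonal to \<open>\<alpha>\<close> and \<open>\<beta>\<close>.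

  Now turn the direction of rolling at a point of such a curve and look at the resulting displacement
  at a fixed point. Modulo the direction of the curve this traces the projective curve
  \<open>t \<mapsto> [sin t : sin (l t) : cos (l t) - cos t]\<close>, \<open>l\<close> being the ratio of the radii, i.e.
  \<open>[cot d t : cot a t : 1]\<close> in half angles \<open>a = (1 + l) / 2\<close>, \<open>d = (1 - l) / 2\<close>. The
  differential of an equivalence matches the two curves projectively, with one reparametrization that
  serves all base points. The incidences of the curve with itself and with the line at infinity force
  the reparametrization to carry time intervals of length \<open>\<pi> / a\<close> and \<open>\<pi> / d\<close> to
  intervals of the corresponding lengths for the target, so that \<open>a / d\<close>, and therefore
  \<open>l\<close>, is an invariant.
\<close>

section \<open>Linear algebra of the state space\<close>

text \<open>For unequal radii the curves rolled along great circles are the abnormal curves of the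
  distribution, and the constant covector is the Noether momentum of the abnormal extremal. It is
  derived from the equality of the two lengths, so neither Hamiltonian flows nor Lie brackets occur
  and two derivatives of the maps suffice. Equal radii give no such rigidity; hence the argument
  runs towards a target with unequal radii, after inverting the equivalence if necessary. The
  parametrization of the images of the turned curves is never controlled: the normal of the image
  great circle is linear in the initial velocity, and only incidence with it is differentiated. One
  base point alone would prove nothing, since a monotone function can match two nested intervals
  with any two others. As the same function serves every base point, it intertwines two translations
  with two others, and comparing multiples recovers the ratio of their lengths. The ratio 1/3 is
  exceptional: there the projective curve is a conic, without the double point that locates the
  first period. Two different ratios are not both 1/3.\<close>

definition outer :: "real^3 \<Rightarrow> real^3 \<Rightarrow> real^3^3" where
  "outer a b = (\<chi> i j. a $ i * b $ j)"

lemma outer_mult [simp]: "outer a b *v w = (b \<bullet> w) *\<^sub>R a"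
  by (simp add: outer_def matrix_vector_mult_def vec_eq_iff inner_vec_def sum_3 algebra_simps)

lemma matrix_add_mult [simp]: "(A + B) *v w = A *v w + B *v (w :: real^3)" for A B :: "real^3^3"
  by (simp add: matrix_vector_mult_add_rdistrib)

lemma matrix_diff_mult [simp]: "(A - B) *v w = A *v w - B *v (w :: real^3)" for A B :: "real^3^3"
  by (simp add: matrix_vector_mult_diff_rdistrib)

lemma matrix_scaleR_mult [simp]: "(c *\<^sub>R A) *v w = c *\<^sub>R (A *v (w :: real^3))" for A :: "real^3^3"
  by (simp add: scaleR_matrix_vector_assoc)

lemma matrix_minus_mult [simp]: "(- A) *v w = - (A *v (w :: real^3))" for A :: "real^3^3"
  by (metis matrix_diff_mult diff_0 matrix_vector_mult_0)

lemma bounded_bilinear_matrix_vector_mult: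
  "bounded_bilinear (\<lambda>(A :: real^3^3) (w :: real^3). A *v w)"
  unfolding bilinear_conv_bounded_bilinear[symmetric] bilinear_def
  by (auto intro!: linearI simp: matrix_vector_right_distrib matrix_vector_mult_scaleR)

lemma bounded_bilinear_outer: "bounded_bilinear outer"
  unfolding bilinear_conv_bounded_bilinear[symmetric] bilinear_def
  by (auto intro!: linearI simp: outer_def vec_eq_iff algebra_simps)

lemma bounded_bilinear_cross3: "bounded_bilinear cross3"
  using bilinear_cross bilinear_conv_bounded_bilinear by blast

lemma dot_vector_matrix: "(y v* B) \<bullet> a = y \<bullet> (B *v a)" for B :: "real^3^3"
  by (rule dot_lmul_matrix)

definition cross_matrix :: "real^3 \<Rightarrow> real^3^3" where
  "cross_matrix \<xi> = matrix (cross3 \<xi>)"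

lemma cross_matrix_mult [simp]: "cross_matrix \<xi> *v w = cross3 \<xi> w"
proof -
  have "linear (cross3 \<xi>)"
    by (auto intro!: linearI simp: cross_add_right cross_mult_right)
  then show ?thesis by (simp add: cross_matrix_def)
qed

text \<open>The isometry of tangent planes extended by mapping one outward unit normal to the other.\<close>

definition completed :: "real \<Rightarrow> real \<Rightarrow> state \<Rightarrow> real^3^3" where
  "completed r r' = (\<lambda>(x, x', B). B + (1 / (r * r')) *\<^sub>R outer x' x)"

lemma completed_mult:
  "completed r r' (x, x', B) *v a = B *v a + ((x \<bullet> a) / (r * r')) *\<^sub>R x'"
  by (simp add: completed_def)

context
  fixes r r' :: real
  assumes r: "r > 0" and r': "r' > 0"
begin

text \<open>Since \<open>B\<close> vanishes on the normal line, splitting off the normal component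
  turns the conditions on the tangent plane into identities for all vectors. These can be
  differentiated along curves without following the moving plane.\<close>

lemma M4_D:
  assumes "(x, x', B) \<in> M4 r r'"
  shows "x \<bullet> x = r\<^sup>2" "x' \<bullet> x' = r'\<^sup>2" "B *v x = 0" "x' \<bullet> (B *v a) = 0"
    "(B *v a) \<bullet> (B *v b) = a \<bullet> b - (x \<bullet> a) * (x \<bullet> b) / r\<^sup>2"
proof -
  have q: "norm x = r" "norm x' = r'" "B *v x = 0" "(*v) B ` tangent_plane x = tangent_plane x'"
    "\<And>u v. u \<in> tangent_plane x \<Longrightarrow> v \<in> tangent_plane x \<Longrightarrow> (B *v u) \<bullet> (B *v v) = u \<bullet> v"
    using assms by (auto simp: M4_def)
  show xx: "x \<bullet> x = r\<^sup>2" "x' \<bullet> x' = r'\<^sup>2" "B *v x = 0" using q by (auto simp: power2_norm_eq_inner[symmetric])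
  define t where "t a = a - ((x \<bullet> a) / r\<^sup>2) *\<^sub>R x" for a
  have t: "t a \<in> tangent_plane x" for a
    using xx r by (simp add: t_def tangent_plane_def orthogonal_def inner_diff_right)
  have Bt: "B *v a = B *v t a" for a
    using xx by (simp add: t_def matrix_vector_mult_diff_distrib matrix_vector_mult_scaleR)
  have "B *v t a \<in> tangent_plane x'" using q(4) t by blast
  then show "x' \<bullet> (B *v a) = 0" by (simp add: Bt[of a] tangent_plane_def orthogonal_def)
  have "(B *v a) \<bullet> (B *v b) = t a \<bullet> t b" unfolding Bt[of a] Bt[of b] using q(5) t by blast
  also have "\<dots> = a \<bullet> b - (x \<bullet> a) * (x \<bullet> b) / r\<^sup>2"
    using r by (simp add: t_def inner_diff_left inner_diff_right xx inner_commute[of a x] power2_eq_square)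
  finally show "(B *v a) \<bullet> (B *v b) = a \<bullet> b - (x \<bullet> a) * (x \<bullet> b) / r\<^sup>2" .
qed

lemma completed_orthogonal:
  assumes "x \<bullet> x = r\<^sup>2" "x' \<bullet> x' = r'\<^sup>2" "\<And>a. x' \<bullet> (B *v a) = 0"
    "\<And>a b. (B *v a) \<bullet> (B *v b) = a \<bullet> b - (x \<bullet> a) * (x \<bullet> b) / r\<^sup>2"
  shows "orthogonal_transformation ((*v) (completed r r' (x, x', B)))"
    "orthogonal_matrix (completed r r' (x, x', B))"
proof -
  let ?R = "completed r r' (x, x', B)"
  have "(?R *v a) \<bullet> (?R *v b) = a \<bullet> b" for a b
    using r r' by (simp add: completed_mult inner_add_left inner_add_right assms
        inner_commute[of "B *v _" x'] power2_eq_square)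
  then show "orthogonal_transformation ((*v) ?R)"
    by (simp add: orthogonal_transformation_def)
  then show "orthogonal_matrix ?R"
    using orthogonal_transformation_matrix[of "(*v) ?R"] by (metis matrix_of_matrix_vector_mul)
qed

text \<open>Only surjectivity onto the second tangent plane needs an argument: the completed matrix
  is orthogonal, hence onto, and a preimage of a vector tangent at \<open>x'\<close> has no
  component along \<open>x\<close>.\<close>

lemma M4_I:
  assumes "x \<bullet> x = r\<^sup>2" "x' \<bullet> x' = r'\<^sup>2" "B *v x = 0" "\<And>a. x' \<bullet> (B *v a) = 0"
    "\<And>a b. (B *v a) \<bullet> (B *v b) = a \<bullet> b - (x \<bullet> a) * (x \<bullet> b) / r\<^sup>2"
  shows "(x, x', B) \<in> M4 r r'"
proof -
  let ?R = "completed r r' (x, x', B)"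
  have n: "norm x = r" "norm x' = r'" using assms(1,2) r r' by (simp_all add: norm_eq_sqrt_inner)
  have "y \<in> (*v) B ` tangent_plane x" if y: "y \<in> tangent_plane x'" for y
  proof -
    obtain a where a: "y = ?R *v a"
      using orthogonal_transformation_surj[OF completed_orthogonal(1)[OF assms(1,2,4,5)]]
      by (metis surjD)
    have "x' \<bullet> y = ((x \<bullet> a) / (r * r')) * r'\<^sup>2"
      by (simp add: a completed_mult inner_add_right assms)
    moreover have "x' \<bullet> y = 0" using y by (simp add: tangent_plane_def orthogonal_def)
    ultimately have "x \<bullet> a = 0" using r r' by simp
    then show ?thesis using a by (auto simp: completed_mult tangent_plane_def orthogonal_def)
  qed
  then show ?thesis
    using n assms by (auto simp: M4_def tangent_plane_def orthogonal_def)
qed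

lemma M4_orientation:
  assumes q: "(x, x', B) \<in> M4 r r'"
  obtains \<epsilon> :: real where "\<epsilon>\<^sup>2 = 1"
    "\<And>v. x \<bullet> v = 0 \<Longrightarrow> B *v cross3 x v = (\<epsilon> * (r / r')) *\<^sub>R cross3 x' (B *v v)"
proof -
  let ?R = "completed r r' (x, x', B)"
  note D = M4_D[OF q]
  have o: "orthogonal_matrix ?R" using completed_orthogonal(2) D(1,2,4,5) by blast
  have e: "det ?R * det ?R = 1"
    using det_orthogonal_matrix[OF o] by auto
  have "B *v cross3 x v = (det ?R * (r / r')) *\<^sub>R cross3 x' (B *v v)" if "x \<bullet> v = 0" for v
  proof -
    have "cross3 (?R *v x) (?R *v v) = det ?R *\<^sub>R (?R *v cross3 x v)"
      by (rule cross_orthogonal_matrix[OF o])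
    then have "(r / r') *\<^sub>R cross3 x' (B *v v) = det ?R *\<^sub>R (B *v cross3 x v)"
      using r r' that by (simp add: completed_mult D dot_cross_self cross_mult_left power2_eq_square)
    then have "det ?R *\<^sub>R ((r / r') *\<^sub>R cross3 x' (B *v v)) = (det ?R * det ?R) *\<^sub>R (B *v cross3 x v)"
      by simp
    then show ?thesis using e by simp
  qed
  then show ?thesis using that[of "det ?R"] e by (simp add: power2_eq_square)
qed

text \<open>\<open>y v* B\<close> is the transpose of \<open>B\<close> applied to \<open>y\<close>:
  the inverse isometry of the tangent planes, extended by zero on the normal line through
  \<open>x'\<close>.\<close>

lemma M4_transpose:
  assumes q: "(x, x', B) \<in> M4 r r'"
  shows "B *v (y v* B) = y - ((x' \<bullet> y) / r'\<^sup>2) *\<^sub>R x'"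
    "(y v* B) \<bullet> (y v* B) = y \<bullet> y - (x' \<bullet> y)\<^sup>2 / r'\<^sup>2"
proof -
  note D = M4_D[OF q]
  let ?R = "completed r r' (x, x', B)"
  show B: "B *v (y v* B) = y - ((x' \<bullet> y) / r'\<^sup>2) *\<^sub>R x'"
  proof -
    obtain a where a: "y = ?R *v a"
      using orthogonal_transformation_surj[OF completed_orthogonal(1)[OF D(1,2,4,5)]]
      by (metis surjD)
    have xy: "x' \<bullet> y = ((x \<bullet> a) / (r * r')) * r'\<^sup>2"
      by (simp add: a completed_mult inner_add_right D)
    have "y v* B = a - ((x \<bullet> a) / r\<^sup>2) *\<^sub>R x"
    proof (rule vector_eq_rdot[THEN iffD1], rule allI)
      fix z
      show "(y v* B) \<bullet> z = (a - ((x \<bullet> a) / r\<^sup>2) *\<^sub>R x) \<bullet> z"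
        by (simp add: dot_vector_matrix a completed_mult inner_add_left inner_diff_left D)
    qed
    then have "B *v (y v* B) = B *v a"
      by (simp add: matrix_vector_mult_diff_distrib matrix_vector_mult_scaleR D)
    then show ?thesis using xy a r' by (simp add: completed_mult power2_eq_square)
  qed
  show "(y v* B) \<bullet> (y v* B) = y \<bullet> y - (x' \<bullet> y)\<^sup>2 / r'\<^sup>2"
    by (simp add: dot_vector_matrix B inner_diff_right inner_commute[of y x'] power2_eq_square)
qed

end

text \<open>Horizontal lift of a velocity \<open>v\<close> of the first contact point. The matrix
  part is forced: \<open>B *v x = 0\<close> determines its value at \<open>x\<close>, and on tangent
  vectors the absence of twisting leaves only a normal component, fixed by tangency of the
  image.\<close>

definition hor :: "real \<Rightarrow> real \<Rightarrow> state \<Rightarrow> real^3 \<Rightarrow> state" where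
  "hor r r' = (\<lambda>(x, x', B) v. (v, B *v v, - ((1 / r\<^sup>2) *\<^sub>R outer (B *v v) x) - (1 / r'\<^sup>2) *\<^sub>R outer x' v))"

text \<open>Velocity at the identity of the action by pairs of rotations of the two spheres; \<xi>
  and \<eta> are the angular velocities.\<close>

definition act :: "real^3 \<Rightarrow> real^3 \<Rightarrow> state \<Rightarrow> state" where
  "act \<xi> \<eta> = (\<lambda>(x, x', B). (cross3 \<xi> x, cross3 \<eta> x', cross_matrix \<eta> ** B - B ** cross_matrix \<xi>))"

lemma matrix_eqI: "(\<And>w. A *v w = B *v w) \<Longrightarrow> A = B" for A B :: "real^3^3"
  by (simp add: matrix_eq)

lemma matrix_eqI_orthogonal:
  fixes A B :: "real^3^3"
  assumes "x \<noteq> 0" "A *v x = B *v x" "\<And>w. x \<bullet> w = 0 \<Longrightarrow> A *v w = B *v w"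
  shows "A = B"
proof (rule matrix_eqI)
  fix w
  define t where "t = w - ((x \<bullet> w) / (x \<bullet> x)) *\<^sub>R x"
  have "x \<bullet> t = 0" using assms(1) by (simp add: t_def inner_diff_right)
  then have "A *v t = B *v t" by (rule assms(3))
  then show "A *v w = B *v w"
    using assms(2) by (simp add: t_def matrix_vector_mult_diff_distrib matrix_vector_mult_scaleR)
qed

lemma cross3_orthogonal:
  assumes "x \<bullet> u = 0" "x \<bullet> v = 0" "x \<noteq> 0"
  shows "cross3 u v = ((x \<bullet> cross3 u v) / (x \<bullet> x)) *\<^sub>R x"
proof -
  let ?c = "cross3 u v"
  have "cross3 x ?c = 0" using assms by (simp add: Lagrange)
  then have "(x \<bullet> ?c) *\<^sub>R x - (x \<bullet> x) *\<^sub>R ?c = 0" using Lagrange[of x x ?c] by simp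
  then have "(x \<bullet> x) *\<^sub>R ?c = (x \<bullet> ?c) *\<^sub>R x" by simp
  then have "(1 / (x \<bullet> x)) *\<^sub>R ((x \<bullet> x) *\<^sub>R ?c) = (1 / (x \<bullet> x)) *\<^sub>R ((x \<bullet> ?c) *\<^sub>R x)" by simp
  then show ?thesis using assms(3) by simp
qed

lemma cross3_unit:
  assumes "x \<bullet> x = r\<^sup>2" "r > 0" "u \<bullet> u = 1" "x \<bullet> u = 0"
  shows "((1 / r) *\<^sub>R cross3 x u) \<bullet> ((1 / r) *\<^sub>R cross3 x u) = 1"
proof -
  have "(norm (cross3 x u))\<^sup>2 = (x \<bullet> x) * (u \<bullet> u)"
    using norm_cross_dot[of x u] assms(4) by (simp add: power_mult_distrib dot_square_norm)
  then show ?thesis using assms by (simp add: dot_square_norm power2_eq_square)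
qed

lemma cross3_cross3_left:
  assumes "x \<bullet> y = 0"
  shows "cross3 (cross3 x y) x = (x \<bullet> x) *\<^sub>R y"
  using Lagrange[of x x y] assms by (subst cross_skew) simp

lemma cross_triple: "a \<bullet> cross3 b c = cross3 a b \<bullet> c"
  by (simp add: cross3_simps)

lemma matrix_mult_mult [simp]: "(A ** B) *v w = A *v (B *v w)" for A B :: "real^3^3"
  by (simp add: matrix_vector_mul_assoc)

context
  fixes r r' :: real
  assumes r: "r > 0" and r': "r' > 0"
begin

text \<open>The stabilizer of a state: both spheres turn about the contact normal. The factor
  compensates for the orientation and for the different lengths of \<open>x\<close> and
  \<open>x'\<close>.\<close>

lemma act_isotropy:
  assumes q: "(x, x', B) \<in> M4 r r'"
    and e: "\<And>v. x \<bullet> v = 0 \<Longrightarrow> B *v cross3 x v = (\<epsilon> * (r / r')) *\<^sub>R cross3 x' (B *v v)"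
  shows "act x ((\<epsilon> * (r / r')) *\<^sub>R x') (x, x', B) = 0"
proof -
  note D = M4_D[OF r r' q]
  have "cross_matrix ((\<epsilon> * (r / r')) *\<^sub>R x') ** B - B ** cross_matrix x = 0"
    by (rule matrix_eqI_orthogonal[of x])
      (use D r in \<open>auto simp: e cross_mult_left\<close>)
  then show ?thesis by (simp add: act_def cross_mult_left zero_prod_def)
qed

text \<open>Rolling is infinitesimally a motion whose two axes are tangent and correspond under
  \<open>B\<close> up to a factor. On the tangent plane the matrix part has only a normal component,
  because the cross product of two tangent vectors is normal.\<close>

lemma act_hor:
  assumes q: "(x, x', B) \<in> M4 r r'"
    and e: "\<And>v. x \<bullet> v = 0 \<Longrightarrow> B *v cross3 x v = (\<epsilon> * (r / r')) *\<^sub>R cross3 x' (B *v v)"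
    and \<xi>: "x \<bullet> \<xi> = 0"
  shows "act \<xi> ((\<epsilon> * (r / r')) *\<^sub>R (B *v \<xi>)) (x, x', B) = hor r r' (x, x', B) (cross3 \<xi> x)"
proof -
  note D = M4_D[OF r r' q]
  have x0: "x \<noteq> 0" "x' \<noteq> 0" using D r r' by auto
  let ?\<eta> = "(\<epsilon> * (r / r')) *\<^sub>R (B *v \<xi>)"
  have v: "B *v cross3 \<xi> x = cross3 ?\<eta> x'"
  proof -
    have "B *v cross3 \<xi> x = - (B *v cross3 x \<xi>)"
      by (subst cross_skew) (metis matrix_vector_mult_scaleR scaleR_minus1_left)
    also have "\<dots> = cross3 ?\<eta> x'"
      unfolding e[OF \<xi>] by (subst (2) cross_skew) (simp add: cross_mult_left cross_mult_right)
    finally show ?thesis .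
  qed
  have "cross_matrix ?\<eta> ** B - B ** cross_matrix \<xi>
    = - ((1 / r\<^sup>2) *\<^sub>R outer (B *v cross3 \<xi> x) x) - (1 / r'\<^sup>2) *\<^sub>R outer x' (cross3 \<xi> x)"
  proof (rule matrix_eqI_orthogonal[OF x0(1)])
    show "(cross_matrix ?\<eta> ** B - B ** cross_matrix \<xi>) *v x =
      (- ((1 / r\<^sup>2) *\<^sub>R outer (B *v cross3 \<xi> x) x) - (1 / r'\<^sup>2) *\<^sub>R outer x' (cross3 \<xi> x)) *v x"
      using D r by (simp add: dot_cross_self)
  next
    fix w assume w: "x \<bullet> w = 0"
    have "B *v cross3 \<xi> w = 0"
      by (subst cross3_orthogonal[OF \<xi> w x0(1)]) (simp add: matrix_vector_mult_scaleR D)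
    moreover have "cross3 ?\<eta> (B *v w) = ((x' \<bullet> cross3 ?\<eta> (B *v w)) / (x' \<bullet> x')) *\<^sub>R x'"
      by (rule cross3_orthogonal) (use x0 D in auto)
    moreover have "x' \<bullet> cross3 ?\<eta> (B *v w) = - (cross3 \<xi> x \<bullet> w)"
    proof -
      have "x' \<bullet> cross3 ?\<eta> (B *v w) = ((\<epsilon> * (r / r')) *\<^sub>R cross3 x' (B *v \<xi>)) \<bullet> (B *v w)"
        by (simp add: cross_triple[of x' "B *v \<xi>"] cross_mult_left)
      also have "\<dots> = cross3 x \<xi> \<bullet> w"
        unfolding e[OF \<xi>, symmetric] by (simp add: D w)
      also have "\<dots> = - (cross3 \<xi> x \<bullet> w)" by (metis cross_skew inner_minus_left)
      finally show ?thesis .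
    qed
    ultimately show "(cross_matrix ?\<eta> ** B - B ** cross_matrix \<xi>) *v w =
      (- ((1 / r\<^sup>2) *\<^sub>R outer (B *v cross3 \<xi> x) x) - (1 / r'\<^sup>2) *\<^sub>R outer x' (cross3 \<xi> x)) *v w"
      using D(2) w by simp
  qed
  then show ?thesis unfolding act_def hor_def using v by simp
qed

end

section \<open>Second derivatives\<close>

text \<open>The mean value theorem is applied in both orders to the second difference of \<open>f\<close> over a
  small parallelogram.\<close>

lemma mixed_directional_derivatives:
  fixes f :: "'a::real_normed_vector \<Rightarrow> real"
  assumes U: "open U" "p \<in> U"
    and fv: "\<And>x. x \<in> U \<Longrightarrow> ((\<lambda>s. f (x + s *\<^sub>R v)) has_real_derivative fv x) (at 0)"
    and fw: "\<And>x. x \<in> U \<Longrightarrow> ((\<lambda>s. f (x + s *\<^sub>R w)) has_real_derivative fw x) (at 0)"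
    and fvw: "\<And>x. x \<in> U \<Longrightarrow> ((\<lambda>s. fv (x + s *\<^sub>R w)) has_real_derivative fvw x) (at 0)"
    and fwv: "\<And>x. x \<in> U \<Longrightarrow> ((\<lambda>s. fw (x + s *\<^sub>R v)) has_real_derivative fwv x) (at 0)"
    and cont: "isCont fvw p" "isCont fwv p"
  shows "fvw p = fwv p"
proof (rule ccontr)
  assume ne: "fvw p \<noteq> fwv p"
  define e where "e = \<bar>fvw p - fwv p\<bar> / 2"
  have e: "e > 0" using ne by (simp add: e_def)
  obtain d0 where d0: "d0 > 0" "ball p d0 \<subseteq> U" using U openE by blast
  obtain d1 where d1: "d1 > 0" "\<And>x. dist x p < d1 \<Longrightarrow> dist (fvw x) (fvw p) < e"
    using cont(1) e unfolding continuous_at_eps_delta by blast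
  obtain d2 where d2: "d2 > 0" "\<And>x. dist x p < d2 \<Longrightarrow> dist (fwv x) (fwv p) < e"
    using cont(2) e unfolding continuous_at_eps_delta by blast
  define d where "d = Min {d0, d1, d2}"
  have d: "d > 0" "d \<le> d0" "d \<le> d1" "d \<le> d2" using d0 d1 d2 by (auto simp: d_def)
  define N where "N = norm v + norm w + 1"
  have N: "N > 0" by (simp add: N_def add_nonneg_pos)
  define h where "h = d / (2 * N)"
  have h: "h > 0" using d N by (simp add: h_def)
  have near: "dist (p + s *\<^sub>R v + t *\<^sub>R w) p < d" if "0 \<le> s" "s \<le> h" "0 \<le> t" "t \<le> h" for s t
  proof -
    have "dist (p + s *\<^sub>R v + t *\<^sub>R w) p \<le> norm (s *\<^sub>R v) + norm (t *\<^sub>R w)"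
      unfolding dist_norm by (metis add.commute add_diff_cancel_left' group_cancel.add1 norm_triangle_ineq)
    also have "\<dots> \<le> h * norm v + h * norm w" using that by (intro add_mono) (auto intro!: mult_right_mono)
    also have "\<dots> \<le> h * N" using h by (simp add: N_def algebra_simps)
    also have "\<dots> = d / 2" using N by (simp add: h_def)
    also have "\<dots> < d" using d by simp
    finally show ?thesis .
  qed
  then have inU: "p + s *\<^sub>R v + t *\<^sub>R w \<in> U" if "0 \<le> s" "s \<le> h" "0 \<le> t" "t \<le> h" for s t
    using d0 d that by (force simp: dist_commute)
  have shift: "((\<lambda>s. k (x + s *\<^sub>R y)) has_real_derivative D) (at s0)"
    if "((\<lambda>s. k ((x + s0 *\<^sub>R y) + s *\<^sub>R y)) has_real_derivative D) (at 0)" for k :: "'a \<Rightarrow> real" and x y D s0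
    using DERIV_shift[of "\<lambda>s. k (x + s *\<^sub>R y)" D 0 s0] that
    by (simp add: algebra_simps scaleR_add_left)
  have fv': "((\<lambda>s. f (p + s *\<^sub>R v + t *\<^sub>R w)) has_real_derivative fv (p + s *\<^sub>R v + t *\<^sub>R w)) (at s)"
    if "0 \<le> s" "s \<le> h" "0 \<le> t" "t \<le> h" for s t
    using shift[of f "p + t *\<^sub>R w" s v] fv[OF inU[OF that]] by (simp add: algebra_simps)
  have fw': "((\<lambda>t. f (p + s *\<^sub>R v + t *\<^sub>R w)) has_real_derivative fw (p + s *\<^sub>R v + t *\<^sub>R w)) (at t)"
    if "0 \<le> s" "s \<le> h" "0 \<le> t" "t \<le> h" for s t
    using shift[of f "p + s *\<^sub>R v" t w] fw[OF inU[OF that]] by (simp add: algebra_simps)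
  have fvw': "((\<lambda>t. fv (p + s *\<^sub>R v + t *\<^sub>R w)) has_real_derivative fvw (p + s *\<^sub>R v + t *\<^sub>R w)) (at t)"
    if "0 \<le> s" "s \<le> h" "0 \<le> t" "t \<le> h" for s t
    using shift[of fv "p + s *\<^sub>R v" t w] fvw[OF inU[OF that]] by (simp add: algebra_simps)
  have fwv': "((\<lambda>s. fw (p + s *\<^sub>R v + t *\<^sub>R w)) has_real_derivative fwv (p + s *\<^sub>R v + t *\<^sub>R w)) (at s)"
    if "0 \<le> s" "s \<le> h" "0 \<le> t" "t \<le> h" for s t
    using shift[of fw "p + t *\<^sub>R w" s v] fwv[OF inU[OF that]] by (simp add: algebra_simps)
  define \<phi> where "\<phi> s t = f (p + s *\<^sub>R v + t *\<^sub>R w)" for s t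
  define \<Delta> where "\<Delta> = \<phi> h h - \<phi> h 0 - (\<phi> 0 h - \<phi> 0 0)"
  have "\<exists>s t. 0 \<le> s \<and> s \<le> h \<and> 0 \<le> t \<and> t \<le> h \<and> \<Delta> = h * (h * fvw (p + s *\<^sub>R v + t *\<^sub>R w))"
  proof -
    have "\<exists>s>0. s < h \<and> (\<phi> h h - \<phi> h 0) - (\<phi> 0 h - \<phi> 0 0)
        = (h - 0) * (fv (p + s *\<^sub>R v + h *\<^sub>R w) - fv (p + s *\<^sub>R v + 0 *\<^sub>R w))"
      unfolding \<phi>_def using h by (intro MVT2[of 0 h "\<lambda>s. f (p + s *\<^sub>R v + h *\<^sub>R w) - f (p + s *\<^sub>R v + 0 *\<^sub>R w)"])
        (auto intro!: DERIV_diff fv' simp del: scaleR_zero_left)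
    then obtain s where s: "0 < s" "s < h" "\<Delta> = h * (fv (p + s *\<^sub>R v + h *\<^sub>R w) - fv (p + s *\<^sub>R v + 0 *\<^sub>R w))"
      by (auto simp: \<Delta>_def)
    have "\<exists>t>0. t < h \<and> fv (p + s *\<^sub>R v + h *\<^sub>R w) - fv (p + s *\<^sub>R v + 0 *\<^sub>R w)
        = (h - 0) * fvw (p + s *\<^sub>R v + t *\<^sub>R w)"
      using h s by (intro MVT2[of 0 h "\<lambda>t. fv (p + s *\<^sub>R v + t *\<^sub>R w)"]) (auto intro!: fvw')
    then obtain t where "0 < t" "t < h" "fv (p + s *\<^sub>R v + h *\<^sub>R w) - fv (p + s *\<^sub>R v + 0 *\<^sub>R w)
        = h * fvw (p + s *\<^sub>R v + t *\<^sub>R w)" by auto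
    with s show ?thesis by (intro exI[of _ s] exI[of _ t]) auto
  qed
  then obtain s t where st: "0 \<le> s" "s \<le> h" "0 \<le> t" "t \<le> h" "\<Delta> = h * (h * fvw (p + s *\<^sub>R v + t *\<^sub>R w))"
    by blast
  have "\<exists>s t. 0 \<le> s \<and> s \<le> h \<and> 0 \<le> t \<and> t \<le> h \<and> \<Delta> = h * (h * fwv (p + s *\<^sub>R v + t *\<^sub>R w))"
  proof -
    have "\<exists>t>0. t < h \<and> (\<phi> h h - \<phi> 0 h) - (\<phi> h 0 - \<phi> 0 0)
        = (h - 0) * (fw (p + h *\<^sub>R v + t *\<^sub>R w) - fw (p + 0 *\<^sub>R v + t *\<^sub>R w))"
      unfolding \<phi>_def using h by (intro MVT2[of 0 h "\<lambda>t. f (p + h *\<^sub>R v + t *\<^sub>R w) - f (p + 0 *\<^sub>R v + t *\<^sub>R w)"])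
        (auto intro!: DERIV_diff fw' simp del: scaleR_zero_left)
    then obtain t where t: "0 < t" "t < h" "\<Delta> = h * (fw (p + h *\<^sub>R v + t *\<^sub>R w) - fw (p + 0 *\<^sub>R v + t *\<^sub>R w))"
      by (auto simp: \<Delta>_def)
    have "\<exists>s>0. s < h \<and> fw (p + h *\<^sub>R v + t *\<^sub>R w) - fw (p + 0 *\<^sub>R v + t *\<^sub>R w)
        = (h - 0) * fwv (p + s *\<^sub>R v + t *\<^sub>R w)"
      using h t by (intro MVT2[of 0 h "\<lambda>s. fw (p + s *\<^sub>R v + t *\<^sub>R w)"]) (auto intro!: fwv')
    then obtain s where "0 < s" "s < h" "fw (p + h *\<^sub>R v + t *\<^sub>R w) - fw (p + 0 *\<^sub>R v + t *\<^sub>R w)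
        = h * fwv (p + s *\<^sub>R v + t *\<^sub>R w)" by auto
    with t show ?thesis by (intro exI[of _ s] exI[of _ t]) auto
  qed
  then obtain s' t' where st': "0 \<le> s'" "s' \<le> h" "0 \<le> t'" "t' \<le> h"
    "\<Delta> = h * (h * fwv (p + s' *\<^sub>R v + t' *\<^sub>R w))" by blast
  have "fvw (p + s *\<^sub>R v + t *\<^sub>R w) = fwv (p + s' *\<^sub>R v + t' *\<^sub>R w)" using st st' h by simp
  moreover have "dist (fvw (p + s *\<^sub>R v + t *\<^sub>R w)) (fvw p) < e"
    using near[OF st(1-4)] d d1(2) by force
  moreover have "dist (fwv (p + s' *\<^sub>R v + t' *\<^sub>R w)) (fwv p) < e"
    using near[OF st'(1-4)] d d2(2) by force
  ultimately show False by (simp add: e_def dist_real_def abs_real_def split: if_splits)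
qed

section \<open>Twice differentiable maps and their derivatives along curves\<close>

lemma isCont_eventually_nhds:
  assumes "isCont f x" "open U" "f x \<in> U"
  shows "\<forall>\<^sub>F y in nhds x. f y \<in> U"
proof -
  have "\<forall>\<^sub>F y in at x. f y \<in> U"
    using assms by (auto simp: isCont_def intro: topological_tendstoD)
  then have "\<forall>\<^sub>F y in nhds x. y \<noteq> x \<longrightarrow> f y \<in> U" by (simp add: eventually_at_filter)
  then show ?thesis by (rule eventually_mono) (use assms(3) in auto)
qed

definition C2_on :: "'a::euclidean_space set \<Rightarrow> ('a \<Rightarrow> 'b::euclidean_space) \<Rightarrow> bool" where
  "C2_on U g \<longleftrightarrow> open U \<and> times_differentiable_on 2 U g"

lemma C2_onD:
  assumes "C2_on U g"
  shows "open U"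
    and "\<And>x. x \<in> U \<Longrightarrow> (g has_derivative frechet_derivative g (at x)) (at x)"
    and "\<And>x v. x \<in> U \<Longrightarrow> ((\<lambda>x. frechet_derivative g (at x) v) has_derivative
          frechet_derivative (\<lambda>x. frechet_derivative g (at x) v) (at x)) (at x)"
    and "\<And>v w. continuous_on U (\<lambda>x. frechet_derivative (\<lambda>x. frechet_derivative g (at x) v) (at x) w)"
  using assms unfolding C2_on_def numeral_2_eq_2 times_differentiable_on.simps
  by (auto simp: frechet_derivative_works[symmetric])

lemma line_derivative:
  assumes "(f has_derivative f') (at x)"
  shows "((\<lambda>s. f (x + s *\<^sub>R v)) has_vector_derivative f' v) (at (0::real))"
proof -
  have "((\<lambda>s. x + s *\<^sub>R v) has_vector_derivative v) (at (0::real))"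
    by (auto intro!: derivative_eq_intros)
  then have "((f \<circ> (\<lambda>s. x + s *\<^sub>R v)) has_vector_derivative f' v) (at 0)"
    by (rule vector_derivative_diff_chain_within) (use assms in \<open>auto intro: has_derivative_at_withinI\<close>)
  then show ?thesis by (simp add: o_def)
qed

definition second_derivative :: "('a::real_normed_vector \<Rightarrow> 'b::real_normed_vector) \<Rightarrow> 'a \<Rightarrow> 'a \<Rightarrow> 'a \<Rightarrow> 'b" where
  "second_derivative g x v w = frechet_derivative (\<lambda>x. frechet_derivative g (at x) v) (at x) w"

lemma second_derivative_symmetric:
  assumes g: "C2_on U g" and p: "p \<in> U"
  shows "second_derivative g p v w = second_derivative g p w v"
proof (rule euclidean_eqI)
  fix i :: 'b assume "i \<in> Basis"
  let ?D = "\<lambda>v x. frechet_derivative g (at x) v"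
  note D = C2_onD[OF g]
  have d1: "((\<lambda>s. g (x + s *\<^sub>R v) \<bullet> i) has_real_derivative ?D v x \<bullet> i) (at 0)" if "x \<in> U" for x v
    unfolding has_real_derivative_iff_has_vector_derivative
    by (rule bounded_linear.has_vector_derivative[OF bounded_linear_inner_left line_derivative[OF D(2)[OF that]]])
  have d2: "((\<lambda>s. ?D v (x + s *\<^sub>R w) \<bullet> i) has_real_derivative second_derivative g x v w \<bullet> i) (at 0)" if "x \<in> U" for x v w
    unfolding has_real_derivative_iff_has_vector_derivative second_derivative_def
    by (rule bounded_linear.has_vector_derivative[OF bounded_linear_inner_left line_derivative[OF D(3)[OF that]]])
  have c: "isCont (\<lambda>x. second_derivative g x v w \<bullet> i) p" for v w
    using D(4)[of v w] D(1) p unfolding second_derivative_def[symmetric]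
    by (intro continuous_intros) (auto simp: continuous_on_eq_continuous_at)
  show "second_derivative g p v w \<bullet> i = second_derivative g p w v \<bullet> i"
    by (rule mixed_directional_derivatives[OF D(1) p, where f="\<lambda>x. g x \<bullet> i" and v=v and w=w
          and fv="\<lambda>x. ?D v x \<bullet> i" and fw="\<lambda>x. ?D w x \<bullet> i"]) (use d1 d2 c in auto)
qed

text \<open>\<open>C2_on\<close> controls the first derivative in each fixed direction only.
  Expanding the moving direction \<open>z t\<close> in an orthonormal basis reduces the claim to
  fixed directions and the product rule.\<close>

lemma second_derivative_chain:
  fixes c :: "real \<Rightarrow> 'a::euclidean_space"
  assumes g: "C2_on U g" and p: "c t \<in> U"
    and c: "(c has_vector_derivative c') (at t)" and z: "(z has_vector_derivative z') (at t)"
  shows "((\<lambda>t. frechet_derivative g (at (c t)) (z t)) has_vector_derivative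
     second_derivative g (c t) (z t) c' + frechet_derivative g (at (c t)) z') (at t)"
proof -
  let ?D = "\<lambda>v x. frechet_derivative g (at x) v"
  note D = C2_onD[OF g]
  have lin: "linear (\<lambda>v. ?D v x)" if "x \<in> U" for x
    using D(2)[OF that] has_derivative_bounded_linear bounded_linear.linear by blast
  have expand: "?D v x = (\<Sum>i\<in>Basis. (v \<bullet> i) *\<^sub>R ?D i x)" if "x \<in> U" for x v
  proof -
    have "?D (\<Sum>i\<in>Basis. (v \<bullet> i) *\<^sub>R i) x = (\<Sum>i\<in>Basis. (v \<bullet> i) *\<^sub>R ?D i x)"
      using lin[OF that] by (simp add: linear_sum linear_scale)
    then show ?thesis by (simp add: euclidean_representation)
  qed
  have Dc: "((\<lambda>t. ?D v (c t)) has_vector_derivative second_derivative g (c t) v c') (at t)" for v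
  proof -
    have "((?D v \<circ> c) has_vector_derivative second_derivative g (c t) v c') (at t)"
      unfolding second_derivative_def
      by (rule vector_derivative_diff_chain_within[OF c]) (use D(3)[OF p, of v] in \<open>auto intro: has_derivative_at_withinI\<close>)
    then show ?thesis by (simp add: o_def)
  qed
  have sd: "second_derivative g (c t) v c' = (\<Sum>i\<in>Basis. (v \<bullet> i) *\<^sub>R second_derivative g (c t) i c')" for v
  proof -
    have "((\<lambda>x. \<Sum>i\<in>Basis. (v \<bullet> i) *\<^sub>R ?D i x) has_derivative
        (\<lambda>w. \<Sum>i\<in>Basis. (v \<bullet> i) *\<^sub>R second_derivative g (c t) i w)) (at (c t))"
      unfolding second_derivative_def
      by (intro has_derivative_sum has_derivative_scaleR_right D(3) p)
    then have "(?D v has_derivative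
        (\<lambda>w. \<Sum>i\<in>Basis. (v \<bullet> i) *\<^sub>R second_derivative g (c t) i w)) (at (c t))"
      by (rule has_derivative_transform_within_open[OF _ D(1) p]) (simp add: expand[symmetric])
    from fun_cong[OF frechet_derivative_at[OF this], of c'] show ?thesis
      unfolding second_derivative_def[of g "c t" v c'] by (rule sym)
  qed
  have "isCont c t" using c has_vector_derivative_continuous by blast
  then have "\<forall>\<^sub>F t in nhds t. c t \<in> U" using D(1) p by (rule isCont_eventually_nhds)
  then obtain T where T: "open T" "t \<in> T" "\<And>t. t \<in> T \<Longrightarrow> c t \<in> U"
    by (auto simp: eventually_nhds)
  have "((\<lambda>t. \<Sum>i\<in>Basis. (z t \<bullet> i) *\<^sub>R ?D i (c t)) has_vector_derivative
     (\<Sum>i\<in>Basis. (z t \<bullet> i) *\<^sub>R second_derivative g (c t) i c' + (z' \<bullet> i) *\<^sub>R ?D i (c t))) (at t)"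
  proof (intro has_vector_derivative_sum has_vector_derivative_scaleR Dc)
    show "((\<lambda>x. z x \<bullet> i) has_real_derivative z' \<bullet> i) (at t)" for i
      unfolding has_real_derivative_iff_has_vector_derivative
      by (rule bounded_linear.has_vector_derivative[OF bounded_linear_inner_left z])
  qed
  then have "((\<lambda>t. ?D (z t) (c t)) has_vector_derivative
     (\<Sum>i\<in>Basis. (z t \<bullet> i) *\<^sub>R second_derivative g (c t) i c' + (z' \<bullet> i) *\<^sub>R ?D i (c t))) (at t)"
    by (rule has_vector_derivative_transform_within_open[OF _ T(1,2)]) (rule expand[OF T(3), symmetric])
  moreover have "(\<Sum>i\<in>Basis. (z t \<bullet> i) *\<^sub>R second_derivative g (c t) i c' + (z' \<bullet> i) *\<^sub>R ?D i (c t))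
    = second_derivative g (c t) (z t) c' + ?D z' (c t)"
    by (simp add: sum.distrib sd[of "z t"] expand[OF p, of z'])
  ultimately show ?thesis by simp
qed

lemma smooth_map_on_extension:
  assumes "smooth_map_on M G" "p \<in> M"
  obtains U g where "C2_on U g" "p \<in> U" "\<And>q. q \<in> M \<inter> U \<Longrightarrow> g q = G q"
  using assms unfolding smooth_map_on_def smooth_on_def C2_on_def by metis

text \<open>Tangency is expressed by curves: on such vectors the derivative of a map within
  \<open>M\<close> agrees with that of every local extension.\<close>

definition velocity_in :: "'a::real_normed_vector set \<Rightarrow> 'a \<Rightarrow> 'a \<Rightarrow> bool" where
  "velocity_in M q v \<longleftrightarrow> (\<exists>\<gamma> e. e > 0 \<and> \<gamma> ` {-e<..<e} \<subseteq> M \<and> \<gamma> 0 = q \<and> (\<gamma> has_vector_derivative v) (at (0::real)))"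

lemma extension_derivative:
  assumes G: "smooth_map_on M G" and g: "C2_on U g" "q \<in> U" "\<And>q. q \<in> M \<inter> U \<Longrightarrow> g q = G q"
    and v: "velocity_in M q v"
  shows "frechet_derivative G (at q within M) v = frechet_derivative g (at q) v"
proof -
  obtain \<gamma> e where ge: "e > 0" "\<gamma> ` {-e<..<e} \<subseteq> M" "\<gamma> 0 = q" "(\<gamma> has_vector_derivative v) (at 0)"
    using v by (auto simp: velocity_in_def)
  have 1: "((G \<circ> \<gamma>) has_vector_derivative frechet_derivative G (at q within M) v) (at 0)"
    by (rule frechet_derivative_within_velocity[OF G ge])
  have 2: "((g \<circ> \<gamma>) has_vector_derivative frechet_derivative g (at q) v) (at 0)"
    by (rule vector_derivative_diff_chain_within[OF ge(4)])
      (use C2_onD(2)[OF g(1,2)] ge(3) in \<open>auto intro: has_derivative_at_withinI\<close>)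
  have "\<forall>\<^sub>F t in nhds 0. \<gamma> t \<in> U"
  proof -
    have "isCont \<gamma> 0" using ge(4) has_vector_derivative_continuous by blast
    then show ?thesis using C2_onD(1)[OF g(1)] by (rule isCont_eventually_nhds) (use g(2) ge(3) in simp)
  qed
  moreover have "\<forall>\<^sub>F t in nhds 0. \<gamma> t \<in> M"
    unfolding eventually_nhds using ge by (intro exI[of _ "{-e<..<e}"]) auto
  ultimately have "\<forall>\<^sub>F t in nhds 0. (g \<circ> \<gamma>) t = (G \<circ> \<gamma>) t"
    by eventually_elim (use g in auto)
  then obtain T where T: "open T" "0 \<in> T" "\<And>t. t \<in> T \<Longrightarrow> (g \<circ> \<gamma>) t = (G \<circ> \<gamma>) t"
    by (auto simp: eventually_nhds)
  have "((G \<circ> \<gamma>) has_vector_derivative frechet_derivative g (at q) v) (at 0)"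
    by (rule has_vector_derivative_transform_within_open[OF 2 T])
  with 1 show ?thesis by (rule vector_derivative_unique_at)
qed

lemma linear_frechet_within:
  assumes "smooth_map_on M G" "q \<in> M"
  shows "linear (frechet_derivative G (at q within M))"
proof -
  obtain U g where g: "C2_on U g" "q \<in> U" "\<And>q. q \<in> M \<inter> U \<Longrightarrow> g q = G q"
    using smooth_map_on_extension[OF assms] by metis
  obtain d where d: "d > 0" "ball q d \<subseteq> U" using C2_onD(1)[OF g(1)] g(2) openE by blast
  have "(G has_derivative frechet_derivative g (at q)) (at q within M)"
    by (rule has_derivative_transform_within[OF has_derivative_at_withinI[OF C2_onD(2)[OF g(1,2)]] d(1) assms(2)])
      (use g(3) d(2) in \<open>auto simp: subset_iff dist_commute\<close>)
  then have "(G has_derivative frechet_derivative G (at q within M)) (at q within M)"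
    using frechet_derivative_works differentiable_def by blast
  then show ?thesis using has_derivative_bounded_linear bounded_linear.linear by blast
qed

lemmas has_vector_derivative_mult = bounded_bilinear.has_vector_derivative[OF bounded_bilinear_matrix_vector_mult]
lemmas has_vector_derivative_outer = bounded_bilinear.has_vector_derivative[OF bounded_bilinear_outer]
lemmas has_vector_derivative_cross3 = bounded_bilinear.has_vector_derivative[OF bounded_bilinear_cross3]
lemmas has_vector_derivative_inner = bounded_bilinear.has_vector_derivative[OF bounded_bilinear_inner]

lemma has_vector_derivative_fst: "(f has_vector_derivative D) F \<Longrightarrow> ((\<lambda>t. fst (f t)) has_vector_derivative fst D) F"
  by (rule bounded_linear.has_vector_derivative[OF bounded_linear_fst])

lemma has_vector_derivative_snd: "(f has_vector_derivative D) F \<Longrightarrow> ((\<lambda>t. snd (f t)) has_vector_derivative snd D) F"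
  by (rule bounded_linear.has_vector_derivative[OF bounded_linear_snd])

lemma locally_constant_derivative:
  assumes f: "(f has_vector_derivative D) (at (t::real))" and T: "open T" "t \<in> T" "\<And>s. s \<in> T \<Longrightarrow> f s = c"
  shows "D = 0"
proof -
  have "(f has_vector_derivative 0) (at t)"
    by (rule has_vector_derivative_transform_within_open[OF has_vector_derivative_const T(1,2)]) (simp add: T(3))
  then show ?thesis using f vector_derivative_unique_at by blast
qed

section \<open>Smooth functions\<close>

lemma times_differentiable_on_Suc_D:
  "times_differentiable_on (Suc k) U f \<Longrightarrow> times_differentiable_on k U f"
proof (induction k arbitrary: f)
  case 0
  then show ?case
    by (auto intro!: continuous_at_imp_continuous_on differentiable_imp_continuous_within)
qed auto

lemma times_differentiable_on_cong:
  assumes "open U" "\<And>x. x \<in> U \<Longrightarrow> f x = g x" "times_differentiable_on k U f"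
  shows "times_differentiable_on k U g"
  using assms(2,3)
proof (induction k arbitrary: f g)
  case 0
  then show ?case using continuous_on_cong by auto
next
  case (Suc k)
  have d: "(g has_derivative frechet_derivative f (at x)) (at x)" if "x \<in> U" for x
  proof -
    have "(f has_derivative frechet_derivative f (at x)) (at x)"
      using Suc.prems(2) that by (simp add: frechet_derivative_works)
    then show ?thesis by (rule has_derivative_transform_within_open[OF _ assms(1) that]) (rule Suc.prems(1))
  qed
  have e: "frechet_derivative f (at x) = frechet_derivative g (at x)" if "x \<in> U" for x
    by (rule frechet_derivative_at[OF d[OF that]])
  show ?case
    unfolding times_differentiable_on.simps
  proof (intro conjI ballI allI)
    show "g differentiable at x" if "x \<in> U" for x using d[OF that] by (auto simp: differentiable_def)
    show "times_differentiable_on k U (\<lambda>x. frechet_derivative g (at x) v)" for v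
    proof (rule Suc.IH[of "\<lambda>x. frechet_derivative f (at x) v"])
      show "frechet_derivative f (at x) v = frechet_derivative g (at x) v" if "x \<in> U" for x
        by (simp only: e[OF that])
      show "times_differentiable_on k U (\<lambda>x. frechet_derivative f (at x) v)"
        using Suc.prems(2) by simp
    qed
  qed
qed

lemma times_differentiable_on_SucI:
  assumes "open U" "\<And>x. x \<in> U \<Longrightarrow> (f has_derivative f' x) (at x)"
    "\<And>v. times_differentiable_on k U (\<lambda>x. f' x v)"
  shows "times_differentiable_on (Suc k) U f"
  unfolding times_differentiable_on.simps
proof (intro conjI ballI allI)
  show "f differentiable at x" if "x \<in> U" for x using assms(2)[OF that] by (auto simp: differentiable_def)
  show "times_differentiable_on k U (\<lambda>x. frechet_derivative f (at x) v)" for v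
    by (rule times_differentiable_on_cong[OF assms(1) _ assms(3)[of v]])
      (simp add: frechet_derivative_at[OF assms(2), symmetric])
qed

lemma times_differentiable_on_const: "times_differentiable_on k U (\<lambda>x. c)"
  by (induction k arbitrary: c) auto

lemma times_differentiable_on_add:
  assumes "open U" "times_differentiable_on k U f" "times_differentiable_on k U g"
  shows "times_differentiable_on k U (\<lambda>x. f x + g x)"
  using assms(2,3)
proof (induction k arbitrary: f g)
  case 0
  then show ?case by (auto intro: continuous_on_add)
next
  case (Suc k)
  show ?case
    by (rule times_differentiable_on_SucI[OF assms(1), of _ "\<lambda>x v. frechet_derivative f (at x) v + frechet_derivative g (at x) v"])
      (use Suc in \<open>auto intro!: has_derivative_add simp: frechet_derivative_works[symmetric]\<close>)
qed

lemma times_differentiable_on_scaleR: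
  assumes "open U" "times_differentiable_on k U f" "times_differentiable_on k U g"
  shows "times_differentiable_on k U (\<lambda>x. f x *\<^sub>R g x)"
  using assms(2,3)
proof (induction k arbitrary: f g)
  case 0
  then show ?case by (auto intro: continuous_on_scaleR)
next
  case (Suc k)
  note S = Suc.prems[THEN times_differentiable_on_Suc_D]
  show ?case
    by (rule times_differentiable_on_SucI[OF assms(1), of _
          "\<lambda>x v. f x *\<^sub>R frechet_derivative g (at x) v + frechet_derivative f (at x) v *\<^sub>R g x"])
      (use Suc S in \<open>auto intro!: has_derivative_scaleR times_differentiable_on_add[OF assms(1)]
          simp: frechet_derivative_works[symmetric]\<close>)
qed

text \<open>Amplitude and phase are there for the induction: differentiation rescales the former and
  advances the latter by a right angle, so the family is closed.\<close>

lemma times_differentiable_on_cos: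
  "open U \<Longrightarrow> times_differentiable_on k U (\<lambda>t::real. a * cos (\<omega> * t + b))"
proof (induction k arbitrary: a b)
  case 0
  then show ?case by (auto intro!: continuous_intros)
next
  case (Suc k)
  show ?case
  proof (rule times_differentiable_on_SucI[OF Suc.prems, of _ "\<lambda>t v. (v * (a * \<omega>)) * cos (\<omega> * t + (b + pi / 2))"])
    show "((\<lambda>t. a * cos (\<omega> * t + b)) has_derivative (\<lambda>v. (v * (a * \<omega>)) * cos (\<omega> * t + (b + pi / 2)))) (at t)" for t
    proof -
      have "cos (\<omega> * t + (b + pi / 2)) = - sin (\<omega> * t + b)"
        unfolding add.assoc[symmetric] cos_add[of "\<omega> * t + b"] by simp
      then show ?thesis by (auto intro!: derivative_eq_intros)
    qed
    show "times_differentiable_on k U (\<lambda>t. (v * (a * \<omega>)) * cos (\<omega> * t + (b + pi / 2)))" for v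
      by (rule Suc.IH[OF Suc.prems])
  qed
qed

lemma times_differentiable_on_cos_sin:
  assumes "open U"
  shows "times_differentiable_on k U (\<lambda>t::real. cos (\<omega> * t))" "times_differentiable_on k U (\<lambda>t::real. sin (\<omega> * t))"
proof -
  show "times_differentiable_on k U (\<lambda>t::real. cos (\<omega> * t))"
    using times_differentiable_on_cos[OF assms, of k 1 \<omega> 0] by simp
  have "cos (\<omega> * t + - (pi / 2)) = sin (\<omega> * t)" for t
    unfolding cos_add by simp
  then show "times_differentiable_on k U (\<lambda>t::real. sin (\<omega> * t))"
    using times_differentiable_on_cos[OF assms, of k 1 \<omega> "- (pi / 2)"] by simp
qed

section \<open>Rolling along great circles\<close>

text \<open>For a unit vector \<open>u\<close> tangent at \<open>x\<close>: the unit tangent, after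
  the angle \<open>t\<close>, of the great circle leaving \<open>x\<close> in direction
  \<open>u\<close>.\<close>

definition roll_dir :: "real \<Rightarrow> real^3 \<Rightarrow> real^3 \<Rightarrow> real \<Rightarrow> real^3" where
  "roll_dir r x u t = cos t *\<^sub>R u - (sin t / r) *\<^sub>R x"

text \<open>Time is the angle on the first sphere, so the speed is \<open>r\<close> and equal arc
  length gives the angle \<open>r / r' * t\<close> on the second. The matrix keeps its value on the
  normal of the great circle; only the term pairing the tangents of the two circles is replaced by
  its current value.\<close>

definition roll :: "real \<Rightarrow> real \<Rightarrow> state \<Rightarrow> real^3 \<Rightarrow> real \<Rightarrow> state" where
  "roll r r' = (\<lambda>(x, x', B) u t.
    (cos t *\<^sub>R x + (r * sin t) *\<^sub>R u,
     cos (r / r' * t) *\<^sub>R x' + (r' * sin (r / r' * t)) *\<^sub>R (B *v u),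
     B - outer (B *v u) u + outer (roll_dir r' x' (B *v u) (r / r' * t)) (roll_dir r x u t)))"

lemma hor_mult: "snd (snd (hor r r' (x, x', B) v)) *v w
    = - (((x \<bullet> w) / r\<^sup>2) *\<^sub>R (B *v v)) - ((v \<bullet> w) / r'\<^sup>2) *\<^sub>R x'"
  by (simp add: hor_def)

lemma hor_scaleR: "hor r r' q (k *\<^sub>R v) = k *\<^sub>R hor r r' q v"
  by (cases q) (auto simp: hor_def matrix_vector_mult_scaleR scaleR_diff_right intro!: matrix_eqI)

lemma hor_add: "hor r r' q (v + w) = hor r r' q v + hor r r' q w"
  by (cases q) (auto simp: hor_def matrix_vector_right_distrib inner_add_left algebra_simps intro!: matrix_eqI)

context
  fixes r r' :: real
  assumes r: "r > 0" and r': "r' > 0"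
begin

context
  fixes x x' :: "real^3" and B :: "real^3^3" and u :: "real^3"
  assumes q: "(x, x', B) \<in> M4 r r'" and xu: "x \<bullet> u = 0" and uu: "u \<bullet> u = 1"
begin

lemmas state_facts = M4_D[OF r r' q]

lemma unit_orthogonal: "u \<bullet> x = 0" using xu by (simp add: inner_commute)

lemma image_unit: "(B *v u) \<bullet> (B *v u) = 1" "(B *v u) \<bullet> x' = 0" "x' \<bullet> (B *v u) = 0"
  using state_facts(4)[of u] by (simp_all add: state_facts(5) uu xu unit_orthogonal inner_commute)

lemma roll_dir_facts:
  "roll_dir r x u t \<bullet> roll_dir r x u t = 1"
  "(cos t *\<^sub>R x + (r * sin t) *\<^sub>R u) \<bullet> roll_dir r x u t = 0"
  "B *v roll_dir r x u t = cos t *\<^sub>R (B *v u)"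
  "u \<bullet> roll_dir r x u t = cos t"
proof -
  have cs: "cos t * cos t + sin t * sin t = 1" using sin_cos_squared_add[of t] by (simp add: power2_eq_square)
  show "roll_dir r x u t \<bullet> roll_dir r x u t = 1"
    using cs r by (simp add: roll_dir_def inner_diff_left inner_diff_right uu xu unit_orthogonal state_facts(1) power2_eq_square)
  show "(cos t *\<^sub>R x + (r * sin t) *\<^sub>R u) \<bullet> roll_dir r x u t = 0"
    using r by (simp add: roll_dir_def inner_diff_right inner_add_left uu xu unit_orthogonal state_facts(1) power2_eq_square)
  show "B *v roll_dir r x u t = cos t *\<^sub>R (B *v u)"
    by (simp add: roll_dir_def matrix_vector_mult_diff_distrib matrix_vector_mult_scaleR state_facts(3))
  show "u \<bullet> roll_dir r x u t = cos t"
    by (simp add: roll_dir_def inner_diff_right uu unit_orthogonal)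
qed

lemma roll_dir'_facts:
  "roll_dir r' x' (B *v u) t \<bullet> roll_dir r' x' (B *v u) t = 1"
  "(cos t *\<^sub>R x' + (r' * sin t) *\<^sub>R (B *v u)) \<bullet> roll_dir r' x' (B *v u) t = 0"
proof -
  have cs: "cos t * cos t + sin t * sin t = 1" using sin_cos_squared_add[of t] by (simp add: power2_eq_square)
  show "roll_dir r' x' (B *v u) t \<bullet> roll_dir r' x' (B *v u) t = 1"
    using cs r' by (simp add: roll_dir_def inner_diff_left inner_diff_right image_unit state_facts(2) power2_eq_square)
  show "(cos t *\<^sub>R x' + (r' * sin t) *\<^sub>R (B *v u)) \<bullet> roll_dir r' x' (B *v u) t = 0"
    using r' by (simp add: roll_dir_def inner_diff_right inner_add_left image_unit state_facts(2) power2_eq_square)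
qed

lemma roll_0: "roll r r' (x, x', B) u 0 = (x, x', B)"
  by (simp add: roll_def roll_dir_def)

lemma roll_mult:
  "snd (snd (roll r r' (x, x', B) u t)) *v a =
    B *v a - (u \<bullet> a) *\<^sub>R (B *v u) + (roll_dir r x u t \<bullet> a) *\<^sub>R roll_dir r' x' (B *v u) (r / r' * t)"
  by (simp add: roll_def)

lemma roll_mult_dir:
  "snd (snd (roll r r' (x, x', B) u t)) *v roll_dir r x u t = roll_dir r' x' (B *v u) (r / r' * t)"
  by (simp add: roll_mult roll_dir_facts)

lemma roll_mult_orthogonal:
  assumes "x \<bullet> n = 0" "u \<bullet> n = 0"
  shows "snd (snd (roll r r' (x, x', B) u t)) *v n = B *v n"
  using assms by (simp add: roll_mult roll_dir_def inner_diff_left)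

lemma roll_M4: "roll r r' (x, x', B) u t \<in> M4 r r'"
proof -
  let ?l = "r / r' * t"
  define X X' C where XC: "X = cos t *\<^sub>R x + (r * sin t) *\<^sub>R u"
    "X' = cos ?l *\<^sub>R x' + (r' * sin ?l) *\<^sub>R (B *v u)" "C = snd (snd (roll r r' (x, x', B) u t))"
  let ?d = "roll_dir r x u t" and ?d' = "roll_dir r' x' (B *v u) ?l"
  have roll: "roll r r' (x, x', B) u t = (X, X', C)" by (simp add: XC roll_def)
  have C: "C *v a = (B *v a - (u \<bullet> a) *\<^sub>R (B *v u)) + (?d \<bullet> a) *\<^sub>R ?d'" for a
    by (simp add: XC roll_mult)
  have cs: "cos t * cos t + sin t * sin t = 1" for t :: real
    using sin_cos_squared_add[of t] by (simp add: power2_eq_square)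
  have o: "(B *v a - (u \<bullet> a) *\<^sub>R (B *v u)) \<bullet> ?d' = 0" "x' \<bullet> (B *v a - (u \<bullet> a) *\<^sub>R (B *v u)) = 0"
    "(B *v u) \<bullet> (B *v a - (u \<bullet> a) *\<^sub>R (B *v u)) = 0" for a
    using state_facts(4)[of a] image_unit
    by (simp_all add: roll_dir_def inner_diff_left inner_diff_right state_facts(5) xu inner_commute[of "B *v a" x'] inner_commute[of a u])
  show ?thesis unfolding roll
  proof (rule M4_I[OF r r'])
    show "X \<bullet> X = r\<^sup>2"
    proof -
      have "X \<bullet> X = r\<^sup>2 * (cos t * cos t) + r\<^sup>2 * (sin t * sin t)"
        by (simp add: XC inner_add_left inner_add_right state_facts(1) uu xu unit_orthogonal power2_eq_square)
      then show ?thesis unfolding distrib_left[symmetric] cs by simp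
    qed
    show "X' \<bullet> X' = r'\<^sup>2"
    proof -
      have "X' \<bullet> X' = r'\<^sup>2 * (cos ?l * cos ?l) + r'\<^sup>2 * (sin ?l * sin ?l)"
        by (simp add: XC inner_add_left inner_add_right state_facts(2) image_unit power2_eq_square)
      then show ?thesis unfolding distrib_left[symmetric] cs by simp
    qed
    have "?d \<bullet> X = 0" using roll_dir_facts(2)[of t] by (simp add: XC inner_commute)
    moreover have "B *v X = (r * sin t) *\<^sub>R (B *v u)" "u \<bullet> X = r * sin t"
      by (simp_all add: XC matrix_vector_right_distrib matrix_vector_mult_scaleR state_facts(3) inner_add_right unit_orthogonal uu)
    ultimately show "C *v X = 0" unfolding C by simp
    have "X' \<bullet> ?d' = 0" using roll_dir'_facts(2)[of ?l] by (simp add: XC)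
    moreover have "X' \<bullet> (B *v a - (u \<bullet> a) *\<^sub>R (B *v u)) = 0" for a
      unfolding XC inner_add_left inner_scaleR_left o by simp
    ultimately show "X' \<bullet> (C *v a) = 0" for a unfolding C inner_add_right by simp
    show "(C *v a) \<bullet> (C *v b) = a \<bullet> b - (X \<bullet> a) * (X \<bullet> b) / r\<^sup>2" for a b
    proof -
      have "(C *v a) \<bullet> (C *v b) = (B *v a - (u \<bullet> a) *\<^sub>R (B *v u)) \<bullet> (B *v b - (u \<bullet> b) *\<^sub>R (B *v u))
          + (?d \<bullet> a) * (?d \<bullet> b)"
        unfolding C inner_add_left inner_add_right inner_scaleR_left inner_scaleR_right
          roll_dir'_facts(1) o(1) inner_commute[of ?d'] by simp
      also have "(B *v a - (u \<bullet> a) *\<^sub>R (B *v u)) \<bullet> (B *v b - (u \<bullet> b) *\<^sub>R (B *v u))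
          = a \<bullet> b - (x \<bullet> a) * (x \<bullet> b) / r\<^sup>2 - (u \<bullet> a) * (u \<bullet> b)"
        by (simp add: inner_diff_left inner_diff_right state_facts(5) xu uu inner_commute[of a u] inner_commute[of b u])
      also have "\<dots> + (?d \<bullet> a) * (?d \<bullet> b) = a \<bullet> b - (X \<bullet> a) * (X \<bullet> b) / r\<^sup>2"
      proof -
        \<comment> \<open>The pair \<open>x / r\<close>, \<open>u\<close> is rotated in its plane
          into \<open>X / r\<close>, \<open>?d\<close>, which preserves the sum of the products of
          components.\<close>
        have "(?d \<bullet> a) * (?d \<bullet> b) + (X \<bullet> a) * (X \<bullet> b) / r\<^sup>2 =
          (cos t * cos t + sin t * sin t) * ((x \<bullet> a) * (x \<bullet> b) / r\<^sup>2 + (u \<bullet> a) * (u \<bullet> b))"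
          unfolding XC roll_dir_def inner_diff_left inner_add_left inner_scaleR_left
        proof -
          fix c s xa xb ua ub :: real
          show "(c * ua - s / r * xa) * (c * ub - s / r * xb) + (c * xa + r * s * ua) * (c * xb + r * s * ub) / r\<^sup>2
            = (c * c + s * s) * (xa * xb / r\<^sup>2 + ua * ub)"
            using r by (simp add: power2_eq_square field_simps)
        qed
        then show ?thesis using cs[of t] by simp
      qed
      finally show ?thesis .
    qed
  qed
qed

lemma roll_dir_derivative:
  "\<rho> > 0 \<Longrightarrow> ((\<lambda>t. roll_dir \<rho> y w (k * t)) has_vector_derivative
     - ((k / \<rho>) *\<^sub>R (cos (k * t) *\<^sub>R y + (\<rho> * sin (k * t)) *\<^sub>R w))) (at t)"
  unfolding roll_dir_def
  by (auto intro!: derivative_eq_intros simp: algebra_simps)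

lemma roll_derivative:
  "(roll r r' (x, x', B) u has_vector_derivative
     hor r r' (roll r r' (x, x', B) u t) (r *\<^sub>R roll_dir r x u t)) (at t)"
proof -
  let ?l = "r / r'"
  let ?d = "roll_dir r x u t" and ?d' = "roll_dir r' x' (B *v u) (?l * t)"
  let ?X = "cos t *\<^sub>R x + (r * sin t) *\<^sub>R u" and ?X' = "cos (?l * t) *\<^sub>R x' + (r' * sin (?l * t)) *\<^sub>R (B *v u)"
  have X: "((\<lambda>t. cos t *\<^sub>R x + (r * sin t) *\<^sub>R u) has_vector_derivative r *\<^sub>R ?d) (at t)"
    using r by (auto intro!: derivative_eq_intros simp: roll_dir_def algebra_simps)
  have X': "((\<lambda>t. cos (?l * t) *\<^sub>R x' + (r' * sin (?l * t)) *\<^sub>R (B *v u)) has_vector_derivative r *\<^sub>R ?d') (at t)"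
    using r r' by (auto intro!: derivative_eq_intros simp: roll_dir_def algebra_simps)
  have d: "(roll_dir r x u has_vector_derivative - ((1 / r) *\<^sub>R ?X)) (at t)"
    using roll_dir_derivative[OF r, of x u 1 t] by simp
  note O = has_vector_derivative_outer[OF roll_dir_derivative[OF r', of x' "B *v u" ?l t] d]
  have C: "((\<lambda>t. B - outer (B *v u) u + outer (roll_dir r' x' (B *v u) (?l * t)) (roll_dir r x u t))
     has_vector_derivative - ((1 / r\<^sup>2) *\<^sub>R outer (r *\<^sub>R ?d') ?X) - (1 / r'\<^sup>2) *\<^sub>R outer ?X' (r *\<^sub>R ?d)) (at t)"
  proof -
    have "((\<lambda>t. B - outer (B *v u) u + outer (roll_dir r' x' (B *v u) (?l * t)) (roll_dir r x u t)) has_vector_derivative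
      0 + (outer ?d' (- ((1 / r) *\<^sub>R ?X)) + outer (- ((?l / r') *\<^sub>R ?X')) ?d)) (at t)"
      by (intro has_vector_derivative_add has_vector_derivative_const O)
    moreover have "0 + (outer ?d' (- ((1 / r) *\<^sub>R ?X)) + outer (- ((?l / r') *\<^sub>R ?X')) ?d)
      = - ((1 / r\<^sup>2) *\<^sub>R outer (r *\<^sub>R ?d') ?X) - (1 / r'\<^sup>2) *\<^sub>R outer ?X' (r *\<^sub>R ?d)"
      using r r' by (intro matrix_eqI) (simp add: power2_eq_square algebra_simps)
    ultimately show ?thesis by simp
  qed
  have m: "snd (snd (roll r r' (x, x', B) u t)) *v (r *\<^sub>R ?d) = r *\<^sub>R ?d'"
    by (simp add: matrix_vector_mult_scaleR roll_mult_dir)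
  show ?thesis
    using has_vector_derivative_Pair[OF X has_vector_derivative_Pair[OF X' C]] m
    by (simp add: roll_def hor_def)
qed

text \<open>Smoothness is tested against a recursive definition, so the curve is written as a
  trigonometric polynomial with constant coefficients, to which the closure rules apply.\<close>

lemma roll_smooth:
  assumes "open U"
  shows "times_differentiable_on n U (\<lambda>t. roll r r' (x, x', B) u (k * t))"
proof -
  let ?l = "r / r' * k" and ?Bu = "B *v u"
  have "(\<lambda>t. roll r r' (x, x', B) u (k * t)) = (\<lambda>t.
     (0, 0, B - outer ?Bu u) + cos (k * t) *\<^sub>R (x, 0, 0) + sin (k * t) *\<^sub>R (r *\<^sub>R u, 0, 0)
     + cos (?l * t) *\<^sub>R (0, x', 0) + sin (?l * t) *\<^sub>R (0, r' *\<^sub>R ?Bu, 0)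
     + cos (?l * t) *\<^sub>R (cos (k * t) *\<^sub>R (0, 0, outer ?Bu u) + sin (k * t) *\<^sub>R (0, 0, - ((1 / r) *\<^sub>R outer ?Bu x)))
     + sin (?l * t) *\<^sub>R (cos (k * t) *\<^sub>R (0, 0, - ((1 / r') *\<^sub>R outer x' u)) + sin (k * t) *\<^sub>R (0, 0, (1 / (r * r')) *\<^sub>R outer x' x)))"
    by (rule ext)
      (auto simp: roll_def roll_dir_def algebra_simps inner_diff_left intro!: matrix_eqI)
  then show ?thesis
    by (simp only:)
      (intro times_differentiable_on_add times_differentiable_on_scaleR times_differentiable_on_const
        times_differentiable_on_cos_sin assms)
qed

lemma roll_dir_add:
  "roll_dir r (cos a *\<^sub>R x + (r * sin a) *\<^sub>R u) (roll_dir r x u a) b = roll_dir r x u (a + b)"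
  using r unfolding roll_dir_def cos_add sin_add
  by (simp add: algebra_simps add_divide_distrib)

text \<open>Allows the base point to be moved along a rolled curve, including backwards; the
  construction of \<open>fan\<close> and the change of base point rest on it.\<close>

lemma roll_add:
  "roll r r' (roll r r' (x, x', B) u a) (roll_dir r x u a) b = roll r r' (x, x', B) u (a + b)"
proof -
  let ?l = "r / r'"
  let ?a = "?l * a" and ?b = "?l * b" and ?Bu = "B *v u"
  define X X' C where XC: "X = cos a *\<^sub>R x + (r * sin a) *\<^sub>R u"
    "X' = cos ?a *\<^sub>R x' + (r' * sin ?a) *\<^sub>R ?Bu" "C = snd (snd (roll r r' (x, x', B) u a))"
  have roll: "roll r r' (x, x', B) u a = (X, X', C)" by (simp add: XC roll_def)
  have Cd: "C *v roll_dir r x u a = roll_dir r' x' ?Bu ?a" unfolding XC by (rule roll_mult_dir)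
  have d: "roll_dir r X (roll_dir r x u a) b = roll_dir r x u (a + b)"
    unfolding XC by (rule roll_dir_add)
  have d': "roll_dir r' X' (roll_dir r' x' ?Bu ?a) ?b = roll_dir r' x' ?Bu (?a + ?b)"
    using r' unfolding roll_dir_def XC cos_add sin_add
    by (simp add: algebra_simps add_divide_distrib)
  have l: "?l * (a + b) = ?a + ?b" by (simp add: distrib_left)
  have 1: "cos b *\<^sub>R X + (r * sin b) *\<^sub>R roll_dir r x u a = cos (a + b) *\<^sub>R x + (r * sin (a + b)) *\<^sub>R u"
    using r unfolding roll_dir_def XC cos_add sin_add by (simp add: algebra_simps)
  have 2: "cos ?b *\<^sub>R X' + (r' * sin ?b) *\<^sub>R roll_dir r' x' ?Bu ?a
      = cos (?a + ?b) *\<^sub>R x' + (r' * sin (?a + ?b)) *\<^sub>R ?Bu"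
    using r' unfolding roll_dir_def XC cos_add sin_add by (simp add: algebra_simps)
  have C: "C = B - outer ?Bu u + outer (roll_dir r' x' ?Bu ?a) (roll_dir r x u a)"
    by (simp add: XC roll_def)
  show ?thesis
    unfolding roll unfolding roll_def prod.case Cd d d' 1 2 l by (simp add: C)
qed

end
end

section \<open>The distribution\<close>

text \<open>A field parallel along \<open>x\<close> has a derivative normal to the sphere, which
  \<open>B\<close> kills. What remains is the matrix part of \<open>hor\<close> on a tangent vector,
  and that is normal to the second sphere.\<close>

lemma hor_admissible:
  assumes r: "r > 0" and r': "r' > 0" and I: "open I"
    and smooth: "smooth_on I \<gamma>" and M: "\<gamma> ` I \<subseteq> M4 r r'"
    and der: "\<And>t. t \<in> I \<Longrightarrow> (\<gamma> has_vector_derivative hor r r' (\<gamma> t) (w t)) (at t)"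
    and w: "\<And>t. t \<in> I \<Longrightarrow> fst (\<gamma> t) \<bullet> w t = 0"
  shows "admissible r r' I \<gamma>"
proof -
  define x x' B where xB: "x = (\<lambda>t. fst (\<gamma> t))" "x' = (\<lambda>t. fst (snd (\<gamma> t)))" "B = (\<lambda>t. snd (snd (\<gamma> t)))"
  have \<gamma>: "\<gamma> t = (x t, x' t, B t)" for t by (simp add: xB)
  note D = M4_D[OF r r']
  have q: "(x t, x' t, B t) \<in> M4 r r'" if "t \<in> I" for t using M that \<gamma> by (metis image_subset_iff)
  have dx: "(x has_vector_derivative w t) (at t)" if "t \<in> I" for t
    using has_vector_derivative_fst[OF der[OF that]] by (simp add: xB hor_def case_prod_unfold)
  have dx': "(x' has_vector_derivative B t *v w t) (at t)" if "t \<in> I" for t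
    using has_vector_derivative_fst[OF has_vector_derivative_snd[OF der[OF that]]]
    by (simp add: xB hor_def case_prod_unfold)
  have dB: "(B has_vector_derivative snd (snd (hor r r' (x t, x' t, B t) (w t)))) (at t)" if "t \<in> I" for t
    using has_vector_derivative_snd[OF has_vector_derivative_snd[OF der[OF that]]] by (simp add: xB)
  have slip: "no_slipping I x x' B"
    unfolding no_slipping_def by (simp add: vector_derivative_at[OF dx] vector_derivative_at[OF dx'])
  have "parallel_along I x' (\<lambda>t. B t *v V t)" if V: "parallel_along I x V" for V
    unfolding parallel_along_def
  proof (intro ballI conjI)
    fix t assume t: "t \<in> I"
    have xV: "x t \<bullet> V t = 0" and dV: "(V has_vector_derivative vector_derivative V (at t)) (at t)"
      and pV: "tangent_proj (x t) (vector_derivative V (at t)) = 0"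
      using V t by (auto simp: parallel_along_def tangent_plane_def orthogonal_def vector_derivative_works)
    have "vector_derivative V (at t) = ((x t \<bullet> vector_derivative V (at t)) / (x t \<bullet> x t)) *\<^sub>R x t"
      using pV by (simp add: tangent_proj_def)
    then obtain k where k: "vector_derivative V (at t) = k *\<^sub>R x t" by blast
    show "B t *v V t \<in> tangent_plane (x' t)"
      using D(4)[OF q[OF t]] by (simp add: tangent_plane_def orthogonal_def)
    have d: "((\<lambda>t. B t *v V t) has_vector_derivative - ((w t \<bullet> V t) / r'\<^sup>2) *\<^sub>R x' t) (at t)"
      using has_vector_derivative_mult[OF dB[OF t] dV] k D(3)[OF q[OF t]]
      by (simp add: hor_mult xV matrix_vector_mult_scaleR)
    then show "(\<lambda>t. B t *v V t) differentiable at t"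
      by (auto simp: differentiable_def has_vector_derivative_def)
    have "x' t \<bullet> x' t \<noteq> 0" using D(2)[OF q[OF t]] r' by simp
    then show "tangent_proj (x' t) (vector_derivative (\<lambda>t. B t *v V t) (at t)) = 0"
      unfolding vector_derivative_at[OF d] by (simp add: tangent_proj_def)
  qed
  then have "no_twisting I x x' B" by (simp add: no_twisting_def)
  then show ?thesis using slip smooth M by (simp add: admissible_def Let_def xB)
qed

lemma exists_unit_orthogonal:
  fixes x v :: "real^3"
  assumes "x \<bullet> v = 0"
  obtains u k where "x \<bullet> u = 0" "u \<bullet> u = 1" "v = k *\<^sub>R u"
proof (cases "v = 0")
  case False
  then show ?thesis
    using assms by (intro that[of "(1 / norm v) *\<^sub>R v" "norm v"])
      (simp_all add: dot_square_norm power2_eq_square)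
next
  case True
  obtain u where u: "u \<noteq> 0" "orthogonal x u"
    using orthogonal_to_vector_exists[of x, simplified] by (auto simp: orthogonal_commute)
  have "x \<bullet> ((1 / norm u) *\<^sub>R u) = 0" using u by (simp add: orthogonal_def)
  moreover have "((1 / norm u) *\<^sub>R u) \<bullet> ((1 / norm u) *\<^sub>R u) = 1"
    using u by (simp add: dot_square_norm power2_eq_square)
  ultimately show ?thesis by (rule that[of _ 0]) (simp add: True)
qed

text \<open>The witness is a great circle rolled at constant speed; the zero vector is covered by
  speed zero.\<close>

lemma hor_in_D4:
  assumes r: "r > 0" and r': "r' > 0" and q: "q \<in> M4 r r'" and v: "fst q \<bullet> v = 0"
  shows "hor r r' q v \<in> D4 r r' q"
proof -
  obtain x x' B where qx: "q = (x, x', B)" by (cases q)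
  obtain u k where u: "x \<bullet> u = 0" "u \<bullet> u = 1" and k: "v = k *\<^sub>R u"
    using exists_unit_orthogonal[of x v] v qx by auto
  define \<gamma> where "\<gamma> t = roll r r' q u (k / r * t)" for t
  define w where "w t = k *\<^sub>R roll_dir r x u (k / r * t)" for t
  note Q = r r' q[unfolded qx] u
  have der: "(\<gamma> has_vector_derivative hor r r' (\<gamma> t) (w t)) (at t)" for t
  proof -
    have "((roll r r' q u \<circ> (\<lambda>t. k / r * t)) has_vector_derivative
      (k / r) *\<^sub>R hor r r' (\<gamma> t) (r *\<^sub>R roll_dir r x u (k / r * t))) (at t)"
      unfolding \<gamma>_def qx
      by (rule vector_diff_chain_at[OF _ roll_derivative[OF Q]]) (auto intro!: derivative_eq_intros)
    then show ?thesis using r by (simp add: o_def \<gamma>_def[abs_def] w_def hor_scaleR[symmetric])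
  qed
  have "fst (\<gamma> t) \<bullet> w t = 0" for t
    using roll_dir_facts(2)[OF Q, of "k / r * t"] by (simp add: \<gamma>_def w_def qx roll_def)
  moreover have "smooth_on {-1<..<1} \<gamma>"
    unfolding smooth_on_def \<gamma>_def[abs_def] qx
    by (intro allI roll_smooth[OF Q]) simp
  moreover have "\<gamma> ` {-1<..<1} \<subseteq> M4 r r'"
    using roll_M4[OF Q] by (auto simp: \<gamma>_def qx)
  ultimately have "admissible r r' {-1<..<1} \<gamma>"
    using der by (intro hor_admissible[OF r r', where w=w]) auto
  moreover have "\<gamma> 0 = q" using roll_0[OF Q] by (simp add: \<gamma>_def qx)
  moreover have "(\<gamma> has_vector_derivative hor r r' q v) (at 0)"
    using der[of 0] \<open>\<gamma> 0 = q\<close> by (simp add: w_def k roll_dir_def)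
  ultimately show ?thesis unfolding D4_def by (intro CollectI exI[of _ 1] conjI exI[of _ \<gamma>]) auto
qed

section \<open>Parallel transport\<close>

text \<open>The cone over a differentiable curve is negligible in \<open>\<real>\<^sup>3\<close>.\<close>

lemma exists_direction_off_curve:
  fixes x :: "real \<Rightarrow> real^3"
  assumes dx: "\<And>t. t \<in> I \<Longrightarrow> x differentiable (at t)" and x0: "\<And>t. t \<in> I \<Longrightarrow> x t \<noteq> 0"
  obtains w where "\<And>t. t \<in> I \<Longrightarrow> cross3 w (x t) \<noteq> 0"
proof -
  let ?f = "\<lambda>p::real \<times> real. snd p *\<^sub>R x (fst p)"
  have "?f differentiable_on (I \<times> UNIV)"
    unfolding differentiable_on_def
  proof
    fix p assume p: "p \<in> I \<times> (UNIV :: real set)"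
    then have "x differentiable (at (fst p))" using dx by auto
    then have "(\<lambda>p. x (fst p)) differentiable (at p)"
      using differentiable_chain_at[of fst p x] by (simp add: o_def)
        (metis bounded_linear_fst bounded_linear_imp_differentiable differentiable_chain_at o_def)
    then have "?f differentiable (at p)"
      by (intro differentiable_scaleR bounded_linear_imp_differentiable[OF bounded_linear_snd])
    then show "?f differentiable (at p within I \<times> UNIV)" by (rule differentiable_at_withinI)
  qed
  then have "negligible (?f ` (I \<times> UNIV))"
    by (intro negligible_differentiable_image_lowdim) auto
  then have "?f ` (I \<times> UNIV) \<noteq> UNIV" using non_negligible_UNIV by metis
  then obtain w where w: "w \<notin> ?f ` (I \<times> UNIV)" by blast
  have "cross3 w (x t) \<noteq> 0" if t: "t \<in> I" for t
  proof
    assume "cross3 w (x t) = 0"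
    then have "cross3 (x t) (cross3 (x t) w) = 0" by (metis cross_skew cross_zero_right neg_equal_0_iff_equal)
    then have "(x t \<bullet> w) *\<^sub>R x t = (x t \<bullet> x t) *\<^sub>R w" using Lagrange[of "x t" "x t" w] by simp
    then have "(1 / (x t \<bullet> x t)) *\<^sub>R ((x t \<bullet> w) *\<^sub>R x t) = (1 / (x t \<bullet> x t)) *\<^sub>R ((x t \<bullet> x t) *\<^sub>R w)" by simp
    then have "w = ?f (t, (x t \<bullet> w) / (x t \<bullet> x t))" using x0[OF t] by simp
    then show False using w t by blast
  qed
  then show ?thesis by (rule that)
qed

lemma orthogonal_frame_zero:
  assumes "x \<noteq> 0" "e \<noteq> 0" "x \<bullet> e = 0" "x \<bullet> z = 0" "e \<bullet> z = 0" "cross3 x e \<bullet> z = 0"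
  shows "z = 0"
proof -
  have "cross3 x e \<noteq> 0" using assms(1-3) norm_cross_dot[of x e] by auto
  moreover have "cross3 z (cross3 x e) = 0" using assms(4,5) by (simp add: Lagrange inner_commute)
  moreover have "z \<bullet> cross3 x e = 0" using assms(6) by (simp add: inner_commute)
  ultimately show ?thesis using norm_and_cross_eq_0 by blast
qed

text \<open>\<open>no_twisting\<close> speaks about the velocity of \<open>B\<close> only through
  parallel fields, so one is needed for every tangent initial value. No differential equation is
  solved: in a moving frame the field is a rotation by an angle found by integration. The direction
  \<open>w\<close> off the cone over the curve makes the frame exist on the whole interval.\<close>

lemma parallel_field_exists:
  fixes x :: "real \<Rightarrow> real^3" and e :: real
  defines "I \<equiv> {-e<..<e}"
  assumes e: "e > 0" and r: "r > 0"
    and dx: "\<And>t. t \<in> I \<Longrightarrow> (x has_vector_derivative x' t) (at t)"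
    and cx': "continuous_on I x'"
    and norm: "\<And>t. t \<in> I \<Longrightarrow> x t \<bullet> x t = r\<^sup>2"
    and V0: "x 0 \<bullet> V0 = 0"
  obtains V where "parallel_along I x V" "V 0 = V0"
proof -
  have I: "open I" "0 \<in> I" using e by (auto simp: I_def)
  have x0: "x t \<noteq> 0" if "t \<in> I" for t using norm[OF that] r by auto
  have cx: "continuous_on I x"
    by (auto intro!: continuous_at_imp_continuous_on has_vector_derivative_continuous[OF dx])
  obtain w where w: "\<And>t. t \<in> I \<Longrightarrow> cross3 w (x t) \<noteq> 0"
    using exists_direction_off_curve[of I x] dx x0
    by (metis has_vector_derivative_def differentiable_def)
  define m where "m t = cross3 w (x t)" for t
  define e1 where "e1 t = (1 / norm (m t)) *\<^sub>R m t" for t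
  define e2 where "e2 t = (1 / r) *\<^sub>R cross3 (x t) (e1 t)" for t
  \<comment> \<open>The rate at which the frame turns: the tangential derivative of
    \<open>e1\<close> is \<omega> times \<open>e2\<close>. The derivative of the normalizing factor
    drops out because \<open>m\<close> is orthogonal to \<open>e2\<close>.\<close>
  define \<omega> where "\<omega> t = (1 / norm (m t)) * (cross3 w (x' t) \<bullet> e2 t)" for t
  have dm: "(m has_vector_derivative cross3 w (x' t)) (at t)" if "t \<in> I" for t
    using has_vector_derivative_cross3[OF has_vector_derivative_const[of w] dx[OF that]] by (simp add: m_def[abs_def])
  have e1_unit: "e1 t \<bullet> e1 t = 1" if "t \<in> I" for t
    using w[OF that] by (simp add: e1_def m_def dot_square_norm power2_eq_square)
  have xe1: "x t \<bullet> e1 t = 0" for t by (simp add: e1_def m_def dot_cross_self)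
  have xe2: "x t \<bullet> e2 t = 0" and e1e2: "e1 t \<bullet> e2 t = 0" for t by (simp_all add: e2_def dot_cross_self)
  have e2_unit: "e2 t \<bullet> e2 t = 1" if "t \<in> I" for t
    unfolding e2_def by (rule cross3_unit[OF norm[OF that] r e1_unit[OF that] xe1])
  have de: "\<exists>e1' e2'. (e1 has_vector_derivative e1') (at t) \<and> (e2 has_vector_derivative e2') (at t) \<and>
    e1 t \<bullet> e1' = 0 \<and> e2 t \<bullet> e2' = 0 \<and> e2 t \<bullet> e1' = \<omega> t \<and> e1 t \<bullet> e2' = - \<omega> t" if t: "t \<in> I" for t
  proof -
    have mt: "m t \<noteq> 0" using w[OF t] by (simp add: m_def)
    have "(\<lambda>t. 1 / norm (m t)) differentiable (at t)"
    proof (rule differentiable_divide)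
      show "(\<lambda>t. norm (m t)) differentiable (at t)"
      proof -
        have "m differentiable (at t)"
          using dm[OF t] by (auto simp: differentiable_def has_vector_derivative_def)
        then have "(norm \<circ> m) differentiable (at t)"
          by (rule differentiable_chain_at) (rule differentiable_norm_at[OF mt])
        then show ?thesis by (simp add: o_def)
      qed
    qed (use mt in auto)
    then obtain n' where n': "((\<lambda>t. 1 / norm (m t)) has_real_derivative n') (at t)"
      by (auto simp: real_differentiable_def)
    define e1' where "e1' = (1 / norm (m t)) *\<^sub>R cross3 w (x' t) + n' *\<^sub>R m t"
    define e2' where "e2' = (1 / r) *\<^sub>R (cross3 (x t) e1' + cross3 (x' t) (e1 t))"
    have d1: "(e1 has_vector_derivative e1') (at t)"
      using has_vector_derivative_scaleR[OF n' dm[OF t]] by (simp add: e1_def[abs_def] e1'_def)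
    have d2: "(e2 has_vector_derivative e2') (at t)"
      using has_vector_derivative_scaleR[OF DERIV_const has_vector_derivative_cross3[OF dx[OF t] d1], of "1 / r"]
      by (simp add: e2_def[abs_def] e2'_def)
    have 1: "e1 t \<bullet> e1' + e1' \<bullet> e1 t = 0"
      by (rule locally_constant_derivative[OF has_vector_derivative_inner[OF d1 d1] I(1) t e1_unit])
    have 2: "e2 t \<bullet> e2' + e2' \<bullet> e2 t = 0"
      by (rule locally_constant_derivative[OF has_vector_derivative_inner[OF d2 d2] I(1) t e2_unit])
    have 3: "e1 t \<bullet> e2' + e1' \<bullet> e2 t = 0"
      by (rule locally_constant_derivative[OF has_vector_derivative_inner[OF d1 d2] I(1) t e1e2])
    have "e2 t \<bullet> m t = 0" using e1e2[of t] mt by (simp add: e1_def inner_commute)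
    then have "e2 t \<bullet> e1' = \<omega> t" by (simp add: e1'_def \<omega>_def inner_add_right inner_commute)
    then show ?thesis using 1 2 3 d1 d2
      by (intro exI[of _ e1'] exI[of _ e2']) (auto simp: inner_commute eq_neg_iff_add_eq_0)
  qed
  have c\<omega>: "continuous_on I \<omega>"
    unfolding \<omega>_def e2_def e1_def m_def
    by (intro continuous_intros continuous_on_cross cx cx') (use w r in auto)
  obtain \<phi>0 where \<phi>0: "\<And>t. t \<in> I \<Longrightarrow> (\<phi>0 has_vector_derivative \<omega> t) (at t)"
    using einterval_antiderivative[of "ereal (-e)" "ereal e" \<omega>] e c\<omega>
    by (auto simp: I_def continuous_on_eq_continuous_at)
  define \<phi> where "\<phi> t = \<phi>0 t - \<phi>0 0" for t
  have d\<phi>: "(\<phi> has_real_derivative \<omega> t) (at t)" if "t \<in> I" for t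
    using \<phi>0[OF that] unfolding \<phi>_def[abs_def] has_real_derivative_iff_has_vector_derivative
    by (auto intro!: derivative_eq_intros)
  define a b where "a = V0 \<bullet> e1 0" and "b = V0 \<bullet> e2 0"
  \<comment> \<open>Coordinates that turn against the frame by the angle \<phi>, so that the
    tangential derivative of \<open>V\<close> cancels.\<close>
  define p q where "p = (\<lambda>t. a * cos (\<phi> t) + b * sin (\<phi> t))" and "q = (\<lambda>t. b * cos (\<phi> t) - a * sin (\<phi> t))"
  define V where "V t = p t *\<^sub>R e1 t + q t *\<^sub>R e2 t" for t
  have dp: "(p has_real_derivative \<omega> t * q t) (at t)" and dq: "(q has_real_derivative - \<omega> t * p t) (at t)" if "t \<in> I" for t
    unfolding p_def q_def by (auto intro!: derivative_eq_intros d\<phi>[OF that] simp: algebra_simps)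
  have "parallel_along I x V"
    unfolding parallel_along_def
  proof (intro ballI conjI)
    fix t assume t: "t \<in> I"
    obtain e1' e2' where e': "(e1 has_vector_derivative e1') (at t)" "(e2 has_vector_derivative e2') (at t)"
      "e1 t \<bullet> e1' = 0" "e2 t \<bullet> e2' = 0" "e2 t \<bullet> e1' = \<omega> t" "e1 t \<bullet> e2' = - \<omega> t"
      using de[OF t] by blast
    show "V t \<in> tangent_plane (x t)"
      using xe1 xe2 by (simp add: tangent_plane_def orthogonal_def V_def inner_add_right)
    define V' where "V' = (p t *\<^sub>R e1' + (\<omega> t * q t) *\<^sub>R e1 t) + (q t *\<^sub>R e2' + (- \<omega> t * p t) *\<^sub>R e2 t)"
    have dV: "(V has_vector_derivative V') (at t)"
      unfolding V_def V'_def
      by (intro has_vector_derivative_add has_vector_derivative_scaleR dp dq t e')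
    then show "V differentiable at t" by (auto simp: differentiable_def has_vector_derivative_def)
    have V'e: "e1 t \<bullet> V' = 0" "e2 t \<bullet> V' = 0"
      using e' e1e2[of t] e1_unit[OF t] e2_unit[OF t]
      by (simp_all add: V'_def inner_add_right inner_diff_right inner_commute[of "e2 t" "e1 t"])
    have "tangent_proj (x t) V' = 0"
    proof (rule orthogonal_frame_zero[of "x t" "e1 t"])
      show "x t \<noteq> 0" "e1 t \<noteq> 0" "x t \<bullet> e1 t = 0" using x0[OF t] e1_unit[OF t] xe1 by auto
      show "x t \<bullet> tangent_proj (x t) V' = 0"
        using x0[OF t] by (simp add: tangent_proj_def inner_diff_right)
      show "e1 t \<bullet> tangent_proj (x t) V' = 0"
        using V'e xe1[of t] by (simp add: tangent_proj_def inner_diff_right inner_commute)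
      have "cross3 (x t) (e1 t) = r *\<^sub>R e2 t" using r by (simp add: e2_def)
      then show "cross3 (x t) (e1 t) \<bullet> tangent_proj (x t) V' = 0"
        using V'e xe2[of t] by (simp add: tangent_proj_def inner_diff_right inner_commute)
    qed
    then show "tangent_proj (x t) (vector_derivative V (at t)) = 0"
      by (simp add: vector_derivative_at[OF dV])
  qed
  moreover have "V 0 = V0"
  proof -
    have "V0 - V 0 = 0"
    proof (rule orthogonal_frame_zero[of "x 0" "e1 0"])
      show "x 0 \<noteq> 0" "e1 0 \<noteq> 0" "x 0 \<bullet> e1 0 = 0" using x0[OF I(2)] e1_unit[OF I(2)] xe1 by auto
      have V: "V 0 = a *\<^sub>R e1 0 + b *\<^sub>R e2 0" by (simp add: V_def p_def q_def \<phi>_def)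
      show "x 0 \<bullet> (V0 - V 0) = 0" using V0 xe1 xe2 by (simp add: V inner_diff_right inner_add_right)
      show "e1 0 \<bullet> (V0 - V 0) = 0"
        using e1e2 e1_unit[OF I(2)] by (simp add: V inner_diff_right inner_add_right a_def inner_commute)
      have "cross3 (x 0) (e1 0) = r *\<^sub>R e2 0" using r by (simp add: e2_def)
      then show "cross3 (x 0) (e1 0) \<bullet> (V0 - V 0) = 0"
        using e1e2[of 0] e2_unit[OF I(2)]
        by (simp add: V inner_diff_right inner_add_right b_def inner_commute)
    qed
    then show ?thesis by simp
  qed
  ultimately show ?thesis by (rule that)
qed

text \<open>The velocity of \<open>B\<close> is recovered on \<open>x 0\<close> by differentiating
  \<open>B t *v x t = 0\<close>, and on a tangent vector from the parallel field that starts there,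
  whose derivative is normal and hence killed by \<open>B 0\<close>.\<close>

lemma D4_hor:
  assumes r: "r > 0" and r': "r' > 0" and v: "v \<in> D4 r r' q"
  shows "q \<in> M4 r r' \<and> (\<exists>w. fst q \<bullet> w = 0 \<and> v = hor r r' q w)"
proof -
  obtain e \<gamma> where e: "e > 0" and adm: "admissible r r' {-e<..<e} \<gamma>" and q0: "\<gamma> 0 = q"
    and v: "(\<gamma> has_vector_derivative v) (at 0)" using v by (auto simp: D4_def)
  define I where "I = {-e<..<e}"
  have I: "open I" "0 \<in> I" using e by (auto simp: I_def)
  define x x' B where xB: "x = (\<lambda>t. fst (\<gamma> t))" "x' = (\<lambda>t. fst (snd (\<gamma> t)))" "B = (\<lambda>t. snd (snd (\<gamma> t)))"
  have smooth: "smooth_on I \<gamma>" and M: "\<gamma> ` I \<subseteq> M4 r r'" and slip: "no_slipping I x x' B"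
    and twist: "no_twisting I x x' B"
    using adm by (auto simp: admissible_def Let_def xB I_def)
  note D = M4_D[OF r r']
  have q: "(x t, x' t, B t) \<in> M4 r r'" if "t \<in> I" for t using M that by (auto simp: xB)
  have "times_differentiable_on 1 I \<gamma>" using smooth by (simp add: smooth_on_def)
  then have d\<gamma>: "\<And>t. t \<in> I \<Longrightarrow> (\<gamma> has_derivative frechet_derivative \<gamma> (at t)) (at t)"
    and c\<gamma>: "continuous_on I (\<lambda>t. frechet_derivative \<gamma> (at t) 1)"
    by (auto simp: frechet_derivative_works[symmetric])
  have vd: "(\<gamma> has_vector_derivative frechet_derivative \<gamma> (at t) 1) (at t)" if "t \<in> I" for t
    unfolding has_vector_derivative_def
  proof -
    have "linear (frechet_derivative \<gamma> (at t))"
      using d\<gamma>[OF that] has_derivative_bounded_linear bounded_linear.linear by blast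
    then have "s *\<^sub>R frechet_derivative \<gamma> (at t) 1 = frechet_derivative \<gamma> (at t) s" for s
      using linear_scale[of "frechet_derivative \<gamma> (at t)" s 1] by simp
    then have "(\<lambda>s. s *\<^sub>R frechet_derivative \<gamma> (at t) 1) = frechet_derivative \<gamma> (at t)" by (rule ext)
    then show "(\<gamma> has_derivative (\<lambda>s. s *\<^sub>R frechet_derivative \<gamma> (at t) 1)) (at t)"
      using d\<gamma>[OF that] by simp
  qed
  define y y' C where yC: "y = fst v" "y' = fst (snd v)" "C = snd (snd v)"
  have dx: "(x has_vector_derivative y) (at 0)" and dx': "(x' has_vector_derivative y') (at 0)"
    and dB: "(B has_vector_derivative C) (at 0)"
    unfolding xB yC by (intro has_vector_derivative_fst has_vector_derivative_snd v)+
  have y': "y' = B 0 *v y"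
    using bspec[OF slip[unfolded no_slipping_def] I(2)]
    by (simp add: vector_derivative_at[OF dx] vector_derivative_at[OF dx'])
  have xy: "x 0 \<bullet> y = 0"
    using locally_constant_derivative[OF has_vector_derivative_inner[OF dx dx] I D(1)[OF q]] by (simp add: inner_commute)
  have Cx: "C *v x 0 = - (B 0 *v y)"
    using locally_constant_derivative[OF has_vector_derivative_mult[OF dB dx] I D(3)[OF q]]
    by (simp add: eq_neg_iff_add_eq_0 add.commute)
  have C: "C *v w = - ((y \<bullet> w) / r'\<^sup>2) *\<^sub>R x' 0" if w: "x 0 \<bullet> w = 0" for w
  proof -
    have cx: "continuous_on I (\<lambda>t. fst (frechet_derivative \<gamma> (at t) 1))" by (intro continuous_intros c\<gamma>)
    have dxt: "(x has_vector_derivative fst (frechet_derivative \<gamma> (at t) 1)) (at t)" if "t \<in> I" for t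
      unfolding xB by (intro has_vector_derivative_fst vd that)
    obtain V where V: "parallel_along I x V" "V 0 = w"
      using parallel_field_exists[of e r x "\<lambda>t. fst (frechet_derivative \<gamma> (at t) 1)" w] e r dxt cx D(1)[OF q] w
      unfolding I_def by blast
    have dV: "(V has_vector_derivative vector_derivative V (at 0)) (at 0)"
      and pV: "tangent_proj (x 0) (vector_derivative V (at 0)) = 0"
      using V(1) I(2) by (auto simp: parallel_along_def vector_derivative_works)
    have BV': "B 0 *v vector_derivative V (at 0) = 0"
    proof -
      obtain k where "vector_derivative V (at 0) = k *\<^sub>R x 0"
        using pV unfolding tangent_proj_def by (metis eq_iff_diff_eq_0)
      then show ?thesis using D(3)[OF q[OF I(2)]] by (simp add: matrix_vector_mult_scaleR)
    qed
    have "((\<lambda>t. B t *v V t) has_vector_derivative C *v w) (at 0)"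
      using has_vector_derivative_mult[OF dB dV] BV' V(2) by simp
    moreover have "parallel_along I x' (\<lambda>t. B t *v V t)" using twist V(1) by (simp add: no_twisting_def)
    ultimately have "tangent_proj (x' 0) (C *v w) = 0"
      using I(2) by (auto simp: parallel_along_def vector_derivative_at)
    then have Cw: "C *v w = ((x' 0 \<bullet> (C *v w)) / r'\<^sup>2) *\<^sub>R x' 0"
      using D(2)[OF q[OF I(2)]] by (simp add: tangent_proj_def)
    have "x' 0 \<bullet> (C *v w) + y' \<bullet> (B 0 *v w) = 0"
    proof (rule locally_constant_derivative[OF _ I])
      show "((\<lambda>t. x' t \<bullet> (B t *v w)) has_vector_derivative x' 0 \<bullet> (C *v w) + y' \<bullet> (B 0 *v w)) (at 0)"
        using has_vector_derivative_inner[OF dx' has_vector_derivative_mult[OF dB has_vector_derivative_const[of w]]]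
        by simp
    qed (rule D(4)[OF q])
    then have "x' 0 \<bullet> (C *v w) = - (y \<bullet> w)"
      using D(5)[OF q[OF I(2)], of y w] xy by (simp add: y')
    then show ?thesis using Cw by simp
  qed
  have qq: "q = (x 0, x' 0, B 0)" using q0 by (simp add: xB)
  have "C = snd (snd (hor r r' q y))"
  proof (rule matrix_eqI_orthogonal)
    show "x 0 \<noteq> 0" using D(1)[OF q[OF I(2)]] r by auto
    show "C *v x 0 = snd (snd (hor r r' q y)) *v x 0"
      using D(1)[OF q[OF I(2)]] r xy by (simp add: Cx qq hor_mult inner_commute[of y])
    show "C *v w = snd (snd (hor r r' q y)) *v w" if "x 0 \<bullet> w = 0" for w
      using that by (simp add: C qq hor_mult)
  qed
  then have "v = hor r r' q y" using y' by (auto simp: yC qq hor_def prod_eq_iff)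
  then show ?thesis using q[OF I(2)] xy qq by auto
qed

theorem D4_eq:
  assumes "r > 0" "r' > 0" "q \<in> M4 r r'"
  shows "D4 r r' q = {hor r r' q v |v. fst q \<bullet> v = 0}"
  using D4_hor[OF assms(1,2)] hor_in_D4[OF assms] by blast

section \<open>Infinitesimal motions\<close>

lemma bounded_bilinear_matrix_mult: "bounded_bilinear (\<lambda>(A :: real^3^3) (B :: real^3^3). A ** B)"
  unfolding bilinear_conv_bounded_bilinear[symmetric] bilinear_def
  by (auto intro!: linearI matrix_eqI simp: matrix_vector_right_distrib matrix_vector_mult_scaleR)

lemma bounded_linear_transpose: "bounded_linear (transpose :: real^3^3 \<Rightarrow> real^3^3)"
  unfolding linear_conv_bounded_linear[symmetric]
  by (auto intro!: linearI simp: transpose_def vec_eq_iff)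

lemma transpose_cross_matrix: "transpose (cross_matrix \<xi>) = - cross_matrix \<xi>"
proof (rule matrix_eqI)
  fix w
  have "(transpose (cross_matrix \<xi>) *v w) \<bullet> z = (- cross3 \<xi> w) \<bullet> z" for z
    unfolding transpose_matrix_vector dot_vector_matrix cross_matrix_mult by (simp add: cross3_simps)
  then have "transpose (cross_matrix \<xi>) *v w = - cross3 \<xi> w"
    using vector_eq_rdot by blast
  then show "transpose (cross_matrix \<xi>) *v w = - cross_matrix \<xi> *v w" by simp
qed

text \<open>Rodrigues' formula about a unit axis \<open>n\<close>. Using
  \<open>exists_unit_orthogonal\<close> at the zero vector makes its orthogonality condition void
  and supplies an axis even for \<xi> = 0.\<close>

lemma rotation_curve_exists:
  obtains H where "\<And>\<sigma>::real. orthogonal_matrix (H \<sigma>)" "H 0 = mat 1"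
    "(H has_vector_derivative cross_matrix \<xi>) (at 0)"
proof -
  obtain n k where n: "n \<bullet> n = 1" and k: "\<xi> = k *\<^sub>R n"
    using exists_unit_orthogonal[of 0 \<xi>] by auto
  define H where "H \<sigma> = mat 1 + sin (k * \<sigma>) *\<^sub>R cross_matrix n + (1 - cos (k * \<sigma>)) *\<^sub>R (outer n n - mat 1)" for \<sigma>
  have Hv: "H \<sigma> *v v = cos (k * \<sigma>) *\<^sub>R v + sin (k * \<sigma>) *\<^sub>R cross3 n v + ((1 - cos (k * \<sigma>)) * (n \<bullet> v)) *\<^sub>R n" for \<sigma> v
    by (simp add: H_def algebra_simps)
  have "(H \<sigma> *v v) \<bullet> (H \<sigma> *v v) = v \<bullet> v" for \<sigma> v
  proof -
    define c s where "c = cos (k * \<sigma>)" and "s = sin (k * \<sigma>)"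
    have cs: "c * c + s * s = 1" using sin_cos_squared_add[of "k * \<sigma>"] by (simp add: c_def s_def power2_eq_square)
    have nn: "cross3 n v \<bullet> cross3 n v = v \<bullet> v - (n \<bullet> v) * (n \<bullet> v)"
    proof -
      have "norm n = 1" using n by (simp add: norm_eq_1)
      then show ?thesis using norm_cross_dot[of n v] by (simp add: dot_square_norm power2_eq_square)
    qed
    have "(H \<sigma> *v v) \<bullet> (H \<sigma> *v v) = c * c * (v \<bullet> v) + s * s * (v \<bullet> v - (n \<bullet> v) * (n \<bullet> v))
        + (1 - c) * (1 - c) * (n \<bullet> v) * (n \<bullet> v) + 2 * c * (1 - c) * (n \<bullet> v) * (n \<bullet> v)"
      unfolding Hv c_def[symmetric] s_def[symmetric]
      by (simp add: inner_add_left inner_add_right dot_cross_self nn n inner_commute[of v n] algebra_simps)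
    also have "\<dots> = (c * c + s * s) * (v \<bullet> v - (n \<bullet> v) * (n \<bullet> v)) + (n \<bullet> v) * (n \<bullet> v)"
      by (simp add: algebra_simps)
    finally show ?thesis using cs by simp
  qed
  then have "norm (H \<sigma> *v v) = norm v" for \<sigma> v by (simp add: norm_eq_sqrt_inner)
  then have "orthogonal_transformation ((*v) (H \<sigma>))" for \<sigma>
    by (simp add: orthogonal_transformation)
  then have "orthogonal_matrix (H \<sigma>)" for \<sigma>
    using orthogonal_transformation_matrix[of "(*v) (H \<sigma>)"] by simp
  moreover have "H 0 = mat 1" by (simp add: H_def)
  moreover have "(H has_vector_derivative cross_matrix \<xi>) (at 0)"
  proof -
    have "cross_matrix \<xi> = k *\<^sub>R cross_matrix n"
      by (rule matrix_eqI) (simp add: k cross_mult_left)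
    then show ?thesis unfolding H_def[abs_def] by (auto intro!: derivative_eq_intros)
  qed
  ultimately show ?thesis by (rule that)
qed

text \<open>Linear in the state, so the same map also serves as its own differential on
  velocities.\<close>

definition motion :: "real^3^3 \<Rightarrow> real^3^3 \<Rightarrow> state \<Rightarrow> state" where
  "motion H K = (\<lambda>(x, x', B). (H *v x, K *v x', K ** B ** transpose H))"

lemma transpose_orthogonal:
  fixes H :: "real^3^3"
  assumes "orthogonal_matrix H"
  shows "(H *v a) v* H = a" "H *v (a v* H) = a"
    "(H *v a) \<bullet> (H *v b) = a \<bullet> b" "(H *v a) \<bullet> b = a \<bullet> (b v* H)"
    "(a v* H) \<bullet> (b v* H) = a \<bullet> b"
proof -
  have "transpose H *v (H *v a) = a" "H *v (transpose H *v a) = a" for a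
    using assms unfolding orthogonal_matrix_def
    by (simp_all only: matrix_mult_mult[symmetric] matrix_vector_mul_lid)
  then show 1: "(H *v a) v* H = a" "H *v (a v* H) = a" for a by simp_all
  show 2: "(H *v a) \<bullet> b = a \<bullet> (b v* H)" for a b
    by (simp add: inner_commute[of a] dot_vector_matrix) (rule inner_commute)
  show "(H *v a) \<bullet> (H *v b) = a \<bullet> b" by (simp add: 1 2)
  show "(a v* H) \<bullet> (b v* H) = a \<bullet> b" by (simp add: 1 dot_vector_matrix)
qed

lemma matrix_mult_minus [simp]: "A *v (- w) = - (A *v w)" for A :: "real^3^3"
  by (rule linear_neg[OF matrix_vector_mul_linear])

lemma motion_M4:
  assumes r: "r > 0" and r': "r' > 0" and H: "orthogonal_matrix H" and K: "orthogonal_matrix K" and q: "q \<in> M4 r r'"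
  shows "motion H K q \<in> M4 r r'"
proof -
  obtain x x' B where qx: "q = (x, x', B)" by (cases q)
  note D = M4_D[OF r r' q[unfolded qx]] and h = transpose_orthogonal[OF H] and k = transpose_orthogonal[OF K]
  show ?thesis unfolding qx motion_def prod.case
    by (rule M4_I[OF r r']) (simp_all add: h k D)
qed

text \<open>Motions are symmetries of the rolling distribution; this is what makes their pullbacks
  by an equivalence useful.\<close>

lemma motion_hor:
  assumes H: "orthogonal_matrix H"
  shows "motion H K (hor r r' q v) = hor r r' (motion H K q) (H *v v)"
  by (cases q) (auto simp: motion_def hor_def transpose_orthogonal[OF H] matrix_vector_mult_diff_distrib
      matrix_vector_mult_scaleR matrix_vector_right_distrib inner_add_left algebra_simps intro!: matrix_eqI)

lemma motion_derivative:
  assumes H: "H 0 = mat 1" "(H has_vector_derivative cross_matrix \<xi>) (at 0)"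
    and K: "K 0 = mat 1" "(K has_vector_derivative cross_matrix \<eta>) (at 0)"
  shows "((\<lambda>\<sigma>. motion (H \<sigma>) (K \<sigma>) q) has_vector_derivative act \<xi> \<eta> q) (at 0)"
proof -
  obtain x x' B where qx: "q = (x, x', B)" by (cases q)
  note M = bounded_bilinear.has_vector_derivative[OF bounded_bilinear_matrix_mult]
  have 1: "((\<lambda>\<sigma>. H \<sigma> *v x) has_vector_derivative cross3 \<xi> x) (at 0)"
    using has_vector_derivative_mult[OF H(2) has_vector_derivative_const[of x]] by simp
  have 2: "((\<lambda>\<sigma>. K \<sigma> *v x') has_vector_derivative cross3 \<eta> x') (at 0)"
    using has_vector_derivative_mult[OF K(2) has_vector_derivative_const[of x']] by simp
  have KB: "((\<lambda>\<sigma>. K \<sigma> ** B) has_vector_derivative cross_matrix \<eta> ** B) (at 0)"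
    using M[OF K(2) has_vector_derivative_const[of B]] by (simp add: bounded_bilinear.zero_right[OF bounded_bilinear_matrix_mult])
  have "((\<lambda>\<sigma>. K \<sigma> ** B ** transpose (H \<sigma>)) has_vector_derivative
      K 0 ** B ** transpose (cross_matrix \<xi>) + cross_matrix \<eta> ** B ** transpose (H 0)) (at 0)"
    by (rule M[OF KB bounded_linear.has_vector_derivative[OF bounded_linear_transpose H(2)]])
  moreover have "K 0 ** B ** transpose (cross_matrix \<xi>) + cross_matrix \<eta> ** B ** transpose (H 0)
      = cross_matrix \<eta> ** B - B ** cross_matrix \<xi>"
    by (rule matrix_eqI) (simp add: H K transpose_cross_matrix transpose_mat matrix_vector_mult_diff_distrib)
  ultimately have 3: "((\<lambda>\<sigma>. K \<sigma> ** B ** transpose (H \<sigma>)) has_vector_derivative cross_matrix \<eta> ** B - B ** cross_matrix \<xi>) (at 0)"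
    by simp
  show ?thesis unfolding qx motion_def act_def prod.case
    by (intro has_vector_derivative_Pair 1 2 3)
qed

lemma motion_id: "motion (mat 1) (mat 1) q = q"
  by (cases q) (simp add: motion_def transpose_mat)

lemma act_velocity:
  assumes r: "r > 0" and r': "r' > 0" and q: "q \<in> M4 r r'"
  shows "velocity_in (M4 r r') q (act \<xi> \<eta> q)"
proof -
  obtain H K where H: "\<And>\<sigma>::real. orthogonal_matrix (H \<sigma>)" "H 0 = mat 1" "(H has_vector_derivative cross_matrix \<xi>) (at 0)"
    and K: "\<And>\<sigma>::real. orthogonal_matrix (K \<sigma>)" "K 0 = mat 1" "(K has_vector_derivative cross_matrix \<eta>) (at 0)"
    using rotation_curve_exists[of \<xi>] rotation_curve_exists[of \<eta>] by metis
  show ?thesis unfolding velocity_in_def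
    by (intro exI[of _ "\<lambda>\<sigma>. motion (H \<sigma>) (K \<sigma>) q"] exI[of _ 1])
      (use motion_M4[OF r r' H(1) K(1) q] motion_derivative[OF H(2,3) K(2,3)] H(2) K(2) motion_id in auto)
qed

lemma skew_is_cross:
  fixes f :: "real^3 \<Rightarrow> real^3"
  assumes lin: "linear f" and skew: "\<And>a b. f a \<bullet> b = - (a \<bullet> f b)"
  obtains \<Omega> where "\<And>a. f a = cross3 \<Omega> a"
proof -
  let ?e = "\<lambda>i::3. axis i (1::real)"
  define \<Omega> :: "real^3" where "\<Omega> = vector [f (?e 2) $ 3, f (?e 3) $ 1, f (?e 1) $ 2]"
  have ij: "f (?e i) $ j = - (f (?e j) $ i)" for i j
    using skew[of "?e i" "?e j"] by (simp add: inner_axis inner_commute[of "?e i"])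
  have ii: "f (?e i) $ i = 0" for i using ij[of i i] by simp
  have "f a = cross3 \<Omega> a" for a
  proof -
    have "a = a $ 1 *\<^sub>R ?e 1 + a $ 2 *\<^sub>R ?e 2 + a $ 3 *\<^sub>R ?e 3"
      by (simp add: vec_eq_iff forall_3 axis_def)
    from arg_cong[OF this, of f]
    have "f a = a $ 1 *\<^sub>R f (?e 1) + a $ 2 *\<^sub>R f (?e 2) + a $ 3 *\<^sub>R f (?e 3)"
      by (simp only: linear_add[OF lin] linear_scale[OF lin])
    then show ?thesis
      using ij[of 2 1] ij[of 3 1] ij[of 3 2] ii
      by (simp add: vec_eq_iff forall_3 cross3_def \<Omega>_def vector_3 algebra_simps)
  qed
  then show ?thesis by (rule that)
qed

text \<open>Infinitesimal transitivity of the motions. The completed matrix \<open>R\<close> is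
  orthogonal, so its velocity is \<open>R\<close> composed with the cross product by some \<Omega>.
  A \<xi> producing the velocity of \<open>x\<close> is chosen; then \<eta> has to be the image of
  \<Omega> + \<xi> under \<open>R\<close>, with the determinant as the sign by which an orthogonal
  matrix transports axes.\<close>

lemma velocity_is_act:
  assumes r: "r > 0" and r': "r' > 0" and v: "velocity_in (M4 r r') q V"
  obtains \<xi> \<eta> where "V = act \<xi> \<eta> q"
proof -
  obtain \<gamma> e where e: "e > 0" and M: "\<gamma> ` {-e<..<e} \<subseteq> M4 r r'" and g0: "\<gamma> 0 = q"
    and dg: "(\<gamma> has_vector_derivative V) (at 0)" using v by (auto simp: velocity_in_def)
  define I where "I = {-e<..<e}"
  have I: "open I" "0 \<in> I" using e by (auto simp: I_def)
  define x x' B where xB: "x = (\<lambda>t. fst (\<gamma> t))" "x' = (\<lambda>t. fst (snd (\<gamma> t)))" "B = (\<lambda>t. snd (snd (\<gamma> t)))"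
  define y y' C where yC: "y = fst V" "y' = fst (snd V)" "C = snd (snd V)"
  have dx: "(x has_vector_derivative y) (at 0)" and dx': "(x' has_vector_derivative y') (at 0)"
    and dB: "(B has_vector_derivative C) (at 0)"
    unfolding xB yC by (intro has_vector_derivative_fst has_vector_derivative_snd dg)+
  have qt: "(x t, x' t, B t) \<in> M4 r r'" if "t \<in> I" for t using M that by (auto simp: xB I_def)
  note D = M4_D[OF r r' qt] and D0 = M4_D[OF r r' qt[OF I(2)]]
  define R where "R t = completed r r' (x t, x' t, B t)" for t
  have orth: "(R t *v a) \<bullet> (R t *v b) = a \<bullet> b" and surj: "surj ((*v) (R t))" and om: "orthogonal_matrix (R t)"
    if "t \<in> I" for t a b
  proof -
    note O = completed_orthogonal[OF r r' D(1,2,4,5)[OF that]]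
    show "orthogonal_matrix (R t)" "surj ((*v) (R t))"
      unfolding R_def using O orthogonal_transformation_surj by blast+
    show "(R t *v a) \<bullet> (R t *v b) = a \<bullet> b"
      unfolding R_def using O(1) by (simp add: orthogonal_transformation_def)
  qed
  define E where "E = C + (1 / (r * r')) *\<^sub>R (outer (x' 0) y + outer y' (x 0))"
  have dR: "(R has_vector_derivative E) (at 0)"
    unfolding R_def[abs_def] completed_def prod.case E_def
    by (intro has_vector_derivative_add dB bounded_linear.has_vector_derivative[OF bounded_linear_scaleR_right]
        has_vector_derivative_outer dx dx')
  have sk: "(R 0 *v a) \<bullet> (E *v b) + (E *v a) \<bullet> (R 0 *v b) = 0" for a b
  proof (rule locally_constant_derivative[OF _ I])
    show "((\<lambda>t. (R t *v a) \<bullet> (R t *v b)) has_vector_derivative (R 0 *v a) \<bullet> (E *v b) + (E *v a) \<bullet> (R 0 *v b)) (at 0)"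
      using has_vector_derivative_inner[OF has_vector_derivative_mult[OF dR has_vector_derivative_const[of a]]
          has_vector_derivative_mult[OF dR has_vector_derivative_const[of b]]] by simp
    show "(R t *v a) \<bullet> (R t *v b) = a \<bullet> b" if "t \<in> I" for t by (rule orth[OF that])
  qed
  note om0 = om[OF I(2)] and T = transpose_orthogonal[OF om[OF I(2)]]
  define f where "f a = (E *v a) v* R 0" for a
  have "linear f" unfolding f_def by (intro linearI)
      (simp_all add: matrix_vector_right_distrib matrix_vector_mult_scaleR flip: transpose_matrix_vector)
  moreover have "f a \<bullet> b = - (a \<bullet> f b)" for a b
  proof -
    have "f a \<bullet> b = (E *v a) \<bullet> (R 0 *v b)" unfolding f_def using T(4) by (simp add: inner_commute)
    moreover have "a \<bullet> f b = (R 0 *v a) \<bullet> (E *v b)" unfolding f_def using T(4) by simp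
    ultimately show ?thesis using sk[of a b] by simp
  qed
  ultimately obtain \<Omega> where \<Omega>: "\<And>a. f a = cross3 \<Omega> a" using skew_is_cross[of f] by blast
  have E: "E *v a = R 0 *v cross3 \<Omega> a" for a
    unfolding \<Omega>[symmetric] f_def T(2) ..
  define \<xi> where "\<xi> = (1 / r\<^sup>2) *\<^sub>R cross3 (x 0) y"
  define \<eta> where "\<eta> = det (R 0) *\<^sub>R (R 0 *v (\<Omega> + \<xi>))"
  have xy: "x 0 \<bullet> y = 0"
    using locally_constant_derivative[OF has_vector_derivative_inner[OF dx dx] I D(1)] by (simp add: inner_commute)
  have \<xi>x: "cross3 \<xi> (x 0) = y"
    using r by (simp add: \<xi>_def cross_mult_left cross3_cross3_left[OF xy] D0(1))
  have det: "det (R 0) * det (R 0) = 1" using det_orthogonal_matrix[OF om0] by auto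
  have \<eta>R: "cross3 \<eta> (R 0 *v a) = R 0 *v cross3 (\<Omega> + \<xi>) a" for a
    unfolding \<eta>_def cross_mult_left cross_orthogonal_matrix[OF om0] using det by simp
  have Rx: "R 0 *v x 0 = (r / r') *\<^sub>R x' 0"
    using r by (simp add: R_def completed_mult D0 power2_eq_square)
  have dx'R: "y' = cross3 \<eta> (x' 0)"
  proof -
    have "((\<lambda>t. (r' / r) *\<^sub>R (R t *v x t)) has_vector_derivative (r' / r) *\<^sub>R (R 0 *v y + E *v x 0)) (at 0)"
      by (intro bounded_linear.has_vector_derivative[OF bounded_linear_scaleR_right] has_vector_derivative_mult dR dx)
    moreover have "(r' / r) *\<^sub>R (R t *v x t) = x' t" if "t \<in> I" for t
      using r r' D[OF that] by (simp add: R_def completed_mult power2_eq_square)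
    ultimately have "(x' has_vector_derivative (r' / r) *\<^sub>R (R 0 *v y + E *v x 0)) (at 0)"
      using has_vector_derivative_transform_within_open[OF _ I] by blast
    then have "y' = (r' / r) *\<^sub>R (R 0 *v y + E *v x 0)" using dx' vector_derivative_unique_at by blast
    also have "R 0 *v y + E *v x 0 = R 0 *v cross3 (\<Omega> + \<xi>) (x 0)"
      by (simp add: E cross_add_left \<xi>x matrix_vector_right_distrib)
    also have "\<dots> = (r / r') *\<^sub>R cross3 \<eta> (x' 0)" unfolding \<eta>R[symmetric] Rx cross_mult_right ..
    finally show ?thesis using r r' by simp
  qed
  have "C = cross_matrix \<eta> ** B 0 - B 0 ** cross_matrix \<xi>"
  proof (rule matrix_eqI)
    fix a
    have C: "C *v a = E *v a - (1 / (r * r')) *\<^sub>R ((y \<bullet> a) *\<^sub>R x' 0 + (x 0 \<bullet> a) *\<^sub>R y')"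
      by (simp add: E_def)
    have RB: "R 0 *v a = B 0 *v a + ((x 0 \<bullet> a) / (r * r')) *\<^sub>R x' 0" for a by (simp add: R_def completed_mult)
    have "E *v a = R 0 *v cross3 (\<Omega> + \<xi>) a - R 0 *v cross3 \<xi> a"
      by (simp add: E cross_add_left matrix_vector_right_distrib)
    also have "R 0 *v cross3 (\<Omega> + \<xi>) a = cross3 \<eta> (B 0 *v a) + ((x 0 \<bullet> a) / (r * r')) *\<^sub>R y'"
      unfolding \<eta>R[symmetric] by (simp add: RB cross_add_right cross_mult_right dx'R)
    also have "R 0 *v cross3 \<xi> a = B 0 *v cross3 \<xi> a - ((y \<bullet> a) / (r * r')) *\<^sub>R x' 0"
    proof -
      have "x 0 \<bullet> cross3 \<xi> a = - (y \<bullet> a)" unfolding \<xi>x[symmetric] by (simp add: cross3_simps)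
      then show ?thesis by (simp add: RB)
    qed
    finally show "C *v a = (cross_matrix \<eta> ** B 0 - B 0 ** cross_matrix \<xi>) *v a"
      unfolding C by (simp add: algebra_simps)
  qed
  moreover have "q = (x 0, x' 0, B 0)" using g0 by (simp add: xB)
  ultimately have "V = act \<xi> \<eta> q"
    using \<xi>x dx'R by (simp add: act_def yC prod_eq_iff case_prod_unfold)
  then show ?thesis by (rule that)
qed

section \<open>Equivalences of rolling distributions\<close>

lemma derivative_along_curve:
  assumes F: "smooth_map_on M F" and T: "open T" "t \<in> T" "\<gamma> ` T \<subseteq> M"
    and v: "(\<gamma> has_vector_derivative v) (at (t :: real))"
  shows "((\<lambda>s. F (\<gamma> s)) has_vector_derivative frechet_derivative F (at (\<gamma> t) within M) v) (at t)"
proof -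
  obtain d where d: "d > 0" "ball t d \<subseteq> T" using T openE by blast
  define \<delta> where "\<delta> s = \<gamma> (t + s)" for s
  have M: "\<delta> ` {-d<..<d} \<subseteq> M"
    using d T(3) by (auto simp: \<delta>_def subset_iff dist_real_def image_subset_iff)
  have "((\<gamma> \<circ> (\<lambda>s. t + s)) has_vector_derivative 1 *\<^sub>R v) (at 0)"
    by (rule vector_diff_chain_at) (use v in \<open>auto intro!: derivative_eq_intros\<close>)
  then have v0: "(\<delta> has_vector_derivative v) (at 0)" by (simp add: \<delta>_def[abs_def] o_def)
  have "((F \<circ> \<delta>) has_vector_derivative frechet_derivative F (at (\<gamma> t) within M) v) (at (t - t))"
    using frechet_derivative_within_velocity[OF F d(1) M _ v0] by (simp add: \<delta>_def)
  then have "(((F \<circ> \<delta>) \<circ> (\<lambda>s. s - t)) has_vector_derivative 1 *\<^sub>R frechet_derivative F (at (\<gamma> t) within M) v) (at t)"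
    by (intro vector_diff_chain_at) (auto intro!: derivative_eq_intros)
  then show ?thesis by (simp add: \<delta>_def o_def)
qed

lemma velocity_in_image:
  assumes F: "smooth_map_on M F" and FN: "F ` M \<subseteq> N" and v: "velocity_in M q v"
  shows "velocity_in N (F q) (frechet_derivative F (at q within M) v)"
proof -
  obtain \<gamma> e where g: "e > 0" "\<gamma> ` {-e<..<e} \<subseteq> M" "\<gamma> 0 = q" "(\<gamma> has_vector_derivative v) (at (0::real))"
    using v by (auto simp: velocity_in_def)
  have "((F \<circ> \<gamma>) has_vector_derivative frechet_derivative F (at q within M) v) (at 0)"
    by (rule frechet_derivative_within_velocity[OF F g])
  then show ?thesis using g FN unfolding velocity_in_def
    by (intro exI[of _ "F \<circ> \<gamma>"] exI[of _ e]) (auto simp: image_subset_iff)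
qed

lemma velocity_inverse:
  assumes F: "smooth_map_on M F" and G: "smooth_map_on N G" and FN: "F ` M \<subseteq> N"
    and GF: "\<And>q. q \<in> M \<Longrightarrow> G (F q) = q" and v: "velocity_in M q v"
  shows "frechet_derivative G (at (F q) within N) (frechet_derivative F (at q within M) v) = v"
proof -
  obtain \<gamma> e where g: "e > 0" "\<gamma> ` {-e<..<e} \<subseteq> M" "\<gamma> 0 = q" "(\<gamma> has_vector_derivative v) (at (0::real))"
    using v by (auto simp: velocity_in_def)
  have I: "open {-e<..<e}" "0 \<in> {-e<..<e}" using g(1) by auto
  have 1: "((\<lambda>s. F (\<gamma> s)) has_vector_derivative frechet_derivative F (at q within M) v) (at 0)"
    using derivative_along_curve[OF F I g(2,4)] g(3) by simp
  have "((\<lambda>s. G (F (\<gamma> s))) has_vector_derivative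
     frechet_derivative G (at (F (\<gamma> 0)) within N) (frechet_derivative F (at q within M) v)) (at 0)"
    by (rule derivative_along_curve[OF G I _ 1]) (use g(2) FN in auto)
  then have 2: "(\<gamma> has_vector_derivative
     frechet_derivative G (at (F (\<gamma> 0)) within N) (frechet_derivative F (at q within M) v)) (at 0)"
    by (rule has_vector_derivative_transform_within_open[OF _ I]) (use g(2) in \<open>auto intro!: GF\<close>)
  then show ?thesis using g(3,4) vector_derivative_unique_at by blast
qed

lemma D4_velocity: "v \<in> D4 r r' q \<Longrightarrow> velocity_in (M4 r r') q v"
  unfolding D4_def velocity_in_def admissible_def by blast

lemma hor_velocity:
  assumes "r > 0" "r' > 0" "q \<in> M4 r r'" "fst q \<bullet> v = 0"
  shows "velocity_in (M4 r r') q (hor r r' q v)"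
  using hor_in_D4[OF assms] unfolding D4_def velocity_in_def admissible_def by blast

section \<open>Equivalences together with their inverses\<close>

locale rolling_equivalence =
  fixes r1 r1' r2 r2' :: real and F G :: "state \<Rightarrow> state"
  assumes r1: "r1 > 0" and r1': "r1' > 0" and r2: "r2 > 0" and r2': "r2' > 0"
    and F: "smooth_map_on (M4 r1 r1') F" and G: "smooth_map_on (M4 r2 r2') G"
    and FM: "q \<in> M4 r1 r1' \<Longrightarrow> F q \<in> M4 r2 r2'" and GM: "p \<in> M4 r2 r2' \<Longrightarrow> G p \<in> M4 r1 r1'"
    and GF: "q \<in> M4 r1 r1' \<Longrightarrow> G (F q) = q" and FG: "p \<in> M4 r2 r2' \<Longrightarrow> F (G p) = p"
    and dF_D4: "q \<in> M4 r1 r1' \<Longrightarrow> frechet_derivative F (at q within M4 r1 r1') ` D4 r1 r1' q = D4 r2 r2' (F q)"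
begin

abbreviation "dF q \<equiv> frechet_derivative F (at q within M4 r1 r1')"
abbreviation "dG p \<equiv> frechet_derivative G (at p within M4 r2 r2')"

lemma dG_dF: "velocity_in (M4 r1 r1') q v \<Longrightarrow> dG (F q) (dF q v) = v"
  by (rule velocity_inverse[OF F G]) (use FM GF in auto)

text \<open>Only the condition on the distributions is stated for \<open>F\<close> alone; it passes
  to \<open>G\<close> because \<open>dG\<close> undoes \<open>dF\<close> on tangent vectors.\<close>

lemma reverse: "rolling_equivalence r2 r2' r1 r1' G F"
proof
  fix p assume p: "p \<in> M4 r2 r2'"
  have "dG p ` D4 r2 r2' p = dG (F (G p)) ` dF (G p) ` D4 r1 r1' (G p)"
    using dF_D4[OF GM[OF p]] FG[OF p] by simp
  also have "\<dots> = D4 r1 r1' (G p)"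
    unfolding image_image using dG_dF D4_velocity by (auto simp: image_iff)
  finally show "dG p ` D4 r2 r2' p = D4 r1 r1' (G p)" .
qed (use r1 r1' r2 r2' F G FM GM GF FG in auto)

lemma dF_hor:
  assumes q: "q \<in> M4 r1 r1'" and v: "fst q \<bullet> v = 0"
  obtains w where "fst (F q) \<bullet> w = 0" "dF q (hor r1 r1' q v) = hor r2 r2' (F q) w" "v \<noteq> 0 \<Longrightarrow> w \<noteq> 0"
proof -
  have "dF q (hor r1 r1' q v) \<in> D4 r2 r2' (F q)"
    using hor_in_D4[OF r1 r1' q v] dF_D4[OF q] by blast
  then obtain w where w: "fst (F q) \<bullet> w = 0" "dF q (hor r1 r1' q v) = hor r2 r2' (F q) w"
    unfolding D4_eq[OF r2 r2' FM[OF q]] by blast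
  have "v = 0" if "w = 0"
  proof -
    have "hor r1 r1' q v = dG (F q) (hor r2 r2' (F q) 0)"
      using dG_dF[OF hor_velocity[OF r1 r1' q v]] w that by simp
    also have "hor r2 r2' (F q) 0 = 0 *\<^sub>R hor r2 r2' (F q) 0" using hor_scaleR[of r2 r2' "F q" 0 0] by simp
    finally have "hor r1 r1' q v = 0"
      using linear_0[OF linear_frechet_within[OF G FM[OF q]]] by simp
    then show ?thesis by (cases q) (simp add: hor_def zero_prod_def)
  qed
  then show ?thesis using w that by blast
qed

end

text \<open>Horizontal vectors are null for the difference of the metrics of the two spheres; the
  first variation argument differentiates this identity.\<close>

lemma hor_slip:
  assumes r: "r > 0" and r': "r' > 0" and q: "q \<in> M4 r r'" and v: "fst q \<bullet> v = 0"
  shows "fst (hor r r' q v) \<bullet> fst (hor r r' q v) = fst (snd (hor r r' q v)) \<bullet> fst (snd (hor r r' q v))"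
proof -
  obtain x x' B where qx: "q = (x, x', B)" by (cases q)
  show ?thesis using M4_D(5)[OF r r' q[unfolded qx], of v v] v by (simp add: qx hor_def)
qed

lemma act_linear:
  "act (a *\<^sub>R \<xi>) (a *\<^sub>R \<eta>) q = a *\<^sub>R act \<xi> \<eta> q"
  "act (\<xi> + \<xi>') (\<eta> + \<eta>') q = act \<xi> \<eta> q + act \<xi>' \<eta>' q"
  by (cases q; auto simp: act_def cross_mult_left cross_add_left matrix_vector_mult_scaleR
      matrix_vector_right_distrib scaleR_diff_right intro!: matrix_eqI)+

lemma act_bounded_linear: "bounded_linear (act \<xi> \<eta>)"
  unfolding linear_conv_bounded_linear[symmetric]
  by (rule linearI) (auto simp: act_def cross_mult_right cross_add_right matrix_vector_mult_scaleR case_prod_unfold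
      matrix_vector_right_distrib scaleR_diff_right prod_eq_iff intro!: matrix_eqI)

context rolling_equivalence
begin

text \<open>Horizontal curves have equal speeds on the two spheres; this is differentiated along a motion of
  the target.\<close>

lemma speed_variation:
  fixes \<xi> \<eta> :: "real^3"
  assumes p: "p \<in> M4 r2 r2'" and w: "fst p \<bullet> w = 0"
    and g: "C2_on U g" "p \<in> U" "\<And>q. q \<in> M4 r2 r2' \<inter> U \<Longrightarrow> g q = G q"
  defines "Z \<equiv> second_derivative g p (hor r2 r2' p w) (act \<xi> \<eta> p)
      + frechet_derivative g (at p) (act \<xi> \<eta> (hor r2 r2' p w))"
    and "Y \<equiv> dG p (hor r2 r2' p w)"
  shows "fst Y \<bullet> fst Z = fst (snd Y) \<bullet> fst (snd Z)"
proof -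
  obtain H where H: "\<And>\<sigma>::real. orthogonal_matrix (H \<sigma>)" "H 0 = mat 1" "(H has_vector_derivative cross_matrix \<xi>) (at 0)"
    using rotation_curve_exists[of \<xi>] by metis
  obtain K where K: "\<And>\<sigma>::real. orthogonal_matrix (K \<sigma>)" "K 0 = mat 1" "(K has_vector_derivative cross_matrix \<eta>) (at 0)"
    using rotation_curve_exists[of \<eta>] by metis
  define c where "c \<sigma> = motion (H \<sigma>) (K \<sigma>) p" for \<sigma>
  define z where "z \<sigma> = motion (H \<sigma>) (K \<sigma>) (hor r2 r2' p w)" for \<sigma>
  have dc: "(c has_vector_derivative act \<xi> \<eta> p) (at 0)" and dz: "(z has_vector_derivative act \<xi> \<eta> (hor r2 r2' p w)) (at 0)"
    unfolding c_def[abs_def] z_def[abs_def] by (rule motion_derivative[OF H(2,3) K(2,3)])+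
  have c0: "c 0 = p" "z 0 = hor r2 r2' p w" by (simp_all add: c_def z_def H(2) K(2) motion_id)
  define \<phi> where "\<phi> \<sigma> = frechet_derivative g (at (c \<sigma>)) (z \<sigma>)" for \<sigma>
  have d\<phi>: "(\<phi> has_vector_derivative Z) (at 0)"
    unfolding \<phi>_def[abs_def] Z_def
    using second_derivative_chain[OF g(1) _ dc dz] c0 g(2) by simp
  have cM: "c \<sigma> \<in> M4 r2 r2'" for \<sigma> unfolding c_def by (rule motion_M4[OF r2 r2' H(1) K(1) p])
  have ev: "\<forall>\<^sub>F \<sigma> in nhds 0. c \<sigma> \<in> U"
    using has_vector_derivative_continuous[OF dc] C2_onD(1)[OF g(1)]
    by (rule isCont_eventually_nhds) (simp add: c0 g(2))
  then obtain T where T: "open T" "0 \<in> T" "\<And>\<sigma>. \<sigma> \<in> T \<Longrightarrow> c \<sigma> \<in> U" by (auto simp: eventually_nhds)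
  \<comment> \<open>The motion keeps the transported vector horizontal, and the equivalence maps it
    to a horizontal vector of the source, so the speed identity holds for all \<sigma> near
    0.\<close>
  have \<phi>_hor: "fst (\<phi> \<sigma>) \<bullet> fst (\<phi> \<sigma>) - fst (snd (\<phi> \<sigma>)) \<bullet> fst (snd (\<phi> \<sigma>)) = 0 \<and> \<phi> \<sigma> = dG (c \<sigma>) (z \<sigma>)" if "\<sigma> \<in> T" for \<sigma>
  proof -
    have z: "z \<sigma> = hor r2 r2' (c \<sigma>) (H \<sigma> *v w)" unfolding z_def c_def by (rule motion_hor[OF H(1)])
    have o: "fst (c \<sigma>) \<bullet> (H \<sigma> *v w) = 0"
      using w transpose_orthogonal(3)[OF H(1)] by (simp add: c_def motion_def case_prod_unfold)
    note vel = hor_velocity[OF r2 r2' cM o]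
    have e: "dG (c \<sigma>) (z \<sigma>) = \<phi> \<sigma>"
      unfolding \<phi>_def z by (rule extension_derivative[OF G g(1) T(3)[OF that] g(3) vel])
    interpret rev: rolling_equivalence r2 r2' r1 r1' G F by (rule reverse)
    obtain w' where "fst (G (c \<sigma>)) \<bullet> w' = 0" "dG (c \<sigma>) (hor r2 r2' (c \<sigma>) (H \<sigma> *v w)) = hor r1 r1' (G (c \<sigma>)) w'"
      using rev.dF_hor[OF cM o] by blast
    then have "\<phi> \<sigma> = hor r1 r1' (G (c \<sigma>)) w'" "fst (G (c \<sigma>)) \<bullet> w' = 0" using e z by simp_all
    then show ?thesis using hor_slip[OF r1 r1' GM[OF cM[of \<sigma>]], of w'] e by simp
  qed
  have "((\<lambda>\<sigma>. fst (\<phi> \<sigma>) \<bullet> fst (\<phi> \<sigma>) - fst (snd (\<phi> \<sigma>)) \<bullet> fst (snd (\<phi> \<sigma>))) has_vector_derivative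
    (fst (\<phi> 0) \<bullet> fst Z + fst Z \<bullet> fst (\<phi> 0)) - (fst (snd (\<phi> 0)) \<bullet> fst (snd Z) + fst (snd Z) \<bullet> fst (snd (\<phi> 0)))) (at 0)"
    by (intro has_vector_derivative_diff has_vector_derivative_inner has_vector_derivative_fst has_vector_derivative_snd d\<phi>)
  then have "(fst (\<phi> 0) \<bullet> fst Z + fst Z \<bullet> fst (\<phi> 0)) - (fst (snd (\<phi> 0)) \<bullet> fst (snd Z) + fst (snd Z) \<bullet> fst (snd (\<phi> 0))) = 0"
    by (rule locally_constant_derivative[OF _ T(1,2)]) (use \<phi>_hor in blast)
  moreover have "\<phi> 0 = Y" using \<phi>_hor[OF T(2)] by (simp add: Y_def c0)
  ultimately show ?thesis by (simp add: inner_commute)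
qed

end

section \<open>First variation of length\<close>

lemma velocity_tangent:
  assumes "r > 0" "r' > 0" "velocity_in (M4 r r') q V"
  shows "fst q \<bullet> fst V = 0" "fst (snd q) \<bullet> fst (snd V) = 0"
proof -
  obtain \<xi> \<eta> where V: "V = act \<xi> \<eta> q" by (rule velocity_is_act[OF assms])
  show "fst q \<bullet> fst V = 0" "fst (snd q) \<bullet> fst (snd V) = 0"
    unfolding V act_def by (simp_all add: case_prod_unfold dot_cross_self)
qed

locale rolled_curve = rolling_equivalence +
  fixes x x' :: "real^3" and B :: "real^3^3" and u :: "real^3"
  assumes q: "(x, x', B) \<in> M4 r1 r1'" and xu: "x \<bullet> u = 0" and uu: "u \<bullet> u = 1"
begin

definition "c1 t = roll r1 r1' (x, x', B) u t"
definition "d1 t = roll_dir r1 x u t"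
definition "d1' t = roll_dir r1' x' (B *v u) (r1 / r1' * t)"
definition "c2 t = F (c1 t)"

lemmas Q = r1 r1' q xu uu

lemma c1_M4: "c1 t \<in> M4 r1 r1'"
  unfolding c1_def by (rule roll_M4[OF Q])

lemma c2_M4: "c2 t \<in> M4 r2 r2'"
  unfolding c2_def by (rule FM[OF c1_M4])

lemma c1_derivative: "(c1 has_vector_derivative hor r1 r1' (c1 t) (r1 *\<^sub>R d1 t)) (at t)"
  unfolding c1_def[abs_def] d1_def by (rule roll_derivative[OF Q])

lemma c1_d1: "fst (c1 t) \<bullet> d1 t = 0"
  using roll_dir_facts(2)[OF Q] by (simp add: c1_def d1_def roll_def)

lemma d1_unit: "d1 t \<bullet> d1 t = 1"
  using roll_dir_facts(1)[OF Q] by (simp add: d1_def)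

lemma d1_derivative: "(d1 has_vector_derivative - ((1 / r1) *\<^sub>R fst (c1 t))) (at t)"
  using roll_dir_derivative[OF Q r1, of x u 1 t] by (simp add: d1_def[abs_def] c1_def roll_def)

lemma d1'_derivative: "(d1' has_vector_derivative - ((r1 / r1' / r1') *\<^sub>R fst (snd (c1 t)))) (at t)"
  using roll_dir_derivative[OF Q r1', of x' "B *v u" "r1 / r1'" t] by (simp add: d1'_def[abs_def] c1_def roll_def)

lemma c1_mult_d1: "snd (snd (c1 t)) *v d1 t = d1' t"
  unfolding c1_def d1_def d1'_def by (rule roll_mult_dir[OF Q])

definition "w2 t = fst (dF (c1 t) (hor r1 r1' (c1 t) (r1 *\<^sub>R d1 t)))"

lemma c2_hor:
  "dF (c1 t) (hor r1 r1' (c1 t) (r1 *\<^sub>R d1 t)) = hor r2 r2' (c2 t) (w2 t)"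
  "fst (c2 t) \<bullet> w2 t = 0" "w2 t \<noteq> 0"
proof -
  have o: "fst (c1 t) \<bullet> (r1 *\<^sub>R d1 t) = 0" using c1_d1 by simp
  have d: "r1 *\<^sub>R d1 t \<noteq> 0" using r1 d1_unit[of t] by auto
  obtain w where w: "fst (F (c1 t)) \<bullet> w = 0" "dF (c1 t) (hor r1 r1' (c1 t) (r1 *\<^sub>R d1 t)) = hor r2 r2' (F (c1 t)) w"
    "r1 *\<^sub>R d1 t \<noteq> 0 \<Longrightarrow> w \<noteq> 0" by (rule dF_hor[OF c1_M4 o]) blast
  have "w2 t = w" unfolding w2_def w(2) by (simp add: hor_def case_prod_unfold)
  then show "dF (c1 t) (hor r1 r1' (c1 t) (r1 *\<^sub>R d1 t)) = hor r2 r2' (c2 t) (w2 t)"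
    "fst (c2 t) \<bullet> w2 t = 0" "w2 t \<noteq> 0" using w d by (auto simp: c2_def)
qed

lemma c2_derivative: "(c2 has_vector_derivative hor r2 r2' (c2 t) (w2 t)) (at t)"
  using derivative_along_curve[OF F _ _ _ c1_derivative, of UNIV t] c1_M4
  by (auto simp: c2_def[abs_def] c2_hor(1)[symmetric, unfolded c2_def])

text \<open>An infinitesimal motion of the target pulled back to the source curve. As motions
  preserve the target distribution, this is a variation field of \<open>c1\<close> through
  horizontal curves.\<close>

definition "W \<xi> \<eta> t = dG (c2 t) (act \<xi> \<eta> (c2 t))"

text \<open>The boundary terms of the first variation of length on the two spheres, subtracted.\<close>

definition "momentum \<xi> \<eta> t = d1 t \<bullet> fst (W \<xi> \<eta> t) - d1' t \<bullet> fst (snd (W \<xi> \<eta> t))"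

lemma W_velocity: "velocity_in (M4 r1 r1') (c1 t) (W \<xi> \<eta> t)"
proof -
  have "G ` M4 r2 r2' \<subseteq> M4 r1 r1'" using GM by blast
  from velocity_in_image[OF G this act_velocity[OF r2 r2' c2_M4[of t]], of \<xi> \<eta>]
  show ?thesis by (simp add: W_def c2_def GF[OF c1_M4])
qed

text \<open>By symmetry of second derivatives the derivative of \<open>W\<close> along the curve is
  the variation \<open>Z\<close> of the velocity, and \<open>speed_variation\<close> makes its
  components along \<open>d1\<close> and \<open>d1'\<close> agree. The remaining terms vanish
  because along great circles the derivatives of \<open>d1\<close> and \<open>d1'\<close> are normal
  to the spheres.\<close>

lemma momentum_derivative: "(momentum \<xi> \<eta> has_vector_derivative 0) (at t)"
proof -
  obtain U g where g: "C2_on U g" "c2 t \<in> U" "\<And>q. q \<in> M4 r2 r2' \<inter> U \<Longrightarrow> g q = G q"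
    using smooth_map_on_extension[OF G c2_M4[of t]] by metis
  define Z where "Z = second_derivative g (c2 t) (hor r2 r2' (c2 t) (w2 t)) (act \<xi> \<eta> (c2 t))
      + frechet_derivative g (at (c2 t)) (act \<xi> \<eta> (hor r2 r2' (c2 t) (w2 t)))"
  have Y: "dG (c2 t) (hor r2 r2' (c2 t) (w2 t)) = hor r1 r1' (c1 t) (r1 *\<^sub>R d1 t)"
    using dG_dF[OF hor_velocity[OF r1 r1' c1_M4[of t], of "r1 *\<^sub>R d1 t"]] c1_d1[of t]
    by (simp add: c2_hor(1) c2_def[symmetric])
  have "fst (dG (c2 t) (hor r2 r2' (c2 t) (w2 t))) \<bullet> fst Z
      = fst (snd (dG (c2 t) (hor r2 r2' (c2 t) (w2 t)))) \<bullet> fst (snd Z)"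
    unfolding Z_def by (rule speed_variation[OF c2_M4 c2_hor(2) g])
  then have Z: "d1 t \<bullet> fst Z = d1' t \<bullet> fst (snd Z)"
    using r1 c1_mult_d1[of t] unfolding Y by (simp add: hor_def case_prod_unfold matrix_vector_mult_scaleR)
  have "\<forall>\<^sub>F s in nhds t. c2 s \<in> U"
    using has_vector_derivative_continuous[OF c2_derivative] C2_onD(1)[OF g(1)] g(2)
    by (rule isCont_eventually_nhds)
  then obtain T where T: "open T" "t \<in> T" "\<And>s. s \<in> T \<Longrightarrow> c2 s \<in> U" by (auto simp: eventually_nhds)
  have "((\<lambda>s. frechet_derivative g (at (c2 s)) (act \<xi> \<eta> (c2 s))) has_vector_derivative Z) (at t)"
    using second_derivative_chain[OF g(1,2) c2_derivative
        bounded_linear.has_vector_derivative[OF act_bounded_linear c2_derivative], of \<xi> \<eta>]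
    unfolding Z_def second_derivative_symmetric[OF g(1,2), of "hor r2 r2' (c2 t) (w2 t)"] .
  then have dW: "(W \<xi> \<eta> has_vector_derivative Z) (at t)"
    by (rule has_vector_derivative_transform_within_open[OF _ T(1,2)])
      (unfold W_def, rule extension_derivative[OF G g(1) T(3) g(3) act_velocity[OF r2 r2' c2_M4], symmetric])
  have "(momentum \<xi> \<eta> has_vector_derivative
      (d1 t \<bullet> fst Z + - ((1 / r1) *\<^sub>R fst (c1 t)) \<bullet> fst (W \<xi> \<eta> t))
      - (d1' t \<bullet> fst (snd Z) + - ((r1 / r1' / r1') *\<^sub>R fst (snd (c1 t))) \<bullet> fst (snd (W \<xi> \<eta> t)))) (at t)"
    unfolding momentum_def[abs_def]
    by (intro has_vector_derivative_diff has_vector_derivative_inner d1_derivative d1'_derivative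
        has_vector_derivative_fst has_vector_derivative_snd dW)
  then show ?thesis using Z velocity_tangent[OF r1 r1' W_velocity[of t \<xi> \<eta>]] by simp
qed

lemma momentum_constant: "momentum \<xi> \<eta> t = momentum \<xi> \<eta> 0"
proof -
  obtain c where "\<And>t. momentum \<xi> \<eta> t = c"
    using has_vector_derivative_zero_constant[of UNIV "momentum \<xi> \<eta>"] momentum_derivative by auto
  then show ?thesis by simp
qed

lemma linear_dG: "linear (dG (c2 t))"
  by (rule linear_frechet_within[OF G c2_M4])

lemma momentum_linear: "linear (\<lambda>z. momentum (fst z) (snd z) 0)"
proof (rule linearI)
  show "momentum (fst (z + z')) (snd (z + z')) 0 = momentum (fst z) (snd z) 0 + momentum (fst z') (snd z') 0" for z z'
    by (simp add: momentum_def W_def act_linear linear_add[OF linear_dG] inner_add_right)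
  show "momentum (fst (k *\<^sub>R z)) (snd (k *\<^sub>R z)) 0 = k *\<^sub>R momentum (fst z) (snd z) 0" for k z
    by (simp add: momentum_def W_def act_linear linear_scale[OF linear_dG] right_diff_distrib)
qed

lemma momentum_covector:
  obtains \<alpha> \<beta> where "\<And>\<xi> \<eta> t. momentum \<xi> \<eta> t = \<alpha> \<bullet> \<xi> + \<beta> \<bullet> \<eta>"
proof -
  let ?f = "\<lambda>z. momentum (fst z) (snd z) 0"
  define a where "a = adjoint ?f 1"
  have f: "?f z = a \<bullet> z" for z
    using adjoint_works[OF momentum_linear, of z 1] by (simp add: a_def inner_commute)
  have "momentum \<xi> \<eta> t = fst a \<bullet> \<xi> + snd a \<bullet> \<eta>" for \<xi> \<eta> t
    using f[of "(\<xi>, \<eta>)"] momentum_constant[of \<xi> \<eta> t] by (simp add: inner_prod_def)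
  then show ?thesis by (rule that)
qed

text \<open>The equivalence turns the motion into a horizontal vector of the source; on such a
  vector the two terms agree, since the isometry carries \<open>d1\<close> to
  \<open>d1'\<close>.\<close>

lemma momentum_hor:
  assumes "act \<xi> \<eta> (c2 t) = hor r2 r2' (c2 t) v" "fst (c2 t) \<bullet> v = 0"
  shows "momentum \<xi> \<eta> t = 0"
proof -
  interpret rev: rolling_equivalence r2 r2' r1 r1' G F by (rule reverse)
  obtain w where w: "fst (G (c2 t)) \<bullet> w = 0" "dG (c2 t) (hor r2 r2' (c2 t) v) = hor r1 r1' (G (c2 t)) w"
    using rev.dF_hor[OF c2_M4 assms(2)] by blast
  have G2: "G (c2 t) = c1 t" unfolding c2_def by (rule GF[OF c1_M4])
  have W: "W \<xi> \<eta> t = hor r1 r1' (c1 t) w" using w(2) by (simp add: W_def assms(1) G2)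
  obtain X X' C where c: "c1 t = (X, X', C)" by (cases "c1 t") auto
  have "d1' t \<bullet> (C *v w) = (C *v d1 t) \<bullet> (C *v w)" using c1_mult_d1[of t] c by simp
  also have "\<dots> = d1 t \<bullet> w"
    using M4_D(5)[OF r1 r1' c1_M4[of t, unfolded c]] c1_d1[of t] by (simp add: c)
  finally show ?thesis by (simp add: momentum_def W hor_def c)
qed

text \<open>Turning the first sphere alone moves its contact point along \<open>u\<close> and keeps
  the second one fixed, so nothing cancels. This vector is a pulled back motion because every
  tangent vector of the target is an infinitesimal motion.\<close>

lemma momentum_nonzero: "\<exists>\<xi> \<eta>. momentum \<xi> \<eta> 0 \<noteq> 0"
proof -
  have c10: "c1 0 = (x, x', B)" unfolding c1_def by (rule roll_0[OF Q])
  note D = M4_D[OF r1 r1' q]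
  define V where "V = act ((1 / r1\<^sup>2) *\<^sub>R cross3 x u) 0 (c1 0)"
  have vV: "velocity_in (M4 r1 r1') (c1 0) V" unfolding V_def by (rule act_velocity[OF r1 r1' c1_M4])
  have fV: "fst V = u"
    using r1 by (simp add: V_def c10 act_def cross_mult_left cross3_cross3_left[OF xu] D(1))
  have "fst (snd V) = 0" by (simp add: V_def c10 act_def)
  have "velocity_in (M4 r2 r2') (c2 0) (dF (c1 0) V)"
    unfolding c2_def by (rule velocity_in_image[OF F _ vV]) (use FM in auto)
  then obtain \<xi> \<eta> where a: "dF (c1 0) V = act \<xi> \<eta> (c2 0)" using velocity_is_act[OF r2 r2'] by blast
  have "W \<xi> \<eta> 0 = V" unfolding W_def a[symmetric] unfolding c2_def by (rule dG_dF[OF vV])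
  then have "momentum \<xi> \<eta> 0 = 1"
    using fV \<open>fst (snd V) = 0\<close> uu by (simp add: momentum_def d1_def roll_dir_def)
  then show ?thesis by (intro exI[of _ \<xi>] exI[of _ \<eta>]) simp
qed

end

section \<open>Images of curves rolled along great circles\<close>

text \<open>The orientation sign in \<open>momentum_equations\<close> is obtained separately at each
  time, so only squares are seen to be constant; continuity supplies the rest.\<close>

lemma square_constant_imp_constant:
  fixes f :: "real \<Rightarrow> real"
  assumes cont: "continuous_on UNIV f" and sq: "\<And>t. (f t)\<^sup>2 = c"
  shows "f t = f 0"
proof (rule ccontr)
  assume ne: "f t \<noteq> f 0"
  then have "f t = - f 0" using sq[of t] sq[of 0] by (metis power2_eq_iff)
  then have opp: "f t \<le> 0 \<and> 0 \<le> f 0 \<or> f 0 \<le> 0 \<and> 0 \<le> f t" by linarith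
  have cc: "connected (range f)" using cont connected_continuous_image by blast
  have "0 \<in> range f"
    using opp connectedD_interval[OF cc, of "f t" "f 0" 0] connectedD_interval[OF cc, of "f 0" "f t" 0] by auto
  then obtain s where "f s = 0" by auto
  then have "f t = 0" "f 0 = 0" using sq[of s] sq[of t] sq[of 0] by auto
  then show False using ne by simp
qed

lemma hor_zero: "hor r r' q 0 = 0"
  using hor_scaleR[of r r' q 0 0] by simp

context rolled_curve
begin

definition "X t = fst (c2 t)"
definition "X' t = fst (snd (c2 t))"
definition "C t = snd (snd (c2 t))"

lemma c2_eq: "c2 t = (X t, X' t, C t)"
  by (simp add: X_def X'_def C_def)

lemmas D2 = M4_D[OF r2 r2' c2_M4[unfolded c2_eq]]

lemma X_w2: "X t \<bullet> w2 t = 0"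
  using c2_hor(2) by (simp add: X_def)

lemma X_derivative: "(X has_vector_derivative w2 t) (at t)"
  using has_vector_derivative_fst[OF c2_derivative] by (simp add: X_def[abs_def] hor_def case_prod_unfold)

lemma X'_derivative: "(X' has_vector_derivative C t *v w2 t) (at t)"
  using has_vector_derivative_fst[OF has_vector_derivative_snd[OF c2_derivative]]
  by (simp add: X'_def[abs_def] C_def hor_def case_prod_unfold)

definition "C' t = snd (snd (hor r2 r2' (c2 t) (w2 t)))"

lemma C_derivative: "(C has_vector_derivative C' t) (at t)"
  using has_vector_derivative_snd[OF has_vector_derivative_snd[OF c2_derivative]]
  by (simp add: C_def[abs_def] C'_def)

lemma C'_mult: "C' t *v a = - (((X t \<bullet> a) / r2\<^sup>2) *\<^sub>R (C t *v w2 t)) - ((w2 t \<bullet> a) / r2'\<^sup>2) *\<^sub>R X' t"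
  unfolding C'_def c2_eq hor_mult ..

lemma C_w2: "C t *v w2 t \<noteq> 0"
proof
  assume "C t *v w2 t = 0"
  then have "w2 t \<bullet> w2 t = 0" using D2(5)[of t "w2 t" "w2 t"] X_w2[of t] by simp
  then show False using c2_hor(3) by simp
qed

text \<open>The covector annihilates the stabilizer of the state and the motions that realize
  horizontal vectors; these give its normal and its tangential part.\<close>

lemma momentum_equations:
  assumes ab: "\<And>\<xi> \<eta> t. momentum \<xi> \<eta> t = \<alpha> \<bullet> \<xi> + \<beta> \<bullet> \<eta>"
  obtains \<epsilon> :: real where "\<epsilon>\<^sup>2 = 1" "\<alpha> \<bullet> X t = - (\<epsilon> * (r2 / r2') * (\<beta> \<bullet> X' t))"
    "\<alpha> - ((\<alpha> \<bullet> X t) / r2\<^sup>2) *\<^sub>R X t = - ((\<epsilon> * (r2 / r2')) *\<^sub>R (\<beta> v* C t))"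
proof -
  obtain \<epsilon> :: real where e: "\<epsilon>\<^sup>2 = 1"
    "\<And>v. X t \<bullet> v = 0 \<Longrightarrow> C t *v cross3 (X t) v = (\<epsilon> * (r2 / r2')) *\<^sub>R cross3 (X' t) (C t *v v)"
    by (rule M4_orientation[OF r2 r2' c2_M4[unfolded c2_eq]]) blast
  define k where "k = \<epsilon> * (r2 / r2')"
  note e2 = e(2)[folded k_def]
  have 1: "\<alpha> \<bullet> X t + \<beta> \<bullet> (k *\<^sub>R X' t) = 0"
    unfolding ab[symmetric, of _ _ t]
  proof (rule momentum_hor)
    show "act (X t) (k *\<^sub>R X' t) (c2 t) = hor r2 r2' (c2 t) 0"
      unfolding hor_zero c2_eq k_def by (rule act_isotropy[OF r2 r2' c2_M4[unfolded c2_eq] e(2)])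
  qed simp
  have 2: "\<alpha> \<bullet> \<xi> + \<beta> \<bullet> (k *\<^sub>R (C t *v \<xi>)) = 0" if "X t \<bullet> \<xi> = 0" for \<xi>
    unfolding ab[symmetric, of _ _ t]
  proof (rule momentum_hor)
    show "act \<xi> (k *\<^sub>R (C t *v \<xi>)) (c2 t) = hor r2 r2' (c2 t) (cross3 \<xi> (X t))"
      unfolding c2_eq k_def by (rule act_hor[OF r2 r2' c2_M4[unfolded c2_eq] e(2) that])
    show "fst (c2 t) \<bullet> cross3 \<xi> (X t) = 0" by (simp add: c2_eq dot_cross_self)
  qed
  \<comment> \<open>The difference of the two sides is itself tangent, so it may be inserted for
    \<xi>, which yields \<open>z \<bullet> z = 0\<close>.\<close>
  define z where "z = \<alpha> - ((\<alpha> \<bullet> X t) / r2\<^sup>2) *\<^sub>R X t + k *\<^sub>R (\<beta> v* C t)"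
  have bX: "X t \<bullet> (\<beta> v* C t) = 0" using dot_vector_matrix[of \<beta> "C t" "X t"] D2(3) by (simp add: inner_commute)
  have Xz: "X t \<bullet> z = 0"
    using r2 by (simp add: z_def inner_add_right inner_diff_right bX D2(1) inner_commute[of \<alpha>])
  have "z \<bullet> z = \<alpha> \<bullet> z + k * ((\<beta> v* C t) \<bullet> z)"
    using Xz by (subst (1) z_def) (simp add: inner_add_left inner_diff_left)
  also have "\<dots> = 0" using 2[OF Xz] by (simp add: dot_vector_matrix)
  finally have "z = 0" by simp
  then have "\<alpha> - ((\<alpha> \<bullet> X t) / r2\<^sup>2) *\<^sub>R X t = - (k *\<^sub>R (\<beta> v* C t))"
    by (simp add: z_def eq_neg_iff_add_eq_0)
  then show ?thesis using 1 that[OF e(1)] by (simp add: k_def eq_neg_iff_add_eq_0)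
qed

text \<open>Comparing lengths in \<open>momentum_equations\<close> removes the sign. The second
  identity is where unequal radii enter: its left side is constant in time, and a nonzero factor on
  the right makes the square constant too.\<close>

lemma momentum_norms:
  assumes ab: "\<And>\<xi> \<eta> t. momentum \<xi> \<eta> t = \<alpha> \<bullet> \<xi> + \<beta> \<bullet> \<eta>"
  shows "(\<alpha> \<bullet> X t)\<^sup>2 = (r2 / r2')\<^sup>2 * (\<beta> \<bullet> X' t)\<^sup>2"
    and "\<alpha> \<bullet> \<alpha> - (r2 / r2')\<^sup>2 * (\<beta> \<bullet> \<beta>) = (\<alpha> \<bullet> X t)\<^sup>2 * (1 / r2\<^sup>2 - 1 / r2'\<^sup>2)"
proof -
  obtain \<epsilon> :: real where e: "\<epsilon>\<^sup>2 = 1" and 1: "\<alpha> \<bullet> X t = - (\<epsilon> * (r2 / r2') * (\<beta> \<bullet> X' t))"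
    and 2: "\<alpha> - ((\<alpha> \<bullet> X t) / r2\<^sup>2) *\<^sub>R X t = - ((\<epsilon> * (r2 / r2')) *\<^sub>R (\<beta> v* C t))"
    by (rule momentum_equations[OF ab])
  show sq: "(\<alpha> \<bullet> X t)\<^sup>2 = (r2 / r2')\<^sup>2 * (\<beta> \<bullet> X' t)\<^sup>2"
    unfolding 1 by (simp add: power_mult_distrib power_divide e)
  let ?a = "\<alpha> - ((\<alpha> \<bullet> X t) / r2\<^sup>2) *\<^sub>R X t"
  have "?a \<bullet> ?a = \<alpha> \<bullet> \<alpha> - (\<alpha> \<bullet> X t)\<^sup>2 / r2\<^sup>2"
    using r2 by (simp add: inner_diff_left inner_diff_right D2(1) inner_commute[of "X t" \<alpha>] power2_eq_square)
  moreover have "?a \<bullet> ?a = (r2 / r2')\<^sup>2 * (\<beta> \<bullet> \<beta> - (\<beta> \<bullet> X' t)\<^sup>2 / r2'\<^sup>2)"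
  proof -
    have "?a \<bullet> ?a = (\<epsilon> * (r2 / r2'))\<^sup>2 * ((\<beta> v* C t) \<bullet> (\<beta> v* C t))"
      unfolding 2 by (simp add: power2_eq_square)
    then show ?thesis
      unfolding M4_transpose(2)[OF r2 r2' c2_M4[unfolded c2_eq]]
      by (simp add: power_mult_distrib power_divide e inner_commute[of \<beta> "X' t"])
  qed
  ultimately have "\<alpha> \<bullet> \<alpha> - (\<alpha> \<bullet> X t)\<^sup>2 / r2\<^sup>2 = (r2 / r2')\<^sup>2 * (\<beta> \<bullet> \<beta>) - (r2 / r2')\<^sup>2 * (\<beta> \<bullet> X' t)\<^sup>2 / r2'\<^sup>2"
    by (simp add: right_diff_distrib)
  then show "\<alpha> \<bullet> \<alpha> - (r2 / r2')\<^sup>2 * (\<beta> \<bullet> \<beta>) = (\<alpha> \<bullet> X t)\<^sup>2 * (1 / r2\<^sup>2 - 1 / r2'\<^sup>2)"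
    unfolding sq[symmetric] by (simp add: right_diff_distrib)
qed

text \<open>Constancy of \<open>\<alpha> \<bullet> X t\<close> puts the image on some circle with
  axis \<alpha>; the main point is that the constant is zero.\<close>

lemma image_great_circle:
  assumes ne: "r2 \<noteq> r2'"
  obtains \<alpha> where "\<alpha> \<noteq> 0" "\<And>t. \<alpha> \<bullet> X t = 0" "\<And>t. \<alpha> \<bullet> w2 t = 0" "\<And>t. C t *v \<alpha> = C 0 *v \<alpha>"
proof -
  obtain \<alpha> \<beta> where ab: "\<And>\<xi> \<eta> t. momentum \<xi> \<eta> t = \<alpha> \<bullet> \<xi> + \<beta> \<bullet> \<eta>"
    using momentum_covector by blast
  note N = momentum_norms[OF ab]
  define l where "l = r2 / r2'"
  have l: "l > 0" using r2 r2' by (simp add: l_def)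
  have d: "1 / r2\<^sup>2 - 1 / r2'\<^sup>2 \<noteq> 0"
  proof
    assume "1 / r2\<^sup>2 - 1 / r2'\<^sup>2 = 0"
    then have "r2\<^sup>2 = r2'\<^sup>2" using r2 r2' by (simp add: field_simps)
    then show False using ne r2 r2' by (simp add: power2_eq_iff)
  qed
  have cX: "continuous_on UNIV X" "continuous_on UNIV X'"
    using has_vector_derivative_continuous[OF X_derivative] has_vector_derivative_continuous[OF X'_derivative]
    by (auto intro!: continuous_at_imp_continuous_on)
  define k where "k = \<alpha> \<bullet> X 0"
  have "(\<alpha> \<bullet> X t)\<^sup>2 = (\<alpha> \<bullet> \<alpha> - (r2 / r2')\<^sup>2 * (\<beta> \<bullet> \<beta>)) / (1 / r2\<^sup>2 - 1 / r2'\<^sup>2)" for t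
    using N(2)[of t] d by simp
  then have k: "\<alpha> \<bullet> X t = k" for t
    unfolding k_def by (rule square_constant_imp_constant[rotated]) (intro continuous_intros cX)
  define m where "m = \<beta> \<bullet> X' 0"
  have "(\<beta> \<bullet> X' t)\<^sup>2 = k\<^sup>2 / l\<^sup>2" for t
    using N(1)[of t] l unfolding k l_def[symmetric] by simp
  then have m: "\<beta> \<bullet> X' t = m" for t
    unfolding m_def by (rule square_constant_imp_constant[rotated]) (intro continuous_intros cX)
  have \<alpha>w: "\<alpha> \<bullet> w2 t = 0" for t
    using locally_constant_derivative[OF has_vector_derivative_inner[OF has_vector_derivative_const[of \<alpha>] X_derivative[of t]], of UNIV k] k
    by simp
  \<comment> \<open>On a smaller circle the isometry would relate the tangential parts of \<alpha>
    and \<beta> by a fixed factor. Differentiating this relation gives two multiples of the velocity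
    whose coefficients differ by \<open>k * (1 / r2\<^sup>2 - 1 / r2'\<^sup>2)\<close>.\<close>
  have k0: "k = 0"
  proof (rule ccontr)
    assume kn: "k \<noteq> 0"
    have mn: "m \<noteq> 0" using N(1)[of 0] kn unfolding k m by auto
    have eq: "C t *v (\<alpha> - (k / r2\<^sup>2) *\<^sub>R X t) = (k / m) *\<^sub>R \<beta> - (k / r2'\<^sup>2) *\<^sub>R X' t" for t
    proof -
      obtain \<epsilon> :: real where e: "\<epsilon>\<^sup>2 = 1" and 1: "k = - (\<epsilon> * (r2 / r2') * m)"
        and 2: "\<alpha> - (k / r2\<^sup>2) *\<^sub>R X t = - ((\<epsilon> * (r2 / r2')) *\<^sub>R (\<beta> v* C t))"
        using momentum_equations[OF ab, of t] unfolding k m by metis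
      have e': "\<epsilon> * (r2 / r2') = - (k / m)" using 1 mn by (simp add: field_simps)
      show ?thesis
        unfolding 2 e' using mn
        by (simp add: matrix_vector_mult_scaleR M4_transpose(1)[OF r2 r2' c2_M4[unfolded c2_eq]]
            scaleR_diff_right inner_commute[of "X' t"] m)
    qed
    have dl: "((\<lambda>t. C t *v (\<alpha> - (k / r2\<^sup>2) *\<^sub>R X t)) has_vector_derivative
        C 0 *v (0 - (k / r2\<^sup>2) *\<^sub>R w2 0) + C' 0 *v (\<alpha> - (k / r2\<^sup>2) *\<^sub>R X 0)) (at 0)"
      by (intro has_vector_derivative_mult C_derivative has_vector_derivative_diff has_vector_derivative_const
          bounded_linear.has_vector_derivative[OF bounded_linear_scaleR_right] X_derivative)
    have dr: "((\<lambda>t. C t *v (\<alpha> - (k / r2\<^sup>2) *\<^sub>R X t)) has_vector_derivative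
        0 - (k / r2'\<^sup>2) *\<^sub>R (C 0 *v w2 0)) (at 0)"
      unfolding eq
      by (intro has_vector_derivative_diff has_vector_derivative_const
          bounded_linear.has_vector_derivative[OF bounded_linear_scaleR_right] X'_derivative)
    have "X 0 \<bullet> (\<alpha> - (k / r2\<^sup>2) *\<^sub>R X 0) = 0"
      using k[of 0] r2 by (simp add: inner_diff_right D2(1) inner_commute[of _ \<alpha>])
    moreover have "w2 0 \<bullet> (\<alpha> - (k / r2\<^sup>2) *\<^sub>R X 0) = 0"
      using \<alpha>w[of 0] X_w2[of 0] by (simp add: inner_diff_right inner_commute)
    ultimately have "C' 0 *v (\<alpha> - (k / r2\<^sup>2) *\<^sub>R X 0) = 0" by (simp add: C'_mult)
    then have "- ((k / r2\<^sup>2) *\<^sub>R (C 0 *v w2 0)) = - ((k / r2'\<^sup>2) *\<^sub>R (C 0 *v w2 0))"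
      using vector_derivative_unique_at[OF dl dr] by (simp add: matrix_vector_mult_scaleR)
    then have "(k * (1 / r2\<^sup>2 - 1 / r2'\<^sup>2)) *\<^sub>R (C 0 *v w2 0) = 0"
      by (simp add: algebra_simps)
    then show False using kn d C_w2 by simp
  qed
  have \<alpha>X: "\<alpha> \<bullet> X t = 0" for t using k k0 by simp
  have \<beta>X: "\<beta> \<bullet> X' t = 0" for t using N(1)[of t] r2 r2' \<alpha>X[of t] by simp
  have "\<alpha> \<noteq> 0"
  proof
    assume "\<alpha> = 0"
    then have "\<beta> = 0" using N(2)[of 0] r2 r2' by simp
    then show False using momentum_nonzero ab \<open>\<alpha> = 0\<close> by auto
  qed
  moreover have "C t *v \<alpha> = C 0 *v \<alpha>" for t
  proof -
    have "((\<lambda>t. C t *v \<alpha>) has_vector_derivative 0) (at t)" for t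
      using has_vector_derivative_mult[OF C_derivative[of t] has_vector_derivative_const[of \<alpha>]] \<alpha>X[of t] \<alpha>w[of t]
      by (simp add: C'_mult inner_commute)
    then obtain c where "\<And>t. C t *v \<alpha> = c"
      using has_vector_derivative_zero_constant[of UNIV "\<lambda>t. C t *v \<alpha>"] by auto
    then show ?thesis by simp
  qed
  ultimately show ?thesis using that \<alpha>X \<alpha>w by blast
qed

text \<open>Left unnormalized so that it is linear in the initial velocity;
  \<open>fan_constraints\<close> depends on this.\<close>

definition "N2 = cross3 (X 0) (w2 0)"

lemma N2_constant:
  assumes ne: "r2 \<noteq> r2'"
  shows "N2 \<bullet> X t = 0" "N2 \<bullet> w2 t = 0" "C t *v N2 = C 0 *v N2"
proof -
  obtain \<alpha> where a: "\<alpha> \<noteq> 0" "\<And>t. \<alpha> \<bullet> X t = 0" "\<And>t. \<alpha> \<bullet> w2 t = 0" "\<And>t. C t *v \<alpha> = C 0 *v \<alpha>"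
    using image_great_circle[OF ne] by blast
  obtain c where c: "N2 = c *\<^sub>R \<alpha>" unfolding N2_def using cross3_orthogonal[OF a(2,3,1)] by blast
  show "N2 \<bullet> X t = 0" "N2 \<bullet> w2 t = 0" "C t *v N2 = C 0 *v N2"
    unfolding c using a by (simp_all add: matrix_vector_mult_scaleR)
qed

end

lemma has_vector_derivative_hor:
  assumes c: "(c has_vector_derivative c') (at t)" and v: "(v has_vector_derivative v') (at t)"
  shows "\<exists>D. ((\<lambda>t. hor r r' (c t) (v t)) has_vector_derivative D) (at t)"
proof -
  note f = has_vector_derivative_fst[OF c] has_vector_derivative_fst[OF has_vector_derivative_snd[OF c]]
    has_vector_derivative_snd[OF has_vector_derivative_snd[OF c]]
  note Bv = has_vector_derivative_mult[OF f(3) v]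
  show ?thesis
    unfolding hor_def case_prod_unfold
    by (rule exI, rule has_vector_derivative_Pair[OF v has_vector_derivative_Pair[OF Bv has_vector_derivative_diff[OF
        has_vector_derivative_minus[OF bounded_linear.has_vector_derivative[OF bounded_linear_scaleR_right
            has_vector_derivative_outer[OF Bv f(1)]]]
        bounded_linear.has_vector_derivative[OF bounded_linear_scaleR_right has_vector_derivative_outer[OF f(2) v]]]]])
qed

lemma cross_cross_plane:
  assumes "n \<bullet> n = 1" "n \<bullet> a = 0"
  shows "cross3 n (cross3 n a) = - a"
  using assms by (simp add: Lagrange)

lemma orthogonal_basis_eqI:
  fixes A A' :: "real^3^3"
  assumes x: "x \<noteq> 0" "x \<bullet> e = 0" "e \<noteq> 0"
    and eq: "A *v x = A' *v x" "A *v e = A' *v e" "A *v cross3 x e = A' *v cross3 x e"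
  shows "A = A'"
proof (rule matrix_eqI)
  fix a
  let ?n = "cross3 x e"
  have nn: "?n \<noteq> 0"
  proof
    assume "?n = 0"
    then show False using norm_cross_dot[of x e] x by simp
  qed
  define z where "z = a - ((x \<bullet> a) / (x \<bullet> x)) *\<^sub>R x - ((e \<bullet> a) / (e \<bullet> e)) *\<^sub>R e - ((?n \<bullet> a) / (?n \<bullet> ?n)) *\<^sub>R ?n"
  have "z = 0"
    by (rule orthogonal_frame_zero[OF x(1,3,2)])
      (use x nn in \<open>simp_all add: z_def inner_diff_right dot_cross_self inner_commute[of e x]\<close>)
  then obtain k l m where a: "a = k *\<^sub>R x + l *\<^sub>R e + m *\<^sub>R ?n"
    unfolding z_def by (metis (no_types) diff_diff_add eq_iff_diff_eq_0)
  show "A *v a = A' *v a"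
    unfolding a by (simp add: eq matrix_vector_mult_scaleR matrix_vector_right_distrib)
qed

section \<open>The image curve as a reparametrized rolled curve\<close>

context rolled_curve
begin

text \<open>Supplies the continuity of the angular speed whose antiderivative is the
  reparametrization.\<close>

lemma w2_differentiable: "\<exists>D. (w2 has_vector_derivative D) (at t)"
proof -
  obtain U g where g: "C2_on U g" "c1 t \<in> U" "\<And>q. q \<in> M4 r1 r1' \<inter> U \<Longrightarrow> g q = F q"
    using smooth_map_on_extension[OF F c1_M4[of t]] by metis
  obtain D where D: "((\<lambda>t. hor r1 r1' (c1 t) (r1 *\<^sub>R d1 t)) has_vector_derivative D) (at t)"
    using has_vector_derivative_hor[OF c1_derivative bounded_linear.has_vector_derivative[OF bounded_linear_scaleR_right d1_derivative]]
    by blast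
  have "\<forall>\<^sub>F s in nhds t. c1 s \<in> U"
    using has_vector_derivative_continuous[OF c1_derivative] C2_onD(1)[OF g(1)] g(2)
    by (rule isCont_eventually_nhds)
  then obtain T where T: "open T" "t \<in> T" "\<And>s. s \<in> T \<Longrightarrow> c1 s \<in> U" by (auto simp: eventually_nhds)
  have e: "dF (c1 s) (hor r1 r1' (c1 s) (r1 *\<^sub>R d1 s)) = frechet_derivative g (at (c1 s)) (hor r1 r1' (c1 s) (r1 *\<^sub>R d1 s))"
    if "s \<in> T" for s
    by (rule extension_derivative[OF F g(1) T(3)[OF that] g(3) hor_velocity[OF r1 r1' c1_M4]])
      (simp_all add: c1_d1)
  have "((\<lambda>s. dF (c1 s) (hor r1 r1' (c1 s) (r1 *\<^sub>R d1 s))) has_vector_derivative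
     second_derivative g (c1 t) (hor r1 r1' (c1 t) (r1 *\<^sub>R d1 t)) (hor r1 r1' (c1 t) (r1 *\<^sub>R d1 t))
      + frechet_derivative g (at (c1 t)) D) (at t)"
    by (rule has_vector_derivative_transform_within_open[OF second_derivative_chain[OF g(1,2) c1_derivative D] T(1,2)])
      (rule e[symmetric])
  from has_vector_derivative_fst[OF this] show ?thesis unfolding w2_def[abs_def] by blast
qed

definition "u2 = (1 / norm (w2 0)) *\<^sub>R w2 0"

lemma u2: "X 0 \<bullet> u2 = 0" "u2 \<bullet> u2 = 1"
  using X_w2[of 0] c2_hor(3)[of 0] by (simp_all add: u2_def dot_square_norm power2_eq_square)

lemmas Q2 = r2 r2' c2_M4[of 0, unfolded c2_eq] u2

lemma image_roll:
  assumes ne: "r2 \<noteq> r2'"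
  obtains s where "s 0 = 0" "strict_mono s" "continuous_on UNIV s"
    "\<And>t. c2 t = roll r2 r2' (c2 0) u2 (s t)"
    "\<And>t. \<exists>k>0. w2 t = k *\<^sub>R roll_dir r2 (X 0) u2 (s t)"
proof -
  define n where "n = (1 / r2) *\<^sub>R cross3 (X 0) u2"
  have nN: "n = (1 / (r2 * norm (w2 0))) *\<^sub>R N2"
    by (simp add: n_def u2_def N2_def cross_mult_right)
  have nX: "n \<bullet> X t = 0" and nw: "n \<bullet> w2 t = 0" and Cn: "C t *v n = C 0 *v n" for t
    using N2_constant[OF ne, of t] by (simp_all add: nN matrix_vector_mult_scaleR)
  have nn: "n \<bullet> n = 1"
    unfolding n_def by (rule cross3_unit[OF D2(1) r2 u2(2,1)])
  have nX0: "cross3 n (X 0) = r2 *\<^sub>R u2"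
    using r2 by (simp add: n_def cross_mult_left cross3_cross3_left[OF u2(1)] D2(1) power2_eq_square)
  have nu: "cross3 n u2 = - ((1 / r2) *\<^sub>R X 0)"
  proof -
    have "n \<bullet> X 0 = 0" by (rule nX)
    from cross_cross_plane[OF nn this] have "r2 *\<^sub>R cross3 n u2 = - X 0" by (simp add: nX0 cross_mult_right)
    then have "(1 / r2) *\<^sub>R (r2 *\<^sub>R cross3 n u2) = (1 / r2) *\<^sub>R (- X 0)" by simp
    then show ?thesis using r2 by simp
  qed
  \<comment> \<open>Angular speed of the image about the fixed unit axis \<open>n\<close>. It is
    continuous and never zero, so it keeps the positive sign it has at time 0.\<close>
  define \<rho> where "\<rho> t = (n \<bullet> cross3 (X t) (w2 t)) / r2\<^sup>2" for t
  have w: "w2 t = \<rho> t *\<^sub>R cross3 n (X t)" for t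
  proof -
    have n0: "n \<noteq> 0" using nn by auto
    have "cross3 (X t) (w2 t) = (n \<bullet> cross3 (X t) (w2 t)) *\<^sub>R n"
      using cross3_orthogonal[OF nX nw n0] nn by simp
    then have "cross3 (X t) (cross3 (X t) (w2 t)) = (n \<bullet> cross3 (X t) (w2 t)) *\<^sub>R cross3 (X t) n"
      by (metis cross_mult_right)
    then have "- (r2\<^sup>2 *\<^sub>R w2 t) = (n \<bullet> cross3 (X t) (w2 t)) *\<^sub>R cross3 (X t) n"
      by (simp add: Lagrange X_w2 D2)
    also have "cross3 (X t) n = - cross3 n (X t)" by (rule cross_skew)
    finally have "r2\<^sup>2 *\<^sub>R w2 t = (n \<bullet> cross3 (X t) (w2 t)) *\<^sub>R cross3 n (X t)" by simp
    then have "(1 / r2\<^sup>2) *\<^sub>R (r2\<^sup>2 *\<^sub>R w2 t) = (1 / r2\<^sup>2) *\<^sub>R ((n \<bullet> cross3 (X t) (w2 t)) *\<^sub>R cross3 n (X t))" by simp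
    then show ?thesis using r2 by (simp add: \<rho>_def)
  qed
  have \<rho>0: "\<rho> t \<noteq> 0" for t using w[of t] c2_hor(3)[of t] by auto
  have cont_w: "continuous_on UNIV w2"
    using w2_differentiable has_vector_derivative_continuous by (blast intro: continuous_at_imp_continuous_on)
  have cont_X: "continuous_on UNIV X"
    using has_vector_derivative_continuous[OF X_derivative] by (auto intro!: continuous_at_imp_continuous_on)
  have cont: "continuous_on UNIV \<rho>"
    unfolding \<rho>_def by (intro continuous_intros continuous_on_cross cont_w cont_X) (use r2 in auto)
  have \<rho>pos0: "\<rho> 0 > 0"
  proof -
    have "w2 0 = norm (w2 0) *\<^sub>R u2" using c2_hor(3)[of 0] by (simp add: u2_def)
    then have "cross3 (X 0) (w2 0) = norm (w2 0) *\<^sub>R cross3 (X 0) u2" by (metis cross_mult_right)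
    also have "cross3 (X 0) u2 = r2 *\<^sub>R n" using r2 by (simp add: n_def)
    finally have "\<rho> 0 = norm (w2 0) / r2" using r2 nn by (simp add: \<rho>_def power2_eq_square)
    then show ?thesis using r2 c2_hor(3)[of 0] by simp
  qed
  have \<rho>pos: "\<rho> t > 0" for t
  proof (rule ccontr)
    assume "\<not> \<rho> t > 0"
    then have "\<rho> t \<le> 0" by simp
    have cc: "connected (range \<rho>)" using cont connected_continuous_image by blast
    then have "0 \<in> range \<rho>"
      using \<open>\<rho> t \<le> 0\<close> \<rho>pos0 connectedD_interval[of "range \<rho>" "\<rho> t" "\<rho> 0" 0] by auto
    then show False using \<rho>0 by auto
  qed
  obtain s0 where s0: "\<And>t. (s0 has_vector_derivative \<rho> t) (at t)"
    using einterval_antiderivative[of "-\<infinity>" "\<infinity>" \<rho>] cont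
    by (auto simp: continuous_on_eq_continuous_at)
  define s where "s t = s0 t - s0 0" for t
  have ds: "(s has_real_derivative \<rho> t) (at t)" for t
    unfolding s_def[abs_def] has_real_derivative_iff_has_vector_derivative
    using has_vector_derivative_diff[OF s0 has_vector_derivative_const[of "s0 0"]] by simp
  have s00: "s 0 = 0" by (simp add: s_def)
  have mono: "strict_mono s"
    by (rule strict_monoI) (metis DERIV_pos_imp_increasing ds \<rho>pos)
  have cs: "continuous_on UNIV s"
    using ds DERIV_isCont by (blast intro: continuous_at_imp_continuous_on)
  define Y where "Y t = cos (s t) *\<^sub>R X 0 + (r2 * sin (s t)) *\<^sub>R u2" for t
  define e where "e t = roll_dir r2 (X 0) u2 (s t)" for t
  have nY: "cross3 n (Y t) = r2 *\<^sub>R e t" for t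
    using r2 by (simp add: Y_def e_def roll_dir_def cross_add_right cross_mult_right nX0 nu algebra_simps)
  have ne: "n \<bullet> Y t = 0" for t
    using nX[of 0] by (simp add: Y_def inner_add_right n_def dot_cross_self)
  have dY: "(Y has_vector_derivative (\<rho> t * r2) *\<^sub>R e t) (at t)" for t
    unfolding Y_def[abs_def] e_def roll_dir_def
    using r2 by (auto intro!: derivative_eq_intros ds simp: algebra_simps)
  have YY: "Y t \<bullet> Y t = r2\<^sup>2" for t
  proof -
    have "Y t \<bullet> Y t = r2\<^sup>2 * (cos (s t))\<^sup>2 + r2\<^sup>2 * (sin (s t))\<^sup>2"
      using u2 by (simp add: Y_def inner_add_left inner_add_right D2(1) inner_commute[of u2 "X 0"] power2_eq_square)
    then show ?thesis unfolding distrib_left[symmetric] by simp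
  qed
  \<comment> \<open>Both curves turn about \<open>n\<close> at the rate \<rho>, so their inner
    product keeps its initial value \<open>r2\<^sup>2\<close>; for vectors of length
    \<open>r2\<close> this forces equality.\<close>
  have XY: "X t = Y t" for t
  proof -
    have "((\<lambda>t. X t \<bullet> Y t) has_vector_derivative 0) (at t)" for t
    proof -
      have "X t \<bullet> cross3 n (Y t) + cross3 n (X t) \<bullet> Y t = 0" by (simp add: cross3_simps)
      then have "X t \<bullet> ((\<rho> t * r2) *\<^sub>R e t) + w2 t \<bullet> Y t = 0"
        unfolding nY w by (simp add: distrib_left[symmetric] mult.assoc)
      then show ?thesis
        using has_vector_derivative_inner[OF X_derivative dY, of t] by simp
    qed
    then obtain c where "\<And>t. X t \<bullet> Y t = c"
      using has_vector_derivative_zero_constant[of UNIV "\<lambda>t. X t \<bullet> Y t"] by auto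
    then have "X t \<bullet> Y t = X 0 \<bullet> Y 0" by simp
    then have "X t \<bullet> Y t = r2\<^sup>2" by (simp add: Y_def s00 D2)
    then have "(X t - Y t) \<bullet> (X t - Y t) = 0"
      by (simp add: inner_diff_left inner_diff_right YY D2 inner_commute[of "Y t" "X t"])
    then show ?thesis by simp
  qed
  have we: "w2 t = (\<rho> t * r2) *\<^sub>R e t" for t
    unfolding w XY nY by simp
  let ?l = "r2 / r2'"
  define Z where "Z t = cos (?l * s t) *\<^sub>R X' 0 + (r2' * sin (?l * s t)) *\<^sub>R (C 0 *v u2)" for t
  define f where "f t = roll_dir r2' (X' 0) (C 0 *v u2) (?l * s t)" for t
  define h where "h t = C t *v e t" for t
  have dZ: "(Z has_vector_derivative (\<rho> t * r2) *\<^sub>R f t) (at t)" for t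
    unfolding Z_def[abs_def] f_def roll_dir_def
    using r2 r2' by (auto intro!: derivative_eq_intros ds simp: algebra_simps)
  have df: "(f has_vector_derivative - ((\<rho> t * r2 / r2'\<^sup>2) *\<^sub>R Z t)) (at t)" for t
    unfolding f_def[abs_def] Z_def roll_dir_def
    using r2 r2' by (auto intro!: derivative_eq_intros ds simp: algebra_simps power2_eq_square)
  have de: "(e has_vector_derivative - ((\<rho> t / r2) *\<^sub>R Y t)) (at t)" for t
    unfolding e_def[abs_def] Y_def roll_dir_def
    using r2 by (auto intro!: derivative_eq_intros ds simp: algebra_simps)
  have Xe: "X t \<bullet> e t = 0" for t
  proof -
    have "Y t \<bullet> e t = 0" unfolding Y_def e_def by (rule roll_dir_facts(2)[OF Q2])
    then show ?thesis unfolding XY[of t] .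
  qed
  have ee: "e t \<bullet> e t = 1" for t
    using roll_dir_facts(1)[OF Q2] by (simp add: e_def)
  have dX': "(X' has_vector_derivative (\<rho> t * r2) *\<^sub>R h t) (at t)" for t
    using X'_derivative[of t] by (simp add: we h_def matrix_vector_mult_scaleR)
  have dh: "(h has_vector_derivative - ((\<rho> t * r2 / r2'\<^sup>2) *\<^sub>R X' t)) (at t)" for t
  proof -
    have "C t *v - ((\<rho> t / r2) *\<^sub>R Y t) + C' t *v e t = - ((\<rho> t * r2 / r2'\<^sup>2) *\<^sub>R X' t)"
      by (simp add: C'_mult Xe ee we XY[symmetric] matrix_vector_mult_scaleR D2)
    then show ?thesis
      unfolding h_def[abs_def] using has_vector_derivative_mult[OF C_derivative de, of t] by simp
  qed
  have ZX: "X' t = Z t \<and> h t = f t" for t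
  proof -
    \<comment> \<open>The pairs \<open>X'\<close>, \<open>h\<close> and \<open>Z\<close>,
      \<open>f\<close> solve one linear system with the same initial values. The weight makes that
      system skew, so the squared distance of the solutions is conserved.\<close>
    define E where "E t = (1 / r2'\<^sup>2) *\<^sub>R ((X' t - Z t) \<bullet> (X' t - Z t)) + (h t - f t) \<bullet> (h t - f t)" for t
    have "(E has_vector_derivative 0) (at t)" for t
    proof -
      let ?p = "X' t - Z t" and ?q = "h t - f t"
      have "(E has_vector_derivative
        (1 / r2'\<^sup>2) *\<^sub>R (?p \<bullet> ((\<rho> t * r2) *\<^sub>R h t - (\<rho> t * r2) *\<^sub>R f t) + ((\<rho> t * r2) *\<^sub>R h t - (\<rho> t * r2) *\<^sub>R f t) \<bullet> ?p)
        + (?q \<bullet> (- ((\<rho> t * r2 / r2'\<^sup>2) *\<^sub>R X' t) - - ((\<rho> t * r2 / r2'\<^sup>2) *\<^sub>R Z t))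
          + (- ((\<rho> t * r2 / r2'\<^sup>2) *\<^sub>R X' t) - - ((\<rho> t * r2 / r2'\<^sup>2) *\<^sub>R Z t)) \<bullet> ?q)) (at t)"
        unfolding E_def[abs_def]
        by (intro has_vector_derivative_add bounded_linear.has_vector_derivative[OF bounded_linear_scaleR_right]
            has_vector_derivative_inner has_vector_derivative_diff dX' dZ dh df)
      moreover have "(\<rho> t * r2) *\<^sub>R h t - (\<rho> t * r2) *\<^sub>R f t = (\<rho> t * r2) *\<^sub>R ?q"
        "- ((\<rho> t * r2 / r2'\<^sup>2) *\<^sub>R X' t) - - ((\<rho> t * r2 / r2'\<^sup>2) *\<^sub>R Z t) = - ((\<rho> t * r2 / r2'\<^sup>2) *\<^sub>R ?p)"
        by (simp_all add: scaleR_diff_right)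
      ultimately show ?thesis by (simp add: inner_commute[of ?p ?q])
    qed
    then obtain c where "\<And>t. E t = c"
      using has_vector_derivative_zero_constant[of UNIV E] by auto
    then have "E t = E 0" by simp
    also have "E 0 = 0" by (simp add: E_def Z_def f_def h_def e_def s00 roll_dir_def)
    finally have E0: "(1 / r2'\<^sup>2) * ((X' t - Z t) \<bullet> (X' t - Z t)) + (h t - f t) \<bullet> (h t - f t) = 0"
      by (simp add: E_def)
    have "(1 / r2'\<^sup>2) * ((X' t - Z t) \<bullet> (X' t - Z t)) \<ge> 0" "(h t - f t) \<bullet> (h t - f t) \<ge> 0" by auto
    then have "(1 / r2'\<^sup>2) * ((X' t - Z t) \<bullet> (X' t - Z t)) = 0" "(h t - f t) \<bullet> (h t - f t) = 0"
      using E0 by linarith+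
    then show ?thesis using r2' by simp
  qed
  have main: "c2 t = roll r2 r2' (c2 0) u2 (s t)" for t
  proof -
    let ?q = "roll r2 r2' (X 0, X' 0, C 0) u2 (s t)"
    have 1: "fst ?q = X t" "fst (snd ?q) = X' t" using XY[of t] ZX[of t] by (simp_all add: roll_def Y_def Z_def)
    \<comment> \<open>The matrices are compared on the orthogonal frame \<open>X t\<close>,
      \<open>e t\<close>, \<open>n\<close>; on \<open>n\<close> both still have their initial
      value.\<close>
    have C: "C t = snd (snd ?q)"
    proof (rule orthogonal_basis_eqI)
      show "X t \<noteq> 0" "X t \<bullet> e t = 0" "e t \<noteq> 0" using D2(1)[of t] r2 Xe ee[of t] by auto
      have "snd (snd ?q) *v X t = 0"
        using M4_D(3)[OF r2 r2'] roll_M4[OF Q2, of "s t"] 1 by (metis prod.collapse)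
      then show "C t *v X t = snd (snd ?q) *v X t" by (simp add: D2)
      show "C t *v e t = snd (snd ?q) *v e t"
        using ZX[of t] roll_mult_dir[OF Q2, of "s t"] by (simp add: h_def e_def f_def)
      have Xe_n: "cross3 (X t) (e t) = r2 *\<^sub>R n"
      proof -
        have "r2 *\<^sub>R cross3 (X t) (e t) = cross3 (X t) (cross3 n (X t))" by (simp add: XY nY cross_mult_right)
        also have "\<dots> = r2\<^sup>2 *\<^sub>R n" using nX[of t] by (simp add: Lagrange D2 inner_commute)
        finally have "(1 / r2) *\<^sub>R (r2 *\<^sub>R cross3 (X t) (e t)) = (1 / r2) *\<^sub>R (r2\<^sup>2 *\<^sub>R n)" by simp
        then show ?thesis using r2 by (simp add: power2_eq_square)
      qed
      have "snd (snd ?q) *v n = C 0 *v n"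
        by (rule roll_mult_orthogonal[OF Q2]) (use nX[of 0] in \<open>simp_all add: n_def dot_cross_self inner_commute\<close>)
      then show "C t *v cross3 (X t) (e t) = snd (snd ?q) *v cross3 (X t) (e t)"
        unfolding Xe_n using Cn[of t] by (simp add: matrix_vector_mult_scaleR)
    qed
    show ?thesis unfolding c2_eq[of 0] using 1 C by (simp add: c2_eq prod_eq_iff)
  qed
  show ?thesis
  proof (rule that[OF s00 mono cs main])
    show "\<exists>k>0. w2 t = k *\<^sub>R roll_dir r2 (X 0) u2 (s t)" for t
      using we[of t] \<rho>pos[of t] r2 by (intro exI[of _ "\<rho> t * r2"]) (simp add: e_def)
  qed
qed

end

section \<open>A projective curve\<close>

text \<open>Components of the displacement, at a fixed point of a curve rolled along a great circle, that
  results from turning the direction of rolling at time \<open>t\<close>; \<open>l\<close> is the ratio of the radii.\<close>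

definition jacobi :: "real \<Rightarrow> real \<Rightarrow> real \<times> real \<times> real" where
  "jacobi l t = (sin t, sin (l * t), cos (l * t) - cos t)"

lemma jacobi_half_angles:
  fixes l t :: real
  defines "a \<equiv> (1 + l) / 2 * t" and "d \<equiv> (1 - l) / 2 * t"
  shows "sin t = sin a * cos d + cos a * sin d"
    and "sin (l * t) = sin a * cos d - cos a * sin d"
    and "cos (l * t) - cos t = 2 * (sin a * sin d)"
proof -
  have t: "t = a + d" and lt: "l * t = a - d"
    by (simp_all add: a_def d_def field_simps)
  show "sin t = sin a * cos d + cos a * sin d"
    unfolding t by (rule sin_add)
  show "sin (l * t) = sin a * cos d - cos a * sin d"
    unfolding lt by (rule sin_diff)
  show "cos (l * t) - cos t = 2 * (sin a * sin d)"
    unfolding lt unfolding t cos_add cos_diff by simp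
qed

lemma jacobi_eq_0_iff:
  "jacobi l t = 0 \<longleftrightarrow> sin ((1 + l) / 2 * t) = 0 \<and> sin ((1 - l) / 2 * t) = 0" (is "?L \<longleftrightarrow> ?R")
proof
  assume ?R
  then show ?L by (simp add: jacobi_def zero_prod_def jacobi_half_angles[where t=t and l=l])
next
  assume L: ?L
  let ?a = "(1 + l) / 2 * t" and ?d = "(1 - l) / 2 * t"
  have "sin t = 0" "sin (l * t) = 0" "cos (l * t) - cos t = 0"
    using L by (auto simp: jacobi_def zero_prod_def)
  then have "sin ?a * cos ?d = 0" "cos ?a * sin ?d = 0" "sin ?a * sin ?d = 0"
    using jacobi_half_angles[where t=t and l=l] by linarith+
  moreover have "sin ?a ^ 2 + cos ?a ^ 2 = 1" "sin ?d ^ 2 + cos ?d ^ 2 = 1" by simp_all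
  ultimately show ?R by (metis (no_types, lifting) add.right_neutral mult_eq_0_iff power_zero_numeral zero_neq_one)
qed

text \<open>The zeros of this half-angle sine are passages through one point of the line at
  infinity; those of the other one are passages through \<open>(1, 1, 0)\<close>.\<close>

lemma jacobi_long_zero: "sin ((1 + l) / 2 * t) = 0 \<Longrightarrow> jacobi l t = sin t *\<^sub>R (1, -1, 0)"
  using jacobi_half_angles[where t=t and l=l] by (simp add: jacobi_def)

lemma jacobi_short_zero: "sin ((1 - l) / 2 * t) = 0 \<Longrightarrow> jacobi l t = sin t *\<^sub>R (1, 1, 0)"
  using jacobi_half_angles[where t=t and l=l] by (simp add: jacobi_def)

text \<open>Off the line at infinity equal points have equal cotangents of both half angles, so both
  differences are multiples of \<pi>. The other two cases are repeated passages through one of the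
  two points at infinity.\<close>

lemma jacobi_parallel:
  assumes "k *\<^sub>R jacobi l t = m *\<^sub>R jacobi l t'" "k \<noteq> 0" "m \<noteq> 0"
  shows "sin ((1 + l) / 2 * t) = 0 \<and> sin ((1 + l) / 2 * t') = 0 \<or>
         sin ((1 - l) / 2 * t) = 0 \<and> sin ((1 - l) / 2 * t') = 0 \<or>
         sin ((1 + l) / 2 * (t' - t)) = 0 \<and> sin ((1 - l) / 2 * (t' - t)) = 0"
proof -
  define a d a' d' where defs: "a = (1 + l) / 2 * t" "d = (1 - l) / 2 * t"
      "a' = (1 + l) / 2 * t'" "d' = (1 - l) / 2 * t'"
  note h = jacobi_half_angles[where t=t and l=l, folded defs] jacobi_half_angles[where t=t' and l=l, folded defs]
  have e: "k * sin t = m * sin t'" "k * sin (l * t) = m * sin (l * t')"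
      "k * (cos (l * t) - cos t) = m * (cos (l * t') - cos t')"
    using assms(1) by (simp_all add: jacobi_def)
  have e1: "k * (sin a * cos d) = m * (sin a' * cos d')"
    and e2: "k * (cos a * sin d) = m * (cos a' * sin d')"
    and e3: "k * (sin a * sin d) = m * (sin a' * sin d')"
  proof -
    have "k * (sin a * cos d + cos a * sin d) = m * (sin a' * cos d' + cos a' * sin d')"
      "k * (sin a * cos d - cos a * sin d) = m * (sin a' * cos d' - cos a' * sin d')"
      "k * (2 * (sin a * sin d)) = m * (2 * (sin a' * sin d'))"
      using e unfolding h by blast+
    then show "k * (sin a * cos d) = m * (sin a' * cos d')"
      "k * (cos a * sin d) = m * (cos a' * sin d')"
      "k * (sin a * sin d) = m * (sin a' * sin d')" by (simp_all add: algebra_simps)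
  qed
  have diff: "sin ((1 + l) / 2 * (t' - t)) = sin a' * cos a - cos a' * sin a"
    "sin ((1 - l) / 2 * (t' - t)) = sin d' * cos d - cos d' * sin d"
    unfolding right_diff_distrib sin_diff defs by simp_all
  show ?thesis
  proof (cases "sin a * sin d = 0")
    case True
    then have z': "sin a' * sin d' = 0" using e3 assms by auto
    have nz: "cos x \<noteq> 0 \<or> sin x \<noteq> 0" for x :: real
      by (metis sin_zero_abs_cos_one abs_zero zero_neq_one)
    have ca: "cos a \<noteq> 0 \<or> sin a \<noteq> 0" and cd: "cos d \<noteq> 0 \<or> sin d \<noteq> 0"
      and ca': "cos a' \<noteq> 0 \<or> sin a' \<noteq> 0" and cd': "cos d' \<noteq> 0 \<or> sin d' \<noteq> 0"
      using nz by blast+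
    show ?thesis
      using True z' e1 e2 ca cd ca' cd' assms(2,3) unfolding diff defs[symmetric] by auto
  next
    case False
    then have nz: "sin a \<noteq> 0" "sin d \<noteq> 0" by auto
    then have nz': "sin a' \<noteq> 0" "sin d' \<noteq> 0" using e3 assms by auto
    have "(k * m * sin a * sin a') * (sin d' * cos d - cos d' * sin d)
        = (k * (sin a * cos d)) * (m * (sin a' * sin d')) - (k * (sin a * sin d)) * (m * (sin a' * cos d'))"
      by (simp add: algebra_simps)
    also have "\<dots> = 0" unfolding e1 e3 by simp
    finally have A: "sin d' * cos d - cos d' * sin d = 0" using nz nz' assms by simp
    have "(k * m * sin d * sin d') * (sin a' * cos a - cos a' * sin a)
        = (k * (cos a * sin d)) * (m * (sin a' * sin d')) - (k * (sin a * sin d)) * (m * (cos a' * sin d'))"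
      by (simp add: algebra_simps)
    also have "\<dots> = 0" unfolding e2 e3 by simp
    finally have B: "sin a' * cos a - cos a' * sin a = 0" using nz nz' assms by simp
    show ?thesis using A B diff by auto
  qed
qed

text \<open>The spacing of the zeros of the faster half angle. Despite the name it is the smaller of
  the two spacings for \<open>0 < l < 1\<close>.\<close>

definition long_period :: "real \<Rightarrow> real" where
  "long_period l = pi / ((1 + l) / 2)"

definition short_period :: "real \<Rightarrow> real" where
  "short_period l = pi / ((1 - l) / 2)"

lemma long_period:
  assumes "0 < l"
  shows "long_period l > 0" "(1 + l) / 2 * long_period l = pi"
  using assms by (simp_all add: long_period_def)

lemma short_period:
  assumes "l < 1"
  shows "short_period l > 0" "(1 - l) / 2 * short_period l = pi"
  using assms by (simp_all add: short_period_def)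

lemma long_less_short: "0 < l \<Longrightarrow> l < 1 \<Longrightarrow> long_period l < short_period l"
  unfolding long_period_def short_period_def by (intro divide_strict_left_mono) auto

lemma sin_mult_zeroE:
  assumes "sin (c * t) = 0" "c > 0" "t > 0"
  obtains n :: nat where "n \<ge> 1" "t = real n * (pi / c)"
proof -
  obtain i :: int where i: "c * t = of_int i * pi"
    using assms(1) by (auto simp: sin_zero_iff_int2)
  have "0 < of_int i * pi" using assms i by (metis mult_pos_pos)
  then have "i > 0" by (simp add: zero_less_mult_iff)
  moreover have "t = real (nat i) * (pi / c)"
    using i \<open>i > 0\<close> assms(2) by (simp add: field_simps)
  ultimately show ?thesis by (intro that[of "nat i"]) auto
qed

lemma sin_long_zeroE:
  assumes "sin ((1 + l) / 2 * t) = 0" "0 < l" "t > 0"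
  obtains n :: nat where "n \<ge> 1" "t = real n * long_period l"
  using assms unfolding long_period_def by (elim sin_mult_zeroE) auto

lemma sin_short_zeroE:
  assumes "sin ((1 - l) / 2 * t) = 0" "l < 1" "t > 0"
  obtains n :: nat where "n \<ge> 1" "t = real n * short_period l"
  using assms unfolding short_period_def by (elim sin_mult_zeroE) auto

text \<open>The long period \<open>2 \<pi> / a\<close> with \<open>a = (1 + l) / 2\<close> is the first time at which the projective
  curve \<open>jacobi l\<close> meets a point visited before.\<close>

lemma jacobi_common_zero:
  assumes "0 < l" "l < 1" "t > 0"
    and "sin ((1 + l) / 2 * t) = 0" "sin ((1 - l) / 2 * t) = 0"
  shows "t \<ge> 2 * long_period l"
proof -
  obtain n where n: "n \<ge> 1" "t = real n * (long_period l)"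
    using assms by (elim sin_long_zeroE) auto
  obtain m where m: "m \<ge> 1" "t = real m * (short_period l)"
    using assms by (elim sin_short_zeroE) auto
  have lt: "long_period l < short_period l" using assms by (intro long_less_short)
  \<comment> \<open>A single spacing of the faster half angle is shorter than every positive
    multiple of the other spacing.\<close>
  have "n \<noteq> 1"
  proof
    assume "n = 1"
    have "1 * (short_period l) \<le> real m * (short_period l)"
      using m assms short_period(1)[of l] by (intro mult_right_mono) auto
    then show False using n m lt \<open>n = 1\<close> by simp
  qed
  then have "real n \<ge> 2" using n by linarith
  then show ?thesis unfolding n(2) using assms long_period(1)[of l] by (intro mult_right_mono) auto
qed

text \<open>In the cases of \<open>jacobi_parallel\<close>, two passages through
  \<open>(1, -1, 0)\<close> occur at the earliest at the first and second multiple of the long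
  period. Two passages through \<open>(1, 1, 0)\<close>, or the lapse of a common period after a
  positive time, come strictly later, so equality leaves only the first case.\<close>

lemma jacobi_first_double:
  assumes l: "0 < l" "l < 1" and t: "0 < t" "t < t'"
    and par: "k *\<^sub>R jacobi l t = m *\<^sub>R jacobi l t'" "k \<noteq> 0" "m \<noteq> 0"
  shows "t' \<ge> 2 * long_period l"
    and "t' = 2 * long_period l \<Longrightarrow> t = long_period l"
proof -
  let ?T = "long_period l" and ?U = "short_period l"
  have lt: "?T < ?U" using l by (intro long_less_short)
  have T: "?T > 0" using l long_period by blast
  have t'0: "t' > 0" using t by simp
  have "t' \<ge> 2 * ?T \<and> (t' = 2 * ?T \<longrightarrow> t = ?T)"
  proof -
    consider (long) "sin ((1 + l) / 2 * t) = 0" "sin ((1 + l) / 2 * t') = 0"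
      | (short) "sin ((1 - l) / 2 * t) = 0" "sin ((1 - l) / 2 * t') = 0"
      | (both) "sin ((1 + l) / 2 * (t' - t)) = 0" "sin ((1 - l) / 2 * (t' - t)) = 0"
      using jacobi_parallel[OF par] by blast
    then show ?thesis
    proof cases
      case long
      obtain n where n: "n \<ge> 1" "t = real n * ?T" using long(1) l(1) t(1) by (rule sin_long_zeroE)
      obtain m where m: "m \<ge> 1" "t' = real m * ?T"
        using long(2) l(1) t'0 by (rule sin_long_zeroE)
      have "n < m" using t T n m by auto
      then have "real m \<ge> 2" using n by linarith
      then have "real m * ?T \<ge> 2 * ?T" using T by (intro mult_right_mono) auto
      moreover have "n = 1" if "real m * ?T = 2 * ?T"
      proof -
        have "real m = 2" using that T by (simp only: mult_cancel_right) auto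
        then show ?thesis using \<open>n < m\<close> n by linarith
      qed
      ultimately show ?thesis using n m by auto
    next
      case short
      obtain n where n: "n \<ge> 1" "t = real n * ?U" using short(1) l(2) t(1) by (rule sin_short_zeroE)
      obtain m where m: "m \<ge> 1" "t' = real m * ?U"
        using short(2) l(2) t'0 by (rule sin_short_zeroE)
      have "n < m" using t T n m lt by (simp add: mult_less_cancel_right)
      then have "real m \<ge> 2" using n by linarith
      then have "real m * ?U \<ge> 2 * ?U" using T lt by (intro mult_right_mono) auto
      then show ?thesis using m lt by linarith
    next
      case both
      then have "t' - t \<ge> 2 * ?T" using jacobi_common_zero[of l "t' - t"] l t by auto
      then show ?thesis using t by auto
    qed
  qed
  then show "t' \<ge> 2 * ?T" "t' = 2 * ?T \<Longrightarrow> t = ?T" by auto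
qed

text \<open>Near zero the even component \<open>cos (l * t) - cos t\<close> is positive, which
  removes its coefficient. The odd part, evaluated at \<open>t\<close> and \<open>2 * t\<close>,
  separates the two sines by their doubling factors \<open>cos t\<close> and
  \<open>cos (l * t)\<close>.\<close>

lemma jacobi_spans:
  fixes c :: "real \<times> real \<times> real"
  assumes l: "0 < l" "l < 1" and e: "e > 0"
    and ann: "\<And>t. \<bar>t\<bar> < e \<Longrightarrow> c \<bullet> jacobi l t = 0"
  shows "c = 0"
proof -
  obtain p q w where c: "c = (p, q, w)" by (cases c) auto
  define t where "t = min (e / 4) (pi / 4)"
  have t: "0 < t" "t < e" "2 * t < e" "t < pi / 2" using e by (auto simp: t_def min_def)
  have E: "p * sin x + q * sin (l * x) + w * (cos (l * x) - cos x) = 0" if "\<bar>x\<bar> < e" for x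
    using ann[OF that] by (simp add: c jacobi_def algebra_simps)
  have lt: "0 < l * t" "l * t < t" using l t by (auto simp: mult_less_cancel_right)
  have cosd: "cos (l * t) - cos t > 0"
    using cos_monotone_0_pi[of "l * t" t] lt t by auto
  have s: "sin t > 0" "sin (l * t) > 0" using t lt by (auto intro!: sin_gt_zero)
  have "w * (cos (l * t) - cos t) = 0" and o: "p * sin t + q * sin (l * t) = 0"
    using E[of t] E[of "-t"] t by (auto simp: algebra_simps)
  then have w: "w = 0" using cosd by auto
  have "p * sin (2 * t) + q * sin (2 * (l * t)) = 0"
    using E[of "2 * t"] t w by (simp add: algebra_simps)
  then have "(p * sin t) * cos t + (q * sin (l * t)) * cos (l * t) = 0"
    unfolding sin_double by (simp add: algebra_simps)
  moreover have "p * sin t = - (q * sin (l * t))" using o by linarith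
  ultimately have "(q * sin (l * t)) * (cos (l * t) - cos t) = 0"
    by (simp add: algebra_simps)
  then have q: "q = 0" using cosd s by auto
  then have "p = 0" using o s by auto
  then show ?thesis using c q w by (simp add: zero_prod_def)
qed

lemma annihilated_by_nonzero:
  fixes S :: "'a::euclidean_space set"
  assumes "span S \<noteq> UNIV"
  obtains c where "c \<noteq> 0" "\<And>v. v \<in> S \<Longrightarrow> c \<bullet> v = 0"
proof -
  obtain c where "c \<noteq> 0" "span S \<subseteq> {x. c \<bullet> x = 0}"
    using assms by (metis span_not_univ_subset_hyperplane)
  then show ?thesis using span_superset by (intro that[of c]) auto
qed

lemma jacobi_long: "0 < l \<Longrightarrow> jacobi l (long_period l) = sin (long_period l) *\<^sub>R (1, -1, 0)"
  by (rule jacobi_long_zero) (simp only: long_period sin_pi)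

lemma jacobi_2_long:
  assumes "0 < l"
  shows "jacobi l (2 * long_period l) = sin (2 * long_period l) *\<^sub>R (1, -1, 0)"
proof (rule jacobi_long_zero)
  have "(1 + l) / 2 * (2 * long_period l) = 2 * ((1 + l) / 2 * long_period l)" by simp
  also have "\<dots> = 2 * pi" unfolding long_period(2)[OF assms] ..
  finally show "sin ((1 + l) / 2 * (2 * long_period l)) = 0" by simp
qed

lemma jacobi_short: "l < 1 \<Longrightarrow> jacobi l (short_period l) = sin (short_period l) *\<^sub>R (1, 1, 0)"
  by (rule jacobi_short_zero) (simp only: short_period sin_pi)

lemma jacobi_long_nonzero:
  assumes "0 < l" "l < 1"
  shows "jacobi l (long_period l) \<noteq> 0"
  using jacobi_common_zero[of l "long_period l"] long_period(1)[of l] assms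
  by (auto simp: jacobi_eq_0_iff)

text \<open>Twice the long period is the second passage through \<open>(1, -1, 0)\<close>, unless
  the vector itself vanishes there.\<close>

lemma jacobi_double_long:
  assumes "0 < l" "l < 1"
  shows "jacobi l (2 * long_period l) = 0 \<or>
    (\<exists>k m. k \<noteq> 0 \<and> m \<noteq> 0 \<and> k *\<^sub>R jacobi l (long_period l) = m *\<^sub>R jacobi l (2 * long_period l))"
proof (rule disjCI)
  let ?T = "long_period l"
  note j = jacobi_long[OF assms(1)] jacobi_2_long[OF assms(1)]
  assume "\<not> (\<exists>k m. k \<noteq> 0 \<and> m \<noteq> 0 \<and> k *\<^sub>R jacobi l ?T = m *\<^sub>R jacobi l (2 * ?T))"
  moreover have "sin (2 * ?T) *\<^sub>R jacobi l ?T = sin ?T *\<^sub>R jacobi l (2 * ?T)"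
    unfolding j by (simp only: scaleR_scaleR mult.commute)
  moreover have "sin ?T \<noteq> 0" using jacobi_long_nonzero[OF assms] unfolding j by (metis scaleR_zero_left)
  ultimately have "sin (2 * ?T) = 0" by blast
  then show "jacobi l (2 * ?T) = 0" unfolding j by (simp only: scaleR_zero_left)
qed

text \<open>Twice the long period is then a positive multiple of the short one, and
  \<open>1 - l < 1 + l\<close> allows only the first multiple. For this ratio the curve is a conic,
  traversed once in that time.\<close>

lemma jacobi_2_long_zero:
  assumes "0 < l" "l < 1" "jacobi l (2 * long_period l) = 0"
  shows "l = 1/3"
proof -
  have T: "2 * long_period l > 0" using long_period assms by simp
  have "sin ((1 - l) / 2 * (2 * long_period l)) = 0" using assms by (simp only: jacobi_eq_0_iff)
  then obtain n where n: "n \<ge> 1" "2 * long_period l = real n * short_period l"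
    using assms(2) T by (rule sin_short_zeroE)
  have e: "2 * (1 - l) = real n * (1 + l)"
    using n(2) assms by (simp add: long_period_def short_period_def) (simp add: divide_simps, argo)
  have "n < 2"
  proof (rule ccontr)
    assume "\<not> n < 2"
    then have "real n \<ge> 2" by simp
    then have "2 * (1 + l) \<le> real n * (1 + l)" using assms by (intro mult_right_mono) auto
    then show False using e assms by auto
  qed
  then have "n = 1" using n by simp
  then show ?thesis using e by simp
qed

text \<open>Only the values up to the second time matter here, so that this can be used before the
  reparametrization is known to be onto.\<close>

lemma jacobi_double_transfer:
  assumes l: "0 < l" "l < 1" and l': "0 < l'" "l' < 1" and lin: "linear A"
    and match: "A (jacobi l (long_period l)) = \<nu> *\<^sub>R jacobi l' s" "\<nu> \<noteq> 0"
      "A (jacobi l (2 * long_period l)) = \<nu>' *\<^sub>R jacobi l' s'" "\<nu>' \<noteq> 0"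
    and s: "0 < s" "s < s'"
  shows "s' \<ge> 2 * long_period l'"
    and "s' = 2 * long_period l' \<Longrightarrow> jacobi l (2 * long_period l) \<noteq> 0 \<Longrightarrow> s = long_period l'"
proof -
  have par: "\<exists>k m. k *\<^sub>R jacobi l' s = m *\<^sub>R jacobi l' s' \<and> k \<noteq> 0 \<and> m \<noteq> 0"
    if nz: "jacobi l (2 * long_period l) \<noteq> 0"
  proof -
    obtain k m where km: "k \<noteq> 0" "m \<noteq> 0"
      "k *\<^sub>R jacobi l (long_period l) = m *\<^sub>R jacobi l (2 * long_period l)"
      using jacobi_double_long[OF l] nz by blast
    from arg_cong[OF km(3), of A] have "(k * \<nu>) *\<^sub>R jacobi l' s = (m * \<nu>') *\<^sub>R jacobi l' s'"
      using match by (simp add: linear_scale[OF lin])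
    then show ?thesis using km match
      by (intro exI[of _ "k * \<nu>"] exI[of _ "m * \<nu>'"]) simp
  qed
  show "s' \<ge> 2 * long_period l'"
  proof (cases "jacobi l (2 * long_period l) = 0")
    case True
    then have "jacobi l' s' = 0" using match linear_0[OF lin] by auto
    then show ?thesis using jacobi_common_zero[of l' s'] l' s by (simp add: jacobi_eq_0_iff)
  next
    case False
    then show ?thesis using par jacobi_first_double(1)[OF l' s] by blast
  qed
  show "s = long_period l'" if "s' = 2 * long_period l'" "jacobi l (2 * long_period l) \<noteq> 0"
    using par[OF that(2)] jacobi_first_double(2)[OF l' s] that(1) by blast
qed

text \<open>The comparison at one base point. Surjectivity of \<open>f\<close> is assumed so that
  the situation is symmetric and each inequality can be reversed by means of \<open>inv f\<close>
  and \<open>inv A\<close>.\<close>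

locale jacobi_match =
  fixes l\<^sub>1 l\<^sub>2 :: real and f :: "real \<Rightarrow> real" and A :: "real \<times> real \<times> real \<Rightarrow> real \<times> real \<times> real"
  assumes l1: "0 < l\<^sub>1" "l\<^sub>1 < 1" and l2: "0 < l\<^sub>2" "l\<^sub>2 < 1"
    and mono: "strict_mono f" and onto: "surj f" and f0: "f 0 = 0"
    and lin: "linear A" and inj: "inj A"
    and match: "\<And>t. \<exists>\<nu>. \<nu> \<noteq> 0 \<and> A (jacobi l\<^sub>1 t) = \<nu> *\<^sub>R jacobi l\<^sub>2 (f t)"
begin

abbreviation "T\<^sub>1 \<equiv> long_period l\<^sub>1"
abbreviation "T\<^sub>2 \<equiv> long_period l\<^sub>2"
abbreviation "U\<^sub>1 \<equiv> short_period l\<^sub>1"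
abbreviation "U\<^sub>2 \<equiv> short_period l\<^sub>2"

lemma A_scaleR: "A (k *\<^sub>R v) = k *\<^sub>R A v" using lin by (simp add: linear_scale)

lemma A_zero: "A v = 0 \<longleftrightarrow> v = 0"
  using inj lin by (metis injD linear_0)

lemma f_pos: "t > 0 \<longleftrightarrow> f t > 0"
  using mono f0 by (metis strict_mono_less)

lemma inv_scaleR:
  assumes "A v = k *\<^sub>R w" "k \<noteq> 0"
  shows "inv A w = (1 / k) *\<^sub>R v"
proof (rule inv_f_eq[OF inj])
  show "A ((1 / k) *\<^sub>R v) = w" unfolding A_scaleR assms(1) using assms(2) by simp
qed

lemma reverse: "jacobi_match l\<^sub>2 l\<^sub>1 (inv f) (inv A)"
proof (rule jacobi_match.intro[OF l2 l1])
  have "surj A" using lin inj by (rule linear_injective_imp_surjective) simp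
  then show "inj (inv A)" by (rule surj_imp_inj_inv)
  show "linear (inv A)" using lin inj by (rule inj_linear_imp_inv_linear)
  have injf: "inj f" using mono by (rule strict_mono_imp_inj_on)
  then show "surj (inv f)" by (rule inj_imp_surj_inv)
  show "inv f 0 = 0" using injf f0 by (rule inv_f_eq)
  show "strict_mono (inv f)"
    by (rule strict_monoI) (use strict_mono_less[OF mono] surj_f_inv_f[OF onto] in metis)
  fix t
  obtain \<nu> where "\<nu> \<noteq> 0" "A (jacobi l\<^sub>1 (inv f t)) = \<nu> *\<^sub>R jacobi l\<^sub>2 (f (inv f t))"
    using match by blast
  then show "\<exists>\<nu>. \<nu> \<noteq> 0 \<and> inv A (jacobi l\<^sub>2 t) = \<nu> *\<^sub>R jacobi l\<^sub>1 (inv f t)"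
    using inv_scaleR surj_f_inv_f[OF onto] by (intro exI[of _ "1 / \<nu>"]) simp
qed

lemma le_of_reverse:
  assumes "a \<le> inv f b"
  shows "f a \<le> b"
  using assms strict_mono_less_eq[OF mono, of a "inv f b"] surj_f_inv_f[OF onto, of b] by simp

lemma long_times: "0 < f T\<^sub>1" "f T\<^sub>1 < f (2 * T\<^sub>1)"
  using long_period(1)[OF l1(1)] f_pos mono by (auto simp: strict_mono_less)

lemma match_2T_ge: "2 * T\<^sub>2 \<le> f (2 * T\<^sub>1)"
proof -
  obtain \<nu> \<nu>' where "A (jacobi l\<^sub>1 T\<^sub>1) = \<nu> *\<^sub>R jacobi l\<^sub>2 (f T\<^sub>1)" "\<nu> \<noteq> 0"
    "A (jacobi l\<^sub>1 (2 * T\<^sub>1)) = \<nu>' *\<^sub>R jacobi l\<^sub>2 (f (2 * T\<^sub>1))" "\<nu>' \<noteq> 0" using match by meson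
  then show ?thesis by (rule jacobi_double_transfer(1)[OF l1 l2 lin _ _ _ _ long_times])
qed

lemma match_2T: "f (2 * T\<^sub>1) = 2 * T\<^sub>2"
  using match_2T_ge le_of_reverse[OF jacobi_match.match_2T_ge[OF reverse]] by (rule antisym[rotated])

text \<open>By injectivity of \<open>A\<close> the two curves vanish at twice their long periods
  simultaneously, which would make both ratios 1/3. So there is a genuine double point, and its
  earlier time is determined.\<close>

lemma match_T:
  assumes "l\<^sub>1 \<noteq> l\<^sub>2"
  shows "f T\<^sub>1 = T\<^sub>2"
proof -
  obtain \<nu> \<nu>' where m: "A (jacobi l\<^sub>1 T\<^sub>1) = \<nu> *\<^sub>R jacobi l\<^sub>2 (f T\<^sub>1)" "\<nu> \<noteq> 0"
    "A (jacobi l\<^sub>1 (2 * T\<^sub>1)) = \<nu>' *\<^sub>R jacobi l\<^sub>2 (f (2 * T\<^sub>1))" "\<nu>' \<noteq> 0" using match by meson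
  have "jacobi l\<^sub>1 (2 * T\<^sub>1) = 0 \<longleftrightarrow> jacobi l\<^sub>2 (2 * T\<^sub>2) = 0"
    using m(3,4) A_zero[of "jacobi l\<^sub>1 (2 * T\<^sub>1)"] unfolding match_2T by auto
  then have "jacobi l\<^sub>1 (2 * T\<^sub>1) \<noteq> 0"
    using jacobi_2_long_zero[OF l1] jacobi_2_long_zero[OF l2] assms by auto
  then show ?thesis
    by (rule jacobi_double_transfer(2)[OF l1 l2 lin m long_times match_2T])
qed

lemma A_long:
  assumes "l\<^sub>1 \<noteq> l\<^sub>2"
  obtains m where "A (1, -1, 0) = m *\<^sub>R (1, -1, 0)" "m \<noteq> 0"
proof -
  obtain \<nu> where nu: "\<nu> \<noteq> 0" "A (jacobi l\<^sub>1 T\<^sub>1) = \<nu> *\<^sub>R jacobi l\<^sub>2 T\<^sub>2"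
    using match[of T\<^sub>1] match_T[OF assms] by auto
  note j = jacobi_long[OF l1(1)] jacobi_long[OF l2(1)]
  have s: "sin T\<^sub>1 \<noteq> 0" "sin T\<^sub>2 \<noteq> 0"
    using jacobi_long_nonzero[OF l1] jacobi_long_nonzero[OF l2] unfolding j by (metis scaleR_zero_left)+
  have "A (1, -1, 0) = inverse (sin T\<^sub>1) *\<^sub>R (sin T\<^sub>1 *\<^sub>R A (1, -1, 0))" using s by simp
  also have "sin T\<^sub>1 *\<^sub>R A (1, -1, 0) = \<nu> *\<^sub>R (sin T\<^sub>2 *\<^sub>R (1, -1, 0))"
    using nu(2) unfolding j A_scaleR .
  finally have "A (1, -1, 0) = (inverse (sin T\<^sub>1) * (\<nu> * sin T\<^sub>2)) *\<^sub>R (1, -1, 0)" by simp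
  then show ?thesis using that s nu by simp
qed

text \<open>The line at infinity is spanned by \<open>(1, -1, 0)\<close> and the initial tangent
  \<open>(1, l, 0)\<close> of the curve. Both are carried to their counterparts, so \<open>A\<close>
  preserves the line.\<close>

lemma A_plane:
  assumes ne: "l\<^sub>1 \<noteq> l\<^sub>2" and start: "A (1, l\<^sub>1, 0) = k *\<^sub>R (1, l\<^sub>2, 0)"
  shows "snd (snd (A (p, q, 0))) = 0"
proof -
  obtain m where m: "A (1, -1, 0) = m *\<^sub>R (1, -1, 0)" using A_long[OF ne] by blast
  define b where "b = (p + q) / (1 + l\<^sub>1)"
  have "b * (1 + l\<^sub>1) = p + q" using l1 by (simp add: b_def)
  then have "(p, q, 0) = (p - b) *\<^sub>R (1, -1, 0) + b *\<^sub>R (1, l\<^sub>1, 0 :: real)"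
    by (simp add: algebra_simps)
  then have "A (p, q, 0) = (p - b) *\<^sub>R A (1, -1, 0) + b *\<^sub>R A (1, l\<^sub>1, 0)"
    by (simp only: linear_add[OF lin] A_scaleR)
  then show ?thesis using m start by simp
qed

text \<open>At the short period the first curve meets the line at infinity away from
  \<open>(1, -1, 0)\<close>. As \<open>A\<close> is injective and preserves both the line and this
  point, the image time is a zero of the slower half angle, hence a positive multiple of
  \<open>U\<^sub>2\<close>.\<close>

lemma match_U_ge:
  assumes ne: "l\<^sub>1 \<noteq> l\<^sub>2" and start: "A (1, l\<^sub>1, 0) = k *\<^sub>R (1, l\<^sub>2, 0)"
  shows "U\<^sub>2 \<le> f U\<^sub>1"
proof -
  obtain m where m: "A (1, -1, 0) = m *\<^sub>R (1, -1, 0)" "m \<noteq> 0" using A_long[OF ne] by blast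
  obtain \<nu> where nu: "\<nu> \<noteq> 0" "A (jacobi l\<^sub>1 U\<^sub>1) = \<nu> *\<^sub>R jacobi l\<^sub>2 (f U\<^sub>1)" using match by blast
  have "snd (snd (\<nu> *\<^sub>R jacobi l\<^sub>2 (f U\<^sub>1))) = 0"
    using A_plane[OF ne start] l1 unfolding nu(2)[symmetric] by (simp add: jacobi_short)
  then have third: "sin ((1 + l\<^sub>2) / 2 * f U\<^sub>1) = 0 \<or> sin ((1 - l\<^sub>2) / 2 * f U\<^sub>1) = 0"
    using nu(1) jacobi_half_angles(3)[where l=l\<^sub>2 and t="f U\<^sub>1"] by (simp add: jacobi_def)
  have "sin ((1 - l\<^sub>2) / 2 * f U\<^sub>1) = 0"
  proof (rule ccontr)
    assume z: "sin ((1 - l\<^sub>2) / 2 * f U\<^sub>1) \<noteq> 0"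
    then have j2: "jacobi l\<^sub>2 (f U\<^sub>1) = sin (f U\<^sub>1) *\<^sub>R (1, -1, 0)"
      using third by (intro jacobi_long_zero) blast
    have j2n: "jacobi l\<^sub>2 (f U\<^sub>1) \<noteq> 0" using z by (simp add: jacobi_eq_0_iff)
    have "m *\<^sub>R A (jacobi l\<^sub>1 U\<^sub>1) = (\<nu> * sin (f U\<^sub>1)) *\<^sub>R (m *\<^sub>R (1, -1, 0))"
      unfolding nu(2) j2 by simp
    then have "A (m *\<^sub>R jacobi l\<^sub>1 U\<^sub>1) = A ((\<nu> * sin (f U\<^sub>1)) *\<^sub>R (1, -1, 0))"
      unfolding A_scaleR m(1) .
    then have "m *\<^sub>R jacobi l\<^sub>1 U\<^sub>1 = (\<nu> * sin (f U\<^sub>1)) *\<^sub>R (1, -1, 0)" by (rule injD[OF inj])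
    moreover have "fst (m *\<^sub>R jacobi l\<^sub>1 U\<^sub>1) = fst (snd (m *\<^sub>R jacobi l\<^sub>1 U\<^sub>1))"
      using l1 by (simp add: jacobi_short)
    ultimately have "\<nu> * sin (f U\<^sub>1) = 0" by simp
    then show False using nu j2 j2n by (metis mult_eq_0_iff scaleR_zero_left)
  qed
  moreover have "f U\<^sub>1 > 0" using f_pos short_period(1)[OF l1(2)] by blast
  ultimately obtain n where n: "n \<ge> 1" "f U\<^sub>1 = real n * U\<^sub>2" using l2(2) by (elim sin_short_zeroE)
  have "1 * U\<^sub>2 \<le> real n * U\<^sub>2"
    using n short_period(1)[OF l2(2)] by (intro mult_right_mono) auto
  then show ?thesis using n by simp
qed

lemma match_U:
  assumes ne: "l\<^sub>1 \<noteq> l\<^sub>2" and start: "A (1, l\<^sub>1, 0) = k *\<^sub>R (1, l\<^sub>2, 0)"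
  shows "f U\<^sub>1 = U\<^sub>2"
proof (rule antisym)
  have "k \<noteq> 0" using start A_zero[of "(1, l\<^sub>1, 0)"] by (auto simp: zero_prod_def)
  then show "f U\<^sub>1 \<le> U\<^sub>2"
    using inv_scaleR[OF start] ne
    by (intro le_of_reverse jacobi_match.match_U_ge[OF reverse, where k = "1 / k"]) auto
qed (rule match_U_ge[OF assms])

end

text \<open>The linear map may vary with the base point \<open>b\<close>, but \<open>s\<close> may
  not; about \<open>b\<close> it is only recentred. This makes the period identities at single base
  points into translation identities for \<open>s\<close>.\<close>

theorem jacobi_match_families:
  fixes s :: "real \<Rightarrow> real"
  assumes l1: "0 < l\<^sub>1" "l\<^sub>1 \<le> 1" and l2: "0 < l\<^sub>2" "l\<^sub>2 < 1"
    and mono: "strict_mono s" and cont: "continuous_on UNIV s"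
    and A: "\<And>b. \<exists>A k. linear A \<and> A (1, l\<^sub>1, 0) = k *\<^sub>R (1, l\<^sub>2, 0) \<and>
        (\<forall>t. \<exists>\<nu>. \<nu> \<noteq> 0 \<and> A (jacobi l\<^sub>1 t) = \<nu> *\<^sub>R jacobi l\<^sub>2 (s (b + t) - s b))"
  shows "l\<^sub>1 = l\<^sub>2"
proof (rule ccontr)
  assume ne: "l\<^sub>1 \<noteq> l\<^sub>2"
  have smono: "s x < s y \<longleftrightarrow> x < y" for x y using mono by (rule strict_mono_less)
  \<comment> \<open>Local surjectivity already makes the linear maps injective, before global
    surjectivity is available.\<close>
  have onto_near: "\<exists>e>0. \<forall>y. \<bar>y\<bar> < e \<longrightarrow> (\<exists>t. s (b + t) - s b = y)" for b
  proof -
    define e where "e = min (s (b + 1) - s b) (s b - s (b - 1))"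
    have "\<exists>t. s (b + t) - s b = y" if "\<bar>y\<bar> < e" for y
    proof -
      have "s (b - 1) \<le> s b + y" "s b + y \<le> s (b + 1)" using that by (auto simp: e_def)
      then obtain x where "s x = s b + y"
        using IVT'[of s "b - 1" "s b + y" "b + 1"] continuous_on_subset[OF cont] by auto
      then show ?thesis by (intro exI[of _ "x - b"]) auto
    qed
    moreover have "e > 0" using smono by (auto simp: e_def)
    ultimately show ?thesis by blast
  qed
  have ann: "c = 0" if c: "\<And>t. c \<bullet> jacobi l\<^sub>2 (s (b + t) - s b) = 0" for b c
    using onto_near[of b] jacobi_spans[OF l2, of _ c] c by metis
  have inj: "inj A" if lin: "linear A"
    and m: "\<And>t. \<exists>\<nu>. \<nu> \<noteq> 0 \<and> A (jacobi l\<^sub>1 t) = \<nu> *\<^sub>R jacobi l\<^sub>2 (s (b + t) - s b)" for A b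
  proof -
    have "span (range A) = UNIV"
    proof (rule ccontr)
      assume "span (range A) \<noteq> UNIV"
      then obtain c where c: "c \<noteq> 0" "\<And>v. c \<bullet> A v = 0"
        by (rule annihilated_by_nonzero) auto
      have "c \<bullet> jacobi l\<^sub>2 (s (b + t) - s b) = 0" for t
        using c(2)[of "jacobi l\<^sub>1 t"] m[of t] by auto
      then show False using ann c by blast
    qed
    then have "surj A" using lin by (metis span_UNIV linear_span_image)
    then show ?thesis using lin linear_surjective_imp_injective by blast
  qed
  show False
  proof (cases "l\<^sub>1 = 1")
    \<comment> \<open>For ratio 1 the curve degenerates to the single projective point
      \<open>(1, 1, 0)\<close>, whereas the target curve spans the space.\<close>
    case True
    obtain A where lin: "linear A"
      and m: "\<And>t. \<exists>\<nu>. \<nu> \<noteq> 0 \<and> A (jacobi l\<^sub>1 t) = \<nu> *\<^sub>R jacobi l\<^sub>2 (s (0 + t) - s 0)"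
      using A[of 0] by blast
    have "span {A (1, 1, 0)} \<noteq> UNIV"
    proof
      assume "span {A (1, 1, 0)} = UNIV"
      then have "dim {A (1, 1, 0)} = 3" using dim_span by (metis DIM_prod DIM_real dim_UNIV numeral_3_eq_3 one_add_one add.commute eval_nat_numeral(3) numeral_2_eq_2 plus_1_eq_Suc)
      moreover have "dim {A (1, 1, 0)} \<le> 1" using dim_le_card'[of "{A (1, 1, 0)}"] by simp
      ultimately show False by simp
    qed
    then obtain c where c: "c \<noteq> 0" "c \<bullet> A (1, 1, 0) = 0"
      using annihilated_by_nonzero[of "{A (1, 1, 0)}"] by blast
    have "c \<bullet> jacobi l\<^sub>2 (s (0 + t) - s 0) = 0" for t
    proof -
      obtain \<nu> where nu: "\<nu> \<noteq> 0" "A (jacobi l\<^sub>1 t) = \<nu> *\<^sub>R jacobi l\<^sub>2 (s (0 + t) - s 0)" using m by blast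
      have "jacobi l\<^sub>1 t = sin t *\<^sub>R (1, 1, 0)" by (simp add: jacobi_def True)
      then have "A (jacobi l\<^sub>1 t) = sin t *\<^sub>R A (1, 1, 0)" by (simp only: linear_scale[OF lin])
      then have "c \<bullet> (\<nu> *\<^sub>R jacobi l\<^sub>2 (s (0 + t) - s 0)) = sin t * (c \<bullet> A (1, 1, 0))"
        unfolding nu(2)[symmetric] by simp
      then show ?thesis using c nu by simp
    qed
    then show False using ann c by blast
  next
    case False
    then have l1': "0 < l\<^sub>1" "l\<^sub>1 < 1" using l1 by auto
    let ?T1 = "long_period l\<^sub>1" and ?T2 = "long_period l\<^sub>2"
    let ?U1 = "short_period l\<^sub>1" and ?U2 = "short_period l\<^sub>2"
    have pos: "?T1 > 0" "?T2 > 0" "?U1 > 0" "?U2 > 0" using l1' l2 long_period short_period by auto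
    \<comment> \<open>An advance bounded below at every base point makes \<open>s\<close> unbounded
      in both directions, hence onto.\<close>
    have step: "s (b + 2 * ?T1) - s b \<ge> 2 * ?T2" for b
    proof -
      obtain A where lin: "linear A"
        and m: "\<And>t. \<exists>\<nu>. \<nu> \<noteq> 0 \<and> A (jacobi l\<^sub>1 t) = \<nu> *\<^sub>R jacobi l\<^sub>2 (s (b + t) - s b)"
        using A[of b] by blast
      obtain \<nu> \<nu>' where "A (jacobi l\<^sub>1 ?T1) = \<nu> *\<^sub>R jacobi l\<^sub>2 (s (b + ?T1) - s b)" "\<nu> \<noteq> 0"
        "A (jacobi l\<^sub>1 (2 * ?T1)) = \<nu>' *\<^sub>R jacobi l\<^sub>2 (s (b + 2 * ?T1) - s b)" "\<nu>' \<noteq> 0"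
        using m by meson
      then show ?thesis
        by (rule jacobi_double_transfer(1)[OF l1' l2 lin]) (use pos smono in auto)
    qed
    have Suc_mult: "real (Suc n) * x = real n * x + x" for n x by (simp add: algebra_simps)
    have steps: "s (real n * (2 * ?T1)) \<ge> s 0 + real n * (2 * ?T2)"
      "s (- (real n * (2 * ?T1))) \<le> s 0 - real n * (2 * ?T2)" for n
    proof (induction n)
      case (Suc n)
      show "s (real (Suc n) * (2 * ?T1)) \<ge> s 0 + real (Suc n) * (2 * ?T2)"
        using Suc(1) step[of "real n * (2 * ?T1)"] unfolding Suc_mult by linarith
      have "- (real (Suc n) * (2 * ?T1)) + 2 * ?T1 = - (real n * (2 * ?T1))"
        unfolding Suc_mult by simp
      then have "s (- (real n * (2 * ?T1))) - s (- (real (Suc n) * (2 * ?T1))) \<ge> 2 * ?T2"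
        using step[of "- (real (Suc n) * (2 * ?T1))"] by (simp only:)
      then show "s (- (real (Suc n) * (2 * ?T1))) \<le> s 0 - real (Suc n) * (2 * ?T2)"
        using Suc(2) unfolding Suc_mult[of n "2 * ?T2"] by linarith
    qed simp_all
    have onto: "\<exists>x. s x = y" for y
    proof -
      obtain n :: nat where "\<bar>y - s 0\<bar> / (2 * ?T2) < real n" using reals_Archimedean2 by blast
      then have "\<bar>y - s 0\<bar> < real n * (2 * ?T2)" using pos by (simp only: pos_divide_less_eq) 
      then have "s (- (real n * (2 * ?T1))) \<le> y" "y \<le> s (real n * (2 * ?T1))" using steps[of n] by linarith+
      then show ?thesis
        using IVT'[of s "- (real n * (2 * ?T1))" y "real n * (2 * ?T1)"] continuous_on_subset[OF cont] pos
        by auto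
    qed
    have shift: "s (b + ?T1) = s b + ?T2" "s (b + ?U1) = s b + ?U2" for b
    proof -
      obtain A k where lin: "linear A" and start: "A (1, l\<^sub>1, 0) = k *\<^sub>R (1, l\<^sub>2, 0)"
        and m: "\<And>t. \<exists>\<nu>. \<nu> \<noteq> 0 \<and> A (jacobi l\<^sub>1 t) = \<nu> *\<^sub>R jacobi l\<^sub>2 (s (b + t) - s b)"
        using A[of b] by blast
      have sm: "strict_mono (\<lambda>t. s (b + t) - s b)" using smono by (auto simp: strict_mono_def)
      have sj: "surj (\<lambda>t. s (b + t) - s b)"
      proof (rule surjI)
        fix y show "s (b + ((SOME x. s x = y + s b) - b)) - s b = y"
          using someI_ex[OF onto, of "y + s b"] by simp
      qed
      have s0: "s (b + 0) - s b = 0" by simp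
      interpret jacobi_match l\<^sub>1 l\<^sub>2 "\<lambda>t. s (b + t) - s b" A
        by (rule jacobi_match.intro[OF l1' l2 sm sj s0 lin inj[OF lin m] m])
      show "s (b + ?T1) = s b + ?T2" "s (b + ?U1) = s b + ?U2"
        using match_T[OF ne] match_U[OF ne start] by auto
    qed
    have shifts: "s (real n * ?T1) = s 0 + real n * ?T2" "s (real n * ?U1) = s 0 + real n * ?U2" for n
    proof (induction n)
      case (Suc n)
      show "s (real (Suc n) * ?T1) = s 0 + real (Suc n) * ?T2"
        using Suc(1) shift(1)[of "real n * ?T1"] unfolding Suc_mult by linarith
      show "s (real (Suc n) * ?U1) = s 0 + real (Suc n) * ?U2"
        using Suc(2) shift(2)[of "real n * ?U1"] unfolding Suc_mult by linarith
    qed simp_all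
    \<comment> \<open>Monotonicity compares multiples of the two shifts from the common start 0, so
      the two quotients of periods lie below the same positive rationals.\<close>
    have order: "real m * ?U1 < real n * ?T1 \<longleftrightarrow> real m * ?U2 < real n * ?T2" for m n
      using smono[of "real m * ?U1" "real n * ?T1"] unfolding shifts by linarith
    have q: "?U1 / ?T1 < real n / real m \<longleftrightarrow> ?U2 / ?T2 < real n / real m" if "m > 0" for m n
    proof -
      have "?U1 / ?T1 < real n / real m \<longleftrightarrow> real m * ?U1 < real n * ?T1"
        using that pos by (subst frac_less_eq) (auto simp: field_simps)
      moreover have "?U2 / ?T2 < real n / real m \<longleftrightarrow> real m * ?U2 < real n * ?T2"
        using that pos by (subst frac_less_eq) (auto simp: field_simps)
      ultimately show ?thesis using order by blast
    qed
    have ratio: "?U1 / ?T1 = (1 + l\<^sub>1) / (1 - l\<^sub>1)" "?U2 / ?T2 = (1 + l\<^sub>2) / (1 - l\<^sub>2)"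
      using l1' l2 by (simp_all add: long_period_def short_period_def field_simps)
    have rat: "\<not> x < y" if xy: "0 < x" "0 < y" and
      o: "\<And>m n. m > 0 \<Longrightarrow> x < real n / real m \<longleftrightarrow> y < real n / real m" for x y :: real
    proof
      assume "x < y"
      then obtain z where z: "z \<in> \<rat>" "x < z" "z < y" using Rats_dense_in_real by blast
      then have "z > 0" using xy by linarith
      then obtain m n where "m > 0" "z = real n / real m"
        using z(1) Rats_abs_nat_div_natE[of z] by (metis abs_of_pos gr0I)
      then show False using z o[of m n] by simp
    qed
    have "?U1 / ?T1 = ?U2 / ?T2"
      using rat[of "?U1 / ?T1" "?U2 / ?T2"] rat[of "?U2 / ?T2" "?U1 / ?T1"] q pos
      by (metis divide_pos_pos linorder_neqE_linordered_idom)
    then have "l\<^sub>1 = l\<^sub>2" unfolding ratio using l1' l2 by (simp add: field_simps)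
    then show False using ne by blast
  qed
qed

section \<open>Variations through rolling along great circles\<close>

lemma roll_variation:
  fixes u n :: "real^3"
  shows "((\<lambda>\<theta>. roll r r' (y, y', B) (cos \<theta> *\<^sub>R u + sin \<theta> *\<^sub>R n) \<tau>) has_vector_derivative
    ((r * sin \<tau>) *\<^sub>R n, (r' * sin (r / r' * \<tau>)) *\<^sub>R (B *v n),
     - (outer (B *v u) n + outer (B *v n) u)
     + (outer (roll_dir r' y' (B *v u) (r / r' * \<tau>)) (cos \<tau> *\<^sub>R n)
        + outer (cos (r / r' * \<tau>) *\<^sub>R (B *v n)) (roll_dir r y u \<tau>)))) (at 0)"
proof -
  define U where "U \<theta> = cos \<theta> *\<^sub>R u + sin \<theta> *\<^sub>R n" for \<theta>
  have dU: "(U has_vector_derivative n) (at 0)"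
    unfolding U_def[abs_def] by (auto intro!: derivative_eq_intros)
  have U0: "U 0 = u" by (simp add: U_def)
  have dB: "((\<lambda>\<theta>. B *v U \<theta>) has_vector_derivative B *v n) (at 0)"
    using has_vector_derivative_mult[OF has_vector_derivative_const[of B] dU] by simp
  note sc = bounded_linear.has_vector_derivative[OF bounded_linear_scaleR_right]
  have 1: "((\<lambda>\<theta>. roll_dir r y (U \<theta>) \<tau>) has_vector_derivative cos \<tau> *\<^sub>R n) (at 0)"
    unfolding roll_dir_def using has_vector_derivative_diff[OF sc[OF dU] has_vector_derivative_const] by simp
  have 2: "((\<lambda>\<theta>. roll_dir r' y' (B *v U \<theta>) (r / r' * \<tau>)) has_vector_derivative cos (r / r' * \<tau>) *\<^sub>R (B *v n)) (at 0)"
    unfolding roll_dir_def using has_vector_derivative_diff[OF sc[OF dB] has_vector_derivative_const] by simp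
  have "((\<lambda>\<theta>. roll r r' (y, y', B) (U \<theta>) \<tau>) has_vector_derivative
    (0 + (r * sin \<tau>) *\<^sub>R n, 0 + (r' * sin (r / r' * \<tau>)) *\<^sub>R (B *v n),
     0 - (outer (B *v U 0) n + outer (B *v n) (U 0))
     + (outer (roll_dir r' y' (B *v U 0) (r / r' * \<tau>)) (cos \<tau> *\<^sub>R n)
        + outer (cos (r / r' * \<tau>) *\<^sub>R (B *v n)) (roll_dir r y (U 0) \<tau>)))) (at 0)"
    unfolding roll_def prod.case
    by (intro has_vector_derivative_Pair has_vector_derivative_add has_vector_derivative_diff
        has_vector_derivative_const sc dU dB has_vector_derivative_outer 1 2)
  then show ?thesis by (simp add: U_def[abs_def])
qed

section \<open>Turning the direction of rolling\<close>

context rolled_curve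
begin

lemma c1_0: "c1 0 = (x, x', B)"
  unfolding c1_def by (rule roll_0[OF Q])

definition "normal = (1 / r1) *\<^sub>R cross3 x u"

lemma normal: "x \<bullet> normal = 0" "u \<bullet> normal = 0" "normal \<bullet> normal = 1"
proof -
  show "x \<bullet> normal = 0" "u \<bullet> normal = 0" by (simp_all add: normal_def dot_cross_self)
  show "normal \<bullet> normal = 1"
    unfolding normal_def by (rule cross3_unit[OF M4_D(1)[OF r1 r1' q] r1 uu xu])
qed

lemma normal_d1: "fst (c1 t) \<bullet> normal = 0" "d1 t \<bullet> normal = 0" "snd (snd (c1 t)) *v normal = B *v normal"
  using roll_mult_orthogonal[OF Q normal(1,2)] normal
  by (simp_all add: c1_def roll_def d1_def roll_dir_def inner_add_left inner_diff_left)

text \<open>The variation fields at the base point, up to sign, as a function of the coordinates used for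
  \<open>jacobi\<close>.\<close>

definition lift :: "real \<times> real \<times> real \<Rightarrow> state" where
  "lift z = (r1 * fst z) *\<^sub>R (normal, 0, - ((1 / r1\<^sup>2) *\<^sub>R outer (B *v normal) x))
    + (r1' * fst (snd z)) *\<^sub>R (0, B *v normal, - ((1 / r1'\<^sup>2) *\<^sub>R outer x' normal))
    - snd (snd z) *\<^sub>R (0, 0, outer (B *v normal) u - outer (B *v u) normal)"

lemma linear_lift: "linear lift"
  by (rule linearI) (simp_all add: lift_def algebra_simps)

text \<open>The initial tangent of the projective curve corresponds to the horizontal vector
  orthogonal to the rolling direction. Preservation of the distribution thereby becomes the
  condition on \<open>(1, l, 0)\<close> in the comparison of the curves.\<close>

lemma lift_start: "lift (1, r1 / r1', 0) = hor r1 r1' (x, x', B) (r1 *\<^sub>R normal)"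
  using r1 r1' by (auto simp: lift_def hor_def matrix_vector_mult_scaleR power2_eq_square intro!: matrix_eqI)

text \<open>From \<open>c1 t\<close> the spheres are rolled back for the same time with the
  direction turned by \<theta>. For \<theta> = 0 this returns to the base point.\<close>

definition fan :: "real \<Rightarrow> real \<Rightarrow> state" where
  "fan t \<theta> = roll r1 r1' (c1 t) (cos \<theta> *\<^sub>R d1 t + sin \<theta> *\<^sub>R normal) (- t)"

lemma fan_0: "fan t 0 = (x, x', B)"
  using roll_add[OF Q, of t "-t"] c1_0 by (simp add: fan_def c1_def d1_def)

lemma fan_derivative: "(fan t has_vector_derivative - lift (jacobi (r1 / r1') t)) (at 0)"
proof -
  let ?l = "r1 / r1'"
  obtain y y' C where c: "c1 t = (y, y', C)" by (cases "c1 t") auto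
  have y: "y = cos t *\<^sub>R x + (r1 * sin t) *\<^sub>R u" "y' = cos (?l * t) *\<^sub>R x' + (r1' * sin (?l * t)) *\<^sub>R (B *v u)"
    using c by (simp_all add: c1_def roll_def)
  have Cn: "C *v normal = B *v normal" and Cd: "C *v d1 t = d1' t"
    using normal_d1(3)[of t] c1_mult_d1[of t] by (simp_all add: c)
  have b: "roll_dir r1 y (d1 t) (- t) = u"
    unfolding y d1_def using roll_dir_add[OF Q, of t "- t"] by (simp add: roll_dir_def)
  have b': "roll_dir r1' y' (d1' t) (?l * - t) = B *v u"
  proof -
    have cs: "cos a * cos a + sin a * sin a = 1" for a :: real
      using sin_cos_squared_add[of a] by (simp add: power2_eq_square)
    have "roll_dir r1' y' (d1' t) (?l * - t) = (cos (?l * t) * cos (?l * t)) *\<^sub>R (B *v u) + (sin (?l * t) * sin (?l * t)) *\<^sub>R (B *v u)"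
      using r1' unfolding roll_dir_def d1'_def y by (simp add: algebra_simps)
    then show ?thesis unfolding scaleR_add_left[symmetric] cs by simp
  qed
  have "(fan t has_vector_derivative
    ((r1 * sin (- t)) *\<^sub>R normal, (r1' * sin (?l * - t)) *\<^sub>R (B *v normal),
     - (outer (d1' t) normal + outer (B *v normal) (d1 t))
     + (outer (B *v u) (cos (- t) *\<^sub>R normal) + outer (cos (?l * - t) *\<^sub>R (B *v normal)) u))) (at 0)"
    using roll_variation[of r1 r1' y y' C "d1 t" normal "- t"]
    unfolding Cn Cd b b' by (simp only: fan_def[abs_def] c)
  moreover have "((r1 * sin (- t)) *\<^sub>R normal, (r1' * sin (?l * - t)) *\<^sub>R (B *v normal),
     - (outer (d1' t) normal + outer (B *v normal) (d1 t))
     + (outer (B *v u) (cos (- t) *\<^sub>R normal) + outer (cos (?l * - t) *\<^sub>R (B *v normal)) u)) = - lift (jacobi ?l t)"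
    using r1 r1'
    by (auto simp: lift_def jacobi_def d1_def d1'_def roll_dir_def inner_diff_left power2_eq_square algebra_simps intro!: matrix_eqI)
  ultimately show ?thesis by simp
qed

text \<open>Each turned curve is again a rolled curve, started at \<open>c1 t\<close>, so
  \<open>N2_constant\<close> applies to it. The resulting conditions hold wherever on the image
  great circle the point at parameter \<open>- t\<close> lies, and its normal is linear in the
  direction.\<close>

lemma fan_constraints:
  assumes ne: "r2 \<noteq> r2'"
  defines "wb t \<equiv> fst (dF (c1 t) (hor r1 r1' (c1 t) (r1 *\<^sub>R normal)))"
  defines "N t \<theta> \<equiv> cos \<theta> *\<^sub>R cross3 (X t) (w2 t) + sin \<theta> *\<^sub>R cross3 (X t) (wb t)"
  shows "fan t \<theta> \<in> M4 r1 r1'" "N t \<theta> \<bullet> fst (F (fan t \<theta>)) = 0"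
    "snd (snd (F (fan t \<theta>))) *v N t \<theta> = C t *v N t \<theta>"
    "(C t *v N t \<theta>) \<bullet> fst (snd (F (fan t \<theta>))) = 0"
proof -
  obtain y y' K where c: "c1 t = (y, y', K)" by (cases "c1 t") auto
  define v where "v = cos \<theta> *\<^sub>R d1 t + sin \<theta> *\<^sub>R normal"
  have v: "y \<bullet> v = 0" "v \<bullet> v = 1"
  proof -
    show "y \<bullet> v = 0" using c1_d1[of t] normal_d1(1)[of t] by (simp add: c v_def inner_add_right)
    have "v \<bullet> v = (cos \<theta>)\<^sup>2 + (sin \<theta>)\<^sup>2"
      using normal_d1(2)[of t] by (simp add: v_def inner_add_left inner_add_right d1_unit normal(3) inner_commute[of normal "d1 t"] power2_eq_square)
    then show "v \<bullet> v = 1" by simp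
  qed
  interpret R: rolled_curve r1 r1' r2 r2' F G y y' K v
    by unfold_locales (use c1_M4[of t] c v in auto)
  have R0: "R.c1 0 = c1 t" "R.c2 0 = c2 t" "R.d1 0 = v" "R.X 0 = X t" "R.C 0 = C t"
    by (simp_all add: R.c1_0 R.c2_def c2_def R.d1_def R.X_def X_def R.C_def C_def roll_dir_def c)
  have Rt: "R.c1 (- t) = fan t \<theta>" unfolding R.c1_def fan_def c v_def[symmetric] ..
  have "r1 *\<^sub>R v = cos \<theta> *\<^sub>R (r1 *\<^sub>R d1 t) + sin \<theta> *\<^sub>R (r1 *\<^sub>R normal)"
    by (simp add: v_def algebra_simps)
  then have "R.w2 0 = cos \<theta> *\<^sub>R w2 t + sin \<theta> *\<^sub>R wb t"
    unfolding R.w2_def R0 w2_def wb_def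
    by (simp add: hor_add hor_scaleR linear_add[OF linear_frechet_within[OF F c1_M4]]
        linear_scale[OF linear_frechet_within[OF F c1_M4]])
  then have N: "R.N2 = N t \<theta>"
    by (simp add: R.N2_def R0 N_def cross_add_right cross_mult_right)
  show "fan t \<theta> \<in> M4 r1 r1'" using R.c1_M4[of "- t"] unfolding Rt .
  show "N t \<theta> \<bullet> fst (F (fan t \<theta>)) = 0"
    using R.N2_constant(1)[OF ne, of "- t"] unfolding N R.X_def R.c2_def Rt .
  show C: "snd (snd (F (fan t \<theta>))) *v N t \<theta> = C t *v N t \<theta>"
    using R.N2_constant(3)[OF ne, of "- t"] unfolding N R0(5) R.C_def[of "- t"] R.c2_def Rt .
  have "R.X' (- t) \<bullet> (R.C (- t) *v N t \<theta>) = 0" by (rule R.D2(4))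
  then show "(C t *v N t \<theta>) \<bullet> fst (snd (F (fan t \<theta>))) = 0"
    unfolding C[symmetric] R.X'_def R.C_def R.c2_def Rt by (simp add: inner_commute)
qed

text \<open>Differentiating the three constraints of the fan at \<theta> = 0 gives three linear
  equations for the displacement of the image of the base point. Up to one common factor they say
  that its coordinates form the target curve.\<close>

lemma jacobi_image:
  assumes ne: "r2 \<noteq> r2'" and U: "X 0 \<bullet> U = 0" "U \<bullet> U = 1"
    and roll: "\<And>t. c2 t = roll r2 r2' (c2 0) U (s t)"
    and dir: "\<And>t. \<exists>k>0. w2 t = k *\<^sub>R roll_dir r2 (X 0) U (s t)"
  shows "\<exists>A k. linear A \<and> A (1, r1 / r1', 0) = k *\<^sub>R (1, r2 / r2', 0) \<and>
    (\<forall>t. \<exists>\<nu>. \<nu> \<noteq> 0 \<and> A (jacobi (r1 / r1') t) = \<nu> *\<^sub>R jacobi (r2 / r2') (s t))"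
proof -
  define n where "n = (1 / r2) *\<^sub>R cross3 (X 0) U"
  have Xn: "X 0 \<bullet> n = 0" and Un: "U \<bullet> n = 0" by (simp_all add: n_def dot_cross_self)
  note QU = r2 r2' c2_M4[of 0, unfolded c2_eq] U
  have nn: "n \<bullet> n = 1"
    unfolding n_def by (rule cross3_unit[OF D2(1) r2 U(2,1)])
  \<comment> \<open>The counterpart of the coordinates in \<open>lift\<close>, read off at the image
    state along the normal \<open>n\<close> and the direction \<open>U\<close>.\<close>
  define coord :: "state \<Rightarrow> real \<times> real \<times> real" where
    "coord V = ((n \<bullet> fst V) / r2, ((C 0 *v n) \<bullet> fst (snd V)) / r2', (snd (snd V) *v n) \<bullet> (C 0 *v U))" for V
  have lin_coord: "linear coord"
    by (rule linearI) (simp_all add: coord_def inner_add_right inner_add_left add_divide_distrib)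
  define L where "L = dF (x, x', B)"
  have lin_L: "linear L" unfolding L_def by (rule linear_frechet_within[OF F q])
  define A where "A z = coord (L (lift z))" for z
  have "linear A" unfolding A_def
    using linear_compose[OF linear_lift linear_compose[OF lin_L lin_coord]] by (simp add: o_def)
  moreover have "\<exists>k. A (1, r1 / r1', 0) = k *\<^sub>R (1, r2 / r2', 0)"
  proof -
    have o: "fst (x, x', B) \<bullet> (r1 *\<^sub>R normal) = 0" using normal by simp
    obtain w where w: "fst (F (x, x', B)) \<bullet> w = 0" "L (hor r1 r1' (x, x', B) (r1 *\<^sub>R normal)) = hor r2 r2' (F (x, x', B)) w"
      unfolding L_def by (rule dF_hor[OF q o]) blast
    have F0: "F (x, x', B) = (X 0, X' 0, C 0)" using c2_eq[of 0] by (simp add: c2_def c1_0)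
    have "(C 0 *v n) \<bullet> (C 0 *v w) = n \<bullet> w" by (simp add: D2(5) Xn)
    moreover have "(snd (snd (hor r2 r2' (X 0, X' 0, C 0) w)) *v n) \<bullet> (C 0 *v U) = 0"
      unfolding hor_mult by (simp add: Xn D2(4))
    ultimately have "A (1, r1 / r1', 0) = ((n \<bullet> w) / r2) *\<^sub>R (1, r2 / r2', 0)"
      unfolding A_def lift_start w(2) F0 using r2 by (simp add: coord_def hor_def)
    then show ?thesis by blast
  qed
  moreover have "\<exists>\<nu>. \<nu> \<noteq> 0 \<and> A (jacobi (r1 / r1') t) = \<nu> *\<^sub>R jacobi (r2 / r2') (s t)" for t
  proof -
    let ?l = "r2 / r2'"
    define e where "e = roll_dir r2 (X 0) U (s t)"
    define f where "f = roll_dir r2' (X' 0) (C 0 *v U) (?l * s t)"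
    obtain k where k: "k > 0" "w2 t = k *\<^sub>R e" using dir[of t] by (auto simp: e_def)
    have Xt: "X t = cos (s t) *\<^sub>R X 0 + (r2 * sin (s t)) *\<^sub>R U"
      using roll[of t] unfolding X_def[of t] c2_eq[of 0] by (simp add: roll_def)
    have Ct: "C t = snd (snd (roll r2 r2' (X 0, X' 0, C 0) U (s t)))"
      using roll[of t] unfolding C_def[of t] c2_eq[of 0] by simp
    have Ce: "C t *v e = f" unfolding Ct e_def f_def by (rule roll_mult_dir[OF QU])
    have Cn: "C t *v n = C 0 *v n" unfolding Ct by (rule roll_mult_orthogonal[OF QU Xn Un])
    have C0e: "C 0 *v e = cos (s t) *\<^sub>R (C 0 *v U)" unfolding e_def by (rule roll_dir_facts(3)[OF QU])
    have Xe: "X t \<bullet> e = 0" unfolding Xt e_def by (rule roll_dir_facts(2)[OF QU])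
    have ee: "e \<bullet> e = 1" unfolding e_def by (rule roll_dir_facts(1)[OF QU])
    have X0e: "e \<bullet> X 0 = - (r2 * sin (s t))"
      using r2 U by (simp add: e_def roll_dir_def inner_diff_left D2(1) inner_commute[of U "X 0"] power2_eq_square)
    have ne: "n \<bullet> e = 0" using Xn Un by (simp add: e_def roll_dir_def inner_diff_right inner_commute[of n])
    have Xtn: "X t \<bullet> n = 0" using Xn Un by (simp add: Xt inner_add_left)
    have cXe: "cross3 (X t) e = r2 *\<^sub>R n"
    proof -
      have cs: "cos (s t) * cos (s t) + sin (s t) * sin (s t) = 1"
        using sin_cos_squared_add[of "s t"] by (simp add: power2_eq_square)
      have "cross3 (X t) e = (cos (s t) * cos (s t)) *\<^sub>R cross3 (X 0) U + (sin (s t) * sin (s t)) *\<^sub>R cross3 (X 0) U"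
        unfolding Xt e_def roll_dir_def using r2 cross_skew[of U "X 0"]
        by (simp add: cross_add_left Cross3.right_diff_distrib cross_mult_left cross_mult_right algebra_simps)
      then show ?thesis unfolding scaleR_add_left[symmetric] cs using r2 by (simp add: n_def)
    qed
    define wb where "wb = fst (dF (c1 t) (hor r1 r1' (c1 t) (r1 *\<^sub>R normal)))"
    define \<mu> where "\<mu> = k * r2"
    have \<mu>: "\<mu> \<noteq> 0" using k r2 by (simp add: \<mu>_def)
    have Na: "cross3 (X t) (w2 t) = \<mu> *\<^sub>R n" unfolding k(2) cross_mult_right cXe by (simp add: \<mu>_def)
    define Nb where "Nb = cross3 (X t) wb"
    \<comment> \<open>The rate at which the image great circle turns, which becomes the projective
      factor. Were it zero, the rolling direction and its normal would have dependent horizontal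
      images, contrary to injectivity of the differential.\<close>
    define \<nu> where "\<nu> = Nb \<bullet> e"
    have Nb: "Nb = \<nu> *\<^sub>R e + (Nb \<bullet> n) *\<^sub>R n"
    proof -
      have "Nb - (\<nu> *\<^sub>R e + (Nb \<bullet> n) *\<^sub>R n) = 0"
      proof (rule orthogonal_frame_zero[of "X t" e])
        show "X t \<noteq> 0" "e \<noteq> 0" "X t \<bullet> e = 0" using D2(1)[of t] r2 ee Xe by auto
        show "X t \<bullet> (Nb - (\<nu> *\<^sub>R e + (Nb \<bullet> n) *\<^sub>R n)) = 0"
          by (simp add: inner_diff_right inner_add_right Xe Xtn Nb_def dot_cross_self)
        show "e \<bullet> (Nb - (\<nu> *\<^sub>R e + (Nb \<bullet> n) *\<^sub>R n)) = 0"
          using ne by (simp add: inner_diff_right inner_add_right ee \<nu>_def inner_commute[of e Nb] inner_commute[of e n])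
        show "cross3 (X t) e \<bullet> (Nb - (\<nu> *\<^sub>R e + (Nb \<bullet> n) *\<^sub>R n)) = 0"
          by (simp add: cXe inner_diff_right inner_add_right ne nn inner_commute[of n Nb])
      qed
      then show ?thesis by simp
    qed
    have \<nu>0: "\<nu> \<noteq> 0"
    proof
      assume "\<nu> = 0"
      define c where "c = (Nb \<bullet> n) / \<mu>"
      have "Nb = (c * \<mu>) *\<^sub>R n" using Nb \<open>\<nu> = 0\<close> \<mu> by (simp add: c_def)
      then have cr: "cross3 (X t) (wb - c *\<^sub>R w2 t) = 0"
        using Na by (simp add: Nb_def Cross3.right_diff_distrib cross_mult_right)
      define v where "v = r1 *\<^sub>R normal + (- c) *\<^sub>R (r1 *\<^sub>R d1 t)"
      have v0: "fst (c1 t) \<bullet> v = 0" using normal_d1(1)[of t] c1_d1[of t] by (simp add: v_def inner_diff_right)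
      obtain w where w: "fst (F (c1 t)) \<bullet> w = 0" "dF (c1 t) (hor r1 r1' (c1 t) v) = hor r2 r2' (F (c1 t)) w" "v \<noteq> 0 \<Longrightarrow> w \<noteq> 0"
        by (rule dF_hor[OF c1_M4 v0]) blast
      have "w = fst (dF (c1 t) (hor r1 r1' (c1 t) v))" unfolding w(2) by (simp add: hor_def case_prod_unfold)
      also have "\<dots> = wb - c *\<^sub>R w2 t"
        unfolding v_def hor_add hor_scaleR[of _ _ _ "- c"] wb_def w2_def
        by (simp add: linear_add[OF linear_frechet_within[OF F c1_M4]] linear_scale[OF linear_frechet_within[OF F c1_M4]]
            linear_diff[OF linear_frechet_within[OF F c1_M4]])
      finally have w': "w = wb - c *\<^sub>R w2 t" .
      have "X t \<bullet> w = 0" using w(1) by (simp add: X_def c2_def)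
      then have "X t = 0 \<or> w = 0" using cr norm_and_cross_eq_0 unfolding w' by blast
      then have "w = 0" using D2(1)[of t] r2 by auto
      then have "v = 0" using w(3) by blast
      then have "normal \<bullet> v = 0" by simp
      then show False using normal_d1(2)[of t] r1 by (simp add: v_def inner_diff_right normal(3) inner_commute[of normal "d1 t"])
    qed
    define N where "N \<theta> = cos \<theta> *\<^sub>R (\<mu> *\<^sub>R n) + sin \<theta> *\<^sub>R Nb" for \<theta>
    note con = fan_constraints[OF assms(1), where t = t, folded wb_def, folded Nb_def, unfolded Na, folded N_def]
    define V where "V = L (- lift (jacobi (r1 / r1') t))"
    have dN: "(N has_vector_derivative Nb) (at 0)"
      unfolding N_def[abs_def] by (auto intro!: derivative_eq_intros)
    have N0: "N 0 = \<mu> *\<^sub>R n" by (simp add: N_def)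
    have dFan: "((\<lambda>\<theta>. F (fan t \<theta>)) has_vector_derivative V) (at 0)"
      using derivative_along_curve[OF F open_UNIV UNIV_I _ fan_derivative[of t]] con(1)
      by (auto simp: V_def L_def fan_0)
    have F0: "F (fan t 0) = (X 0, X' 0, C 0)" using c2_eq[of 0] by (simp add: c2_def c1_0 fan_0)
    note d1 = has_vector_derivative_fst[OF dFan] and d2 = has_vector_derivative_fst[OF has_vector_derivative_snd[OF dFan]]
      and d3 = has_vector_derivative_snd[OF has_vector_derivative_snd[OF dFan]]
    have "N 0 \<bullet> fst V + Nb \<bullet> fst (F (fan t 0)) = 0"
      by (rule locally_constant_derivative[OF has_vector_derivative_inner[OF dN d1] open_UNIV UNIV_I]) (rule con(2))
    then have e1: "\<mu> * (n \<bullet> fst V) = \<nu> * (r2 * sin (s t))"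
      using Xn X0e by (subst (asm) Nb) (simp add: N0 F0 inner_add_left inner_commute[of n "X 0"])
    have CN: "((\<lambda>\<theta>. C t *v N \<theta>) has_vector_derivative C t *v Nb) (at 0)"
      using has_vector_derivative_mult[OF has_vector_derivative_const[of "C t"] dN] by simp
    have "(C t *v N 0) \<bullet> fst (snd V) + (C t *v Nb) \<bullet> fst (snd (F (fan t 0))) = 0"
      by (rule locally_constant_derivative[OF has_vector_derivative_inner[OF CN d2] open_UNIV UNIV_I]) (rule con(4))
    moreover have CtNb: "C t *v Nb = \<nu> *\<^sub>R f + (Nb \<bullet> n) *\<^sub>R (C 0 *v n)"
      by (subst Nb) (simp add: matrix_vector_right_distrib matrix_vector_mult_scaleR Ce Cn)
    moreover have "f \<bullet> X' 0 = - (r2' * sin (?l * s t))"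
      using r2' by (simp add: f_def roll_dir_def inner_diff_left D2(2) image_unit(2)[OF QU] power2_eq_square)
    ultimately have e2: "\<mu> * ((C 0 *v n) \<bullet> fst (snd V)) = \<nu> * (r2' * sin (?l * s t))"
      using D2(4)[of 0 n] by (simp add: N0 F0 Cn matrix_vector_mult_scaleR inner_add_left inner_commute[of "C 0 *v n" "X' 0"])
    have "snd (snd (F (fan t 0))) *v Nb + snd (snd V) *v N 0 - C t *v Nb = 0"
    proof (rule locally_constant_derivative[OF _ open_UNIV UNIV_I])
      show "((\<lambda>\<theta>. snd (snd (F (fan t \<theta>))) *v N \<theta> - C t *v N \<theta>) has_vector_derivative
        snd (snd (F (fan t 0))) *v Nb + snd (snd V) *v N 0 - C t *v Nb) (at 0)"
        by (intro has_vector_derivative_diff has_vector_derivative_mult d3 dN CN)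
      show "snd (snd (F (fan t \<theta>))) *v N \<theta> - C t *v N \<theta> = 0" for \<theta> using con(3) by simp
    qed
    then have "\<mu> *\<^sub>R (snd (snd V) *v n) = C t *v Nb - C 0 *v Nb"
      by (simp add: N0 F0 matrix_vector_mult_scaleR algebra_simps)
    also have "C 0 *v Nb = (\<nu> * cos (s t)) *\<^sub>R (C 0 *v U) + (Nb \<bullet> n) *\<^sub>R (C 0 *v n)"
      by (subst Nb) (simp add: matrix_vector_right_distrib matrix_vector_mult_scaleR C0e)
    finally have "\<mu> *\<^sub>R (snd (snd V) *v n) = \<nu> *\<^sub>R f - (\<nu> * cos (s t)) *\<^sub>R (C 0 *v U)"
      unfolding CtNb by simp
    then have "(\<mu> *\<^sub>R (snd (snd V) *v n)) \<bullet> (C 0 *v U) = (\<nu> *\<^sub>R f - (\<nu> * cos (s t)) *\<^sub>R (C 0 *v U)) \<bullet> (C 0 *v U)"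
      by simp
    moreover have "f \<bullet> (C 0 *v U) = cos (?l * s t)"
      by (simp add: f_def roll_dir_def inner_diff_left image_unit[OF QU])
    ultimately have e3: "\<mu> * ((snd (snd V) *v n) \<bullet> (C 0 *v U)) = \<nu> * (cos (?l * s t) - cos (s t))"
      by (simp add: inner_diff_left image_unit[OF QU] right_diff_distrib)
    have "coord V = (\<nu> / \<mu>) *\<^sub>R jacobi ?l (s t)"
      using e1 e2 e3 \<mu> r2 r2' by (simp add: coord_def jacobi_def field_simps)
    moreover have "A (jacobi (r1 / r1') t) = - coord V"
      by (simp add: A_def V_def linear_neg[OF lin_L] linear_neg[OF lin_coord])
    ultimately have "A (jacobi (r1 / r1') t) = (- (\<nu> / \<mu>)) *\<^sub>R jacobi ?l (s t)" by simp
    then show ?thesis using \<nu>0 \<mu> by (intro exI[of _ "- (\<nu> / \<mu>)"]) simp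
  qed
  ultimately show ?thesis by blast
qed

end

section \<open>The ratio of the radii\<close>

context rolling_equivalence
begin

text \<open>The inequality is strict only for the target, where the rigidity argument takes place.
  Equal radii of the source lead to the degenerate curve excluded in
  \<open>jacobi_match_families\<close>.\<close>

lemma ratio_eq:
  assumes "M4 r1 r1' \<noteq> {}" "r1 \<le> r1'" "r2 < r2'"
  shows "r1 / r1' = r2 / r2'"
proof -
  have ne: "r2 \<noteq> r2'" using assms by simp
  obtain x x' B where q: "(x, x', B) \<in> M4 r1 r1'" using assms(1) by (metis ex_in_conv prod.collapse)
  obtain u where u: "x \<bullet> u = 0" "u \<bullet> u = 1" using exists_unit_orthogonal[of x 0] by auto
  interpret R: rolled_curve r1 r1' r2 r2' F G x x' B u
    by unfold_locales (use q u in auto)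
  obtain s where s: "s 0 = 0" "strict_mono s" "continuous_on UNIV s"
    "\<And>t. R.c2 t = roll r2 r2' (R.c2 0) R.u2 (s t)"
    "\<And>t. \<exists>k>0. R.w2 t = k *\<^sub>R roll_dir r2 (R.X 0) R.u2 (s t)"
    using R.image_roll[OF ne] by blast
  show ?thesis
  proof (rule jacobi_match_families[OF _ _ _ _ s(2,3)])
    show "0 < r1 / r1'" "r1 / r1' \<le> 1" "0 < r2 / r2'" "r2 / r2' < 1"
      using r1 r1' r2 r2' assms by simp_all
    fix b
    obtain y y' K where c: "R.c1 b = (y, y', K)" by (cases "R.c1 b") auto
    \<comment> \<open>The same curve restarted at time \<open>b\<close>. By \<open>roll_add\<close>
      on both sides the reparametrization about the new base point is \<open>s\<close>
      recentred.\<close>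
    interpret S: rolled_curve r1 r1' r2 r2' F G y y' K "R.d1 b"
      by unfold_locales (use R.c1_M4[of b] R.c1_d1[of b] R.d1_unit[of b] c in auto)
    have c1: "S.c1 t = R.c1 (b + t)" for t
    proof -
      have "S.c1 t = roll r1 r1' (R.c1 b) (R.d1 b) t" unfolding S.c1_def c ..
      also have "\<dots> = R.c1 (b + t)" unfolding R.c1_def R.d1_def by (rule roll_add[OF R.Q])
      finally show ?thesis .
    qed
    have d1: "S.d1 t = R.d1 (b + t)" for t
    proof -
      have y: "y = cos b *\<^sub>R x + (r1 * sin b) *\<^sub>R u" using c by (simp add: R.c1_def roll_def)
      have "S.d1 t = roll_dir r1 y (R.d1 b) t" by (rule S.d1_def)
      also have "\<dots> = R.d1 (b + t)" unfolding R.d1_def y by (rule roll_dir_add[OF R.Q])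
      finally show ?thesis .
    qed
    have c2: "S.c2 t = R.c2 (b + t)" for t by (simp add: S.c2_def R.c2_def c1)
    have w2: "S.w2 t = R.w2 (b + t)" for t by (simp add: S.w2_def R.w2_def c1 d1)
    define U where "U = roll_dir r2 (R.X 0) R.u2 (s b)"
    have Xb: "R.X b = cos (s b) *\<^sub>R R.X 0 + (r2 * sin (s b)) *\<^sub>R R.u2"
      using s(4)[of b] unfolding R.X_def[of b] R.c2_eq[of 0] by (simp add: roll_def)
    have X: "S.X 0 = R.X b" by (simp add: S.X_def R.X_def c2)
    show "\<exists>A k. linear A \<and> A (1, r1 / r1', 0) = k *\<^sub>R (1, r2 / r2', 0) \<and>
      (\<forall>t. \<exists>\<nu>. \<nu> \<noteq> 0 \<and> A (jacobi (r1 / r1') t) = \<nu> *\<^sub>R jacobi (r2 / r2') (s (b + t) - s b))"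
    proof (rule S.jacobi_image[OF ne])
      show "S.X 0 \<bullet> U = 0" unfolding X Xb U_def by (rule roll_dir_facts(2)[OF R.Q2])
      show "U \<bullet> U = 1" unfolding U_def by (rule roll_dir_facts(1)[OF R.Q2])
      show "S.c2 t = roll r2 r2' (S.c2 0) U (s (b + t) - s b)" for t
        using roll_add[OF R.Q2, of "s b" "s (b + t) - s b"] s(4)[of b] s(4)[of "b + t"]
        unfolding R.c2_eq[of 0] by (simp add: c2 U_def)
      show "\<exists>k>0. S.w2 t = k *\<^sub>R roll_dir r2 (S.X 0) U (s (b + t) - s b)" for t
        using s(5)[of "b + t"] roll_dir_add[OF R.Q2, of "s b" "s (b + t) - s b"]
        by (simp add: w2 X Xb U_def)
    qed
  qed
qed

end

lemma M4_nonempty: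
  assumes r: "r > 0" and r': "r' > 0"
  shows "M4 r r' \<noteq> {}"
proof -
  define z :: "real^3" where "z = axis 1 1"
  have z: "z \<bullet> z = 1" by (simp add: z_def inner_axis)
  have "(r *\<^sub>R z, r' *\<^sub>R z, mat 1 - outer z z) \<in> M4 r r'"
  proof (rule M4_I[OF r r'])
    fix a b
    show "((mat 1 - outer z z) *v a) \<bullet> ((mat 1 - outer z z) *v b)
      = a \<bullet> b - (r *\<^sub>R z \<bullet> a) * (r *\<^sub>R z \<bullet> b) / r\<^sup>2"
      using r z by (simp add: inner_diff_left inner_diff_right power2_eq_square inner_commute[of a z])
  qed (use z in \<open>simp_all add: inner_diff_right power2_eq_square\<close>)
  then show ?thesis by blast
qed

theorem proposition3p5:
  fixes r\<^sub>1 r\<^sub>1' r\<^sub>2 r\<^sub>2' :: real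
  assumes "r\<^sub>1 > 0" "r\<^sub>1' > 0" "r\<^sub>2 > 0" "r\<^sub>2' > 0"
    and "r\<^sub>1' / r\<^sub>1 \<ge> 1" "r\<^sub>2' / r\<^sub>2 \<ge> 1"
    and "r\<^sub>1' / r\<^sub>1 \<noteq> r\<^sub>2' / r\<^sub>2"
  shows "\<not> equivalent_distributions (M4 r\<^sub>1 r\<^sub>1') (D4 r\<^sub>1 r\<^sub>1') (M4 r\<^sub>2 r\<^sub>2') (D4 r\<^sub>2 r\<^sub>2')"
proof
  assume "equivalent_distributions (M4 r\<^sub>1 r\<^sub>1') (D4 r\<^sub>1 r\<^sub>1') (M4 r\<^sub>2 r\<^sub>2') (D4 r\<^sub>2 r\<^sub>2')"
  then obtain F where F: "diffeomorphism (M4 r\<^sub>1 r\<^sub>1') (M4 r\<^sub>2 r\<^sub>2') F"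
    and dF: "\<And>q. q \<in> M4 r\<^sub>1 r\<^sub>1' \<Longrightarrow> frechet_derivative F (at q within M4 r\<^sub>1 r\<^sub>1') ` D4 r\<^sub>1 r\<^sub>1' q = D4 r\<^sub>2 r\<^sub>2' (F q)"
    unfolding equivalent_distributions_def by blast
  have bij: "bij_betw F (M4 r\<^sub>1 r\<^sub>1') (M4 r\<^sub>2 r\<^sub>2')" using F by (simp add: diffeomorphism_def)
  interpret E: rolling_equivalence r\<^sub>1 r\<^sub>1' r\<^sub>2 r\<^sub>2' F "inv_into (M4 r\<^sub>1 r\<^sub>1') F"
    by unfold_locales
      (use assms F dF bij in \<open>auto simp: diffeomorphism_def bij_betw_inv_into_left bij_betw_inv_into_right
          bij_betw_apply bij_betw_apply[OF bij_betw_inv_into]\<close>)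
  interpret E': rolling_equivalence r\<^sub>2 r\<^sub>2' r\<^sub>1 r\<^sub>1' "inv_into (M4 r\<^sub>1 r\<^sub>1') F" F
    by (rule E.reverse)
  have le: "r\<^sub>1 \<le> r\<^sub>1'" "r\<^sub>2 \<le> r\<^sub>2'" using assms by (simp_all add: field_simps)
  have ne: "r\<^sub>1 / r\<^sub>1' \<noteq> r\<^sub>2 / r\<^sub>2'" using assms by (simp add: field_simps)
  show False
  proof (cases "r\<^sub>2 < r\<^sub>2'")
    case True
    then show ?thesis using E.ratio_eq[OF M4_nonempty le(1)] assms ne by blast
  next
    \<comment> \<open>Now the target has equal radii, so by the unequal ratios the source does not,
      and the inverse equivalence is used.\<close>
    case False
    then have "r\<^sub>1 < r\<^sub>1'" using le ne assms by (cases "r\<^sub>1 = r\<^sub>1'") auto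
    then show ?thesis using E'.ratio_eq[OF M4_nonempty le(2)] assms ne by metis
  qed
qed

end
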